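(* Let $A$ be a short local algebra of Hilbert type $(e,a)$ which is not self-injective, and suppose there is a non-zero minimal exact complex $P_\bullet=(P_i,\,d_i\colon P_i\to P_{i-1})_{i\in\mathbb Z}$ of projective $A$-modules. Then $1\le a=e-1$. Also, $M_i=\operatorname{Im}d_i$ is bipartite for $i\ll 0$. Let $t_i=t(P_i)=t(M_i)$. There are $v\in\mathbb Z$ and an integer $t$ such that for all $i\le v$ we have $t_i=t$ and $\operatorname{\mathbf{dim}}M_i=(t,at)$. And there are just two possibilities: Type I. For all $i\in\mathbb Z$, the module $M_i$ is bipartite with $\operatorname{\mathbf{dim}}M_i=(t,at)$ (thus $t_i=t$). Type II. We can choose $v$ in such a way that, first, $t_{i+1}>t_i$ for all $i\ge v$; second, the module $M_{v+1}$ is not bipartite; and third, $|JM_i|<at_i$ for all $i>v$.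
   Context: Let $k$ be a field. All algebras $A$ are finite-dimensional local (not necessarily commutative) $k$-algebras with radical $J$ such that $A/J=k$. $A$ is short if $J^3=0$. $|M|$ denotes the length of a module $M$. Put $e=|J/J^2|$ and $a=|J^2|$; $(e,a)$ is the Hilbert type of the short local algebra $A$. Modules are left $A$-modules of finite length. $A$ is self-injective if ${}_AA$ is injective. For a module $M$, $t(M)=|M/JM|$. If $M$ has Loewy length at most $2$, its dimension vector is $\operatorname{\mathbf{dim}}M=(t(M),|JM|)$. A module $M$ is bipartite if $\operatorname{soc}M=JM$. An exact complex of projective modules is a sequence $\cdots\to P_1\xrightarrow{d_1}P_0\xrightarrow{d_0}P_{-1}\to\cdots$ indexed by $\mathbb Z$ with projective modules $P_i$ and $\operatorname{Im}d_i=\operatorname{Ker}d_{i-1}$ for all $i\in\mathbb Z$. It is minimal if every $d_i$ maps into the radical $JP_{i-1}$ of $P_{i-1}$. *)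

theory Defs
  imports "HOL-Algebra.Module" "HOL-Algebra.QuotRing" "HOL-Algebra.Ideal_Product"
    "HOL-Algebra.Generated_Groups"
begin

section \<open>Left modules over a not necessarily commutative ring\<close>

text \<open>The library locale \<^locale>\<open>module\<close> requires a commutative ring of scalars, so left modules
  over an arbitrary ring are introduced here, on the same record type. As in the library, the
  fields \<^const>\<open>mult\<close> and \<^const>\<open>one\<close> of a module are irrelevant. The library locale
  \<^locale>\<open>submodule\<close> does not involve commutativity and is used as it is.\<close>

locale left_module = R?: ring R + M?: abelian_group M
  for R :: "('a, 'r) ring_scheme" (structure) and M :: "('a, 'm, 's) module_scheme" (structure) +
  assumes smult_closed [simp, intro]:
      "\<lbrakk> a \<in> carrier R; x \<in> carrier M \<rbrakk> \<Longrightarrow> a \<odot>\<^bsub>M\<^esub> x \<in> carrier M"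
    and smult_l_distr:
      "\<lbrakk> a \<in> carrier R; b \<in> carrier R; x \<in> carrier M \<rbrakk> \<Longrightarrow>
      (a \<oplus> b) \<odot>\<^bsub>M\<^esub> x = a \<odot>\<^bsub>M\<^esub> x \<oplus>\<^bsub>M\<^esub> b \<odot>\<^bsub>M\<^esub> x"
    and smult_r_distr:
      "\<lbrakk> a \<in> carrier R; x \<in> carrier M; y \<in> carrier M \<rbrakk> \<Longrightarrow>
      a \<odot>\<^bsub>M\<^esub> (x \<oplus>\<^bsub>M\<^esub> y) = a \<odot>\<^bsub>M\<^esub> x \<oplus>\<^bsub>M\<^esub> a \<odot>\<^bsub>M\<^esub> y"
    and smult_assoc1:
      "\<lbrakk> a \<in> carrier R; b \<in> carrier R; x \<in> carrier M \<rbrakk> \<Longrightarrow>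
      (a \<otimes> b) \<odot>\<^bsub>M\<^esub> x = a \<odot>\<^bsub>M\<^esub> (b \<odot>\<^bsub>M\<^esub> x)"
    and smult_one [simp]:
      "x \<in> carrier M \<Longrightarrow> \<one> \<odot>\<^bsub>M\<^esub> x = x"

definition regular_module :: "('a, 'r) ring_scheme \<Rightarrow> ('a, 'a) module" where
  "regular_module R = \<lparr> carrier = carrier R, mult = mult R, one = one R,
     zero = zero R, add = add R, smult = mult R \<rparr>"

abbreviation sub_module :: "('a, 'm) module \<Rightarrow> 'm set \<Rightarrow> ('a, 'm) module" where
  "sub_module M N \<equiv> M\<lparr> carrier := N \<rparr>"

definition quotient_module :: "('a, 'm) module \<Rightarrow> 'm set \<Rightarrow> ('a, 'm set) module" where
  "quotient_module M N = \<lparr> carrier = a_rcosets\<^bsub>M\<^esub> N, mult = undefined, one = undefined,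
     zero = N, add = set_add M,
     smult = (\<lambda>a X. \<Union>x\<in>X. N +>\<^bsub>M\<^esub> (a \<odot>\<^bsub>M\<^esub> x)) \<rparr>"

definition left_module_hom ::
  "('a, 'r) ring_scheme \<Rightarrow> ('a, 'm) module \<Rightarrow> ('a, 'n) module \<Rightarrow> ('m \<Rightarrow> 'n) set" where
  "left_module_hom R M N = {f \<in> hom (add_monoid M) (add_monoid N).
     \<forall>a \<in> carrier R. \<forall>x \<in> carrier M. f (a \<odot>\<^bsub>M\<^esub> x) = a \<odot>\<^bsub>N\<^esub> f x}"

definition submodule_chain ::
  "('a, 'r) ring_scheme \<Rightarrow> ('a, 'm) module \<Rightarrow> nat \<Rightarrow> (nat \<Rightarrow> 'm set) \<Rightarrow> bool" where
  "submodule_chain R M n c \<longleftrightarrow>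
     (\<forall>i\<le>n. submodule (c i) R M) \<and> (\<forall>i<n. c i \<subset> c (Suc i))"

definition finite_length :: "('a, 'r) ring_scheme \<Rightarrow> ('a, 'm) module \<Rightarrow> bool" where
  "finite_length R M \<longleftrightarrow> (\<exists>b. \<forall>n c. submodule_chain R M n c \<longrightarrow> n \<le> b)"

text \<open>The length is meaningful only for modules satisfying \<^const>\<open>finite_length\<close>.\<close>

definition module_length :: "('a, 'r) ring_scheme \<Rightarrow> ('a, 'm) module \<Rightarrow> nat" where
  "module_length R M = (GREATEST n. \<exists>c. submodule_chain R M n c)"

definition fl_module :: "('a, 'r) ring_scheme \<Rightarrow> ('a, 'm) module \<Rightarrow> bool" where
  "fl_module R M \<longleftrightarrow> left_module R M \<and> finite_length R M"

text \<open>Projectivity and injectivity refer to the category of modules of finite length. The test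
  modules have carriers in the type \<^typ>\<open>nat \<Rightarrow> 'a\<close>, where \<^typ>\<open>'a\<close> is the type of the ring
  elements. This is no restriction: a module of finite length is isomorphic to a quotient of
  some \<open>R\<^sup>n\<close>, hence to a module whose carrier is a set of representatives in \<open>R\<^sup>n\<close>, viewed
  as a set of sequences that vanish from the index \<open>n\<close> on.\<close>

definition projective_module :: "('a, 'r) ring_scheme \<Rightarrow> ('a, 'm) module \<Rightarrow> bool" where
  "projective_module R P \<longleftrightarrow>
     (\<forall>(X :: ('a, nat \<Rightarrow> 'a) module) (Y :: ('a, nat \<Rightarrow> 'a) module) g f.
        fl_module R X \<and> fl_module R Y \<and>
        g \<in> left_module_hom R X Y \<and> g ` carrier X = carrier Y \<and> f \<in> left_module_hom R P Y \<longrightarrow>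
        (\<exists>h \<in> left_module_hom R P X. \<forall>x \<in> carrier P. g (h x) = f x))"

definition injective_module :: "('a, 'r) ring_scheme \<Rightarrow> ('a, 'm) module \<Rightarrow> bool" where
  "injective_module R Q \<longleftrightarrow>
     (\<forall>(X :: ('a, nat \<Rightarrow> 'a) module) (Y :: ('a, nat \<Rightarrow> 'a) module) g f.
        fl_module R X \<and> fl_module R Y \<and>
        g \<in> left_module_hom R X Y \<and> inj_on g (carrier X) \<and> f \<in> left_module_hom R X Q \<longrightarrow>
        (\<exists>h \<in> left_module_hom R Y Q. \<forall>x \<in> carrier X. h (g x) = f x))"

definition self_injective :: "('a, 'r) ring_scheme \<Rightarrow> bool" where
  "self_injective R \<longleftrightarrow> injective_module R (regular_module R)"

definition simple_submodule :: "('a, 'r) ring_scheme \<Rightarrow> ('a, 'm) module \<Rightarrow> 'm set \<Rightarrow> bool" where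
  "simple_submodule R M S \<longleftrightarrow> submodule S R M \<and> S \<noteq> {\<zero>\<^bsub>M\<^esub>} \<and>
     (\<forall>N. submodule N R M \<and> N \<subseteq> S \<longrightarrow> N = {\<zero>\<^bsub>M\<^esub>} \<or> N = S)"

definition socle :: "('a, 'r) ring_scheme \<Rightarrow> ('a, 'm) module \<Rightarrow> 'm set" where
  "socle R M = generate (add_monoid M) (\<Union>{S. simple_submodule R M S})"


section \<open>Short local algebras\<close>

definition maximal_left_ideal :: "('a, 'r) ring_scheme \<Rightarrow> 'a set \<Rightarrow> bool" where
  "maximal_left_ideal R I \<longleftrightarrow> submodule I R (regular_module R) \<and> I \<noteq> carrier R \<and>
     (\<forall>L. submodule L R (regular_module R) \<and> I \<subseteq> L \<longrightarrow> L = I \<or> L = carrier R)"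

definition radical :: "('a, 'r) ring_scheme \<Rightarrow> 'a set" where
  "radical R = carrier R \<inter> \<Inter>{I. maximal_left_ideal R I}"

text \<open>The submodule \<open>JM\<close>, where \<open>J\<close> is the radical of the ring.\<close>

definition rad_mult :: "('a, 'r) ring_scheme \<Rightarrow> ('a, 'm) module \<Rightarrow> 'm set" where
  "rad_mult R M = generate (add_monoid M) {j \<odot>\<^bsub>M\<^esub> x | j x. j \<in> radical R \<and> x \<in> carrier M}"

text \<open>A finite-dimensional algebra \<open>A\<close> over a field \<open>K\<close>: the record \<open>A\<close> carries both its ring
  structure and the scalar multiplication by elements of \<open>K\<close>.\<close>

locale fd_algebra = module K A + K: field K + A: ring A
  for K :: "('k, 'r) ring_scheme" (structure) and A :: "('k, 'a, 's) module_scheme" (structure) +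
  assumes smult_mult_left:
      "\<lbrakk> c \<in> carrier K; x \<in> carrier A; y \<in> carrier A \<rbrakk> \<Longrightarrow>
      (c \<odot>\<^bsub>A\<^esub> x) \<otimes>\<^bsub>A\<^esub> y = c \<odot>\<^bsub>A\<^esub> (x \<otimes>\<^bsub>A\<^esub> y)"
    and smult_mult_right:
      "\<lbrakk> c \<in> carrier K; x \<in> carrier A; y \<in> carrier A \<rbrakk> \<Longrightarrow>
      x \<otimes>\<^bsub>A\<^esub> (c \<odot>\<^bsub>A\<^esub> y) = c \<odot>\<^bsub>A\<^esub> (x \<otimes>\<^bsub>A\<^esub> y)"
    and finite_dim:
      "\<exists>B. finite B \<and> B \<subseteq> carrier A \<and>
        (\<forall>x \<in> carrier A. \<exists>c \<in> B \<rightarrow> carrier K. x = (\<Oplus>\<^bsub>A\<^esub>b\<in>B. c b \<odot>\<^bsub>A\<^esub> b))"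

text \<open>The condition \<open>A/J = k\<close> says that the structure map from \<open>k\<close> to \<open>A/J\<close> is an
  isomorphism.\<close>

locale local_algebra = fd_algebra +
  assumes unique_maximal: "\<exists>!I. maximal_left_ideal A I"
    and residue_field:
      "(\<lambda>c. radical A +>\<^bsub>A\<^esub> (c \<odot>\<^bsub>A\<^esub> \<one>\<^bsub>A\<^esub>)) \<in> ring_iso K (A Quot radical A)"

locale short_local_algebra = local_algebra +
  assumes rad_cube: "radical A \<cdot>\<^bsub>A\<^esub> radical A \<cdot>\<^bsub>A\<^esub> radical A = {\<zero>\<^bsub>A\<^esub>}"

text \<open>The pair \<open>(e, a)\<close> with \<open>e\<close> the length of \<open>J/J\<^sup>2\<close> and \<open>a\<close> the length of \<open>J\<^sup>2\<close>.\<close>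

definition hilbert_type :: "('a, 'r) ring_scheme \<Rightarrow> nat \<times> nat" where
  "hilbert_type R =
    (let J = radical R; J2 = J \<cdot>\<^bsub>R\<^esub> J in
     (module_length R (quotient_module (sub_module (regular_module R) J) J2),
      module_length R (sub_module (regular_module R) J2)))"

definition top_length :: "('a, 'r) ring_scheme \<Rightarrow> ('a, 'm) module \<Rightarrow> nat" where
  "top_length R M = module_length R (quotient_module M (rad_mult R M))"

definition rad_length :: "('a, 'r) ring_scheme \<Rightarrow> ('a, 'm) module \<Rightarrow> nat" where
  "rad_length R M = module_length R (sub_module M (rad_mult R M))"

text \<open>The dimension vector is only defined for modules of Loewy length at most 2, that is, those
  with \<open>J(JM) = 0\<close>; an equation between a dimension vector and a pair of numbers is therefore
  provable only in this case.\<close>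

definition dim_vector :: "('a, 'r) ring_scheme \<Rightarrow> ('a, 'm) module \<Rightarrow> nat \<times> nat" where
  "dim_vector R M =
     (if rad_mult R (sub_module M (rad_mult R M)) = {\<zero>\<^bsub>M\<^esub>}
      then (top_length R M, rad_length R M) else undefined)"

definition bipartite :: "('a, 'r) ring_scheme \<Rightarrow> ('a, 'm) module \<Rightarrow> bool" where
  "bipartite R M \<longleftrightarrow> socle R M = rad_mult R M"


section \<open>Exact complexes of projective modules\<close>

definition exact_projective_complex ::
  "('a, 'r) ring_scheme \<Rightarrow> (int \<Rightarrow> ('a, 'm) module) \<Rightarrow> (int \<Rightarrow> 'm \<Rightarrow> 'm) \<Rightarrow> bool" where
  "exact_projective_complex R P d \<longleftrightarrow>
     (\<forall>i. fl_module R (P i) \<and> projective_module R (P i) \<and>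
          d i \<in> left_module_hom R (P i) (P (i - 1)) \<and>
          d i ` carrier (P i) = a_kernel (P (i - 1)) (P (i - 2)) (d (i - 1)))"

definition minimal_complex ::
  "('a, 'r) ring_scheme \<Rightarrow> (int \<Rightarrow> ('a, 'm) module) \<Rightarrow> (int \<Rightarrow> 'm \<Rightarrow> 'm) \<Rightarrow> bool" where
  "minimal_complex R P d \<longleftrightarrow> (\<forall>i. d i ` carrier (P i) \<subseteq> rad_mult R (P (i - 1)))"

definition nonzero_complex :: "(int \<Rightarrow> ('a, 'm) module) \<Rightarrow> bool" where
  "nonzero_complex P \<longleftrightarrow> (\<exists>i. carrier (P i) \<noteq> {\<zero>\<^bsub>P i\<^esub>})"

text \<open>The image of \<open>d i\<close>, as a submodule of \<open>P (i - 1)\<close>.\<close>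

definition image_module ::
  "(int \<Rightarrow> ('a, 'm) module) \<Rightarrow> (int \<Rightarrow> 'm \<Rightarrow> 'm) \<Rightarrow> int \<Rightarrow> ('a, 'm) module" where
  "image_module P d i = sub_module (P (i - 1)) (d i ` carrier (P i))"

end

theory Submission
  imports Defs
begin

text \<open>
  Write \<open>t\<^sub>i = t(M\<^sub>i)\<close> and \<open>r\<^sub>i = |JM\<^sub>i|\<close>. A projective module has the length of a free one
  (\<open>projective_length\<close>), and minimality puts \<open>M\<^sub>i\<close> into \<open>JP\<^sub>i\<^sub>-\<^sub>1\<close>, so that
  \<open>JM\<^sub>i \<subseteq> J\<^sup>2P\<^sub>i\<^sub>-\<^sub>1 \<subseteq> M\<^sub>i\<close>. Let the defect \<open>s\<^sub>i = a t\<^sub>i\<^sub>-\<^sub>1 - r\<^sub>i \<ge> 0\<close> be the length of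
  \<open>J\<^sup>2P\<^sub>i\<^sub>-\<^sub>1/JM\<^sub>i\<close>. The lengths in \<open>0 \<rightarrow> M\<^sub>i\<^sub>+\<^sub>1 \<rightarrow> P\<^sub>i \<rightarrow> M\<^sub>i \<rightarrow> 0\<close> give
  \<open>t\<^sub>i\<^sub>+\<^sub>1 = e t\<^sub>i - a t\<^sub>i\<^sub>-\<^sub>1 + s\<^sub>i + s\<^sub>i\<^sub>+\<^sub>1\<close>. If \<open>M\<^sub>i\<close> is bipartite, then \<open>s\<^sub>i = 0\<close>. The rest is a study of
  the positive integers \<open>t\<^sub>i\<close> for \<open>i \<rightarrow> -\<infinity>\<close>, where they cannot increase strictly for ever.

  First, \<open>1 \<le> a < e\<close>. Indeed, \<open>JM\<^sub>i\<close> comes from the generators of \<open>M\<^sub>i\<close> outside \<open>J\<^sup>2P\<^sub>i\<^sub>-\<^sub>1\<close>, so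
  \<open>a t\<^sub>i\<^sub>-\<^sub>1 \<le> e t\<^sub>i - (e - 1) s\<^sub>i\<close>; for \<open>a \<ge> e\<close>, as for \<open>a = 0\<close>, this or the recurrence leads to
  strictly increasing \<open>t\<^sub>i\<close> or to \<open>t\<^sub>i = 0\<close>. The small cases \<open>(e, a) = (1, 0)\<close> and \<open>(1, 1)\<close> escape
  this argument, but there the algebra is self-injective.

  Next, if \<open>M\<^sub>i\<close> is not bipartite, it has a simple direct summand (\<open>simple_summand\<close>). Decompositions
  pass to syzygies (\<open>kernel_decomposition\<close>), and as \<open>a < e\<close> the Betti numbers of the simple module
  increase strictly; hence \<open>t\<^sub>i\<^sub>+\<^sub>n > n\<close> for all \<open>n\<close>. Looking at a fixed index \<open>i + n\<close>, one sees that
  \<open>M\<^sub>i\<close> is bipartite for \<open>i \<ll> 0\<close>. There \<open>t\<^sub>i\<^sub>+\<^sub>1 = e t\<^sub>i - a t\<^sub>i\<^sub>-\<^sub>1\<close>.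

  If \<open>a > 1\<close>, divisibility shows that a sequence of positive integers satisfying this recurrence as
  \<open>i \<rightarrow> -\<infinity>\<close> is geometric with integral ratio (\<open>nondecreasing_to_the_left\<close>). If \<open>a = 1\<close>, then, as
  \<open>A\<close> is not self-injective, the form \<open>J/J\<^sup>2 \<times> J/J\<^sup>2 \<rightarrow> J\<^sup>2\<close> given by multiplication is degenerate: a
  non-degenerate one makes \<open>A\<close> a Frobenius algebra (\<open>frobenius_form.self_injective\<close>). So \<open>xJ = 0\<close>
  for some \<open>x \<in> J - J\<^sup>2\<close>, and \<open>xP\<^sub>i\<close> provides \<open>t\<^sub>i\<close> generators of \<open>M\<^sub>i\<^sub>+\<^sub>1\<close> (\<open>nondecreasing\<close>). In both
  cases \<open>t\<^sub>i \<le> t\<^sub>i\<^sub>+\<^sub>1\<close> for \<open>i \<ll> 0\<close>. Therefore \<open>t\<^sub>i\<close> is constant for \<open>i \<ll> 0\<close>, and the recurrence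
  gives \<open>e = a + 1\<close>.

  Finally \<open>t\<^sub>i\<^sub>+\<^sub>1 - t\<^sub>i = a (t\<^sub>i - t\<^sub>i\<^sub>-\<^sub>1) + s\<^sub>i + s\<^sub>i\<^sub>+\<^sub>1\<close>. So \<open>t\<^sub>i\<close> is either constant, and then all
  \<open>M\<^sub>i\<close> are bipartite because a non-bipartite one would make \<open>t\<^sub>i\<close> unbounded; or it is constant up to some
  \<open>v\<close> with \<open>s\<^sub>v\<^sub>+\<^sub>1 > 0\<close> and strictly increasing from there on.
\<close>


section \<open>The lattice of submodules\<close>

text \<open>Lengths are defined for module records without further fields.\<close>

locale plain_left_module = left_module R M
  for R :: "('a, 'r) ring_scheme" (structure) and M :: "('a, 'm) module" (structure)

context plain_left_module
begin

lemma smult_l_null [simp]: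
  assumes x: "x \<in> carrier M"
  shows "\<zero> \<odot>\<^bsub>M\<^esub> x = \<zero>\<^bsub>M\<^esub>"
proof -
  have "\<zero> \<odot>\<^bsub>M\<^esub> x \<oplus>\<^bsub>M\<^esub> \<zero> \<odot>\<^bsub>M\<^esub> x = \<zero> \<odot>\<^bsub>M\<^esub> x"
    using smult_l_distr[of \<zero> \<zero> x] x by simp
  then show ?thesis using x by (metis M.add.r_cancel_one' R.zero_closed smult_closed)
qed

lemma smult_r_null [simp]:
  assumes a: "a \<in> carrier R"
  shows "a \<odot>\<^bsub>M\<^esub> \<zero>\<^bsub>M\<^esub> = \<zero>\<^bsub>M\<^esub>"
proof -
  have "a \<odot>\<^bsub>M\<^esub> \<zero>\<^bsub>M\<^esub> \<oplus>\<^bsub>M\<^esub> a \<odot>\<^bsub>M\<^esub> \<zero>\<^bsub>M\<^esub> = a \<odot>\<^bsub>M\<^esub> \<zero>\<^bsub>M\<^esub>"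
    using smult_r_distr[of a "\<zero>\<^bsub>M\<^esub>" "\<zero>\<^bsub>M\<^esub>"] a by simp
  then show ?thesis using a by (metis M.add.r_cancel_one' M.zero_closed smult_closed)
qed

lemma smult_l_minus:
  assumes a: "a \<in> carrier R" and x: "x \<in> carrier M"
  shows "(\<ominus> a) \<odot>\<^bsub>M\<^esub> x = \<ominus>\<^bsub>M\<^esub> (a \<odot>\<^bsub>M\<^esub> x)"
proof -
  have "(\<ominus> a) \<odot>\<^bsub>M\<^esub> x \<oplus>\<^bsub>M\<^esub> a \<odot>\<^bsub>M\<^esub> x = \<zero>\<^bsub>M\<^esub>"
    using smult_l_distr[of "\<ominus> a" a x] a x by (simp add: R.l_neg)
  then show ?thesis using a x by (simp add: M.minus_equality)
qed

lemma smult_r_minus: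
  assumes a: "a \<in> carrier R" and x: "x \<in> carrier M"
  shows "a \<odot>\<^bsub>M\<^esub> (\<ominus>\<^bsub>M\<^esub> x) = \<ominus>\<^bsub>M\<^esub> (a \<odot>\<^bsub>M\<^esub> x)"
proof -
  have "a \<odot>\<^bsub>M\<^esub> (\<ominus>\<^bsub>M\<^esub> x) \<oplus>\<^bsub>M\<^esub> a \<odot>\<^bsub>M\<^esub> x = \<zero>\<^bsub>M\<^esub>"
    using smult_r_distr[of a "\<ominus>\<^bsub>M\<^esub> x" x] a x by (simp add: M.l_neg)
  then show ?thesis using a x by (simp add: M.minus_equality)
qed

lemma submoduleI:
  assumes sub: "N \<subseteq> carrier M" and zero: "\<zero>\<^bsub>M\<^esub> \<in> N"
    and add: "\<And>x y. \<lbrakk>x \<in> N; y \<in> N\<rbrakk> \<Longrightarrow> x \<oplus>\<^bsub>M\<^esub> y \<in> N"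
    and smult: "\<And>a x. \<lbrakk>a \<in> carrier R; x \<in> N\<rbrakk> \<Longrightarrow> a \<odot>\<^bsub>M\<^esub> x \<in> N"
  shows "submodule N R M"
proof -
  have "\<ominus>\<^bsub>M\<^esub> x \<in> N" if "x \<in> N" for x
    using smult[of "\<ominus> \<one>" x] that sub smult_l_minus[of \<one> x] by auto
  then show ?thesis
    using assms by (intro submodule.intro subgroup.intro submodule_axioms.intro)
      (auto simp: a_inv_def)
qed

lemma submoduleD:
  assumes "submodule N R M"
  shows submodule_subset: "N \<subseteq> carrier M"
    and submodule_zero: "\<zero>\<^bsub>M\<^esub> \<in> N"
    and submodule_add: "\<And>x y. \<lbrakk>x \<in> N; y \<in> N\<rbrakk> \<Longrightarrow> x \<oplus>\<^bsub>M\<^esub> y \<in> N"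
    and submodule_smult: "\<And>a x. \<lbrakk>a \<in> carrier R; x \<in> N\<rbrakk> \<Longrightarrow> a \<odot>\<^bsub>M\<^esub> x \<in> N"
    and submodule_a_inv: "\<And>x. x \<in> N \<Longrightarrow> \<ominus>\<^bsub>M\<^esub> x \<in> N"
proof -
  interpret N: submodule N R M by fact
  show "N \<subseteq> carrier M" "\<zero>\<^bsub>M\<^esub> \<in> N"
    using N.subset N.one_closed by auto
  show "\<And>x y. \<lbrakk>x \<in> N; y \<in> N\<rbrakk> \<Longrightarrow> x \<oplus>\<^bsub>M\<^esub> y \<in> N"
    using N.m_closed by auto
  show "\<And>a x. \<lbrakk>a \<in> carrier R; x \<in> N\<rbrakk> \<Longrightarrow> a \<odot>\<^bsub>M\<^esub> x \<in> N"
    by simp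
  show "\<And>x. x \<in> N \<Longrightarrow> \<ominus>\<^bsub>M\<^esub> x \<in> N"
    using N.m_inv_closed by (auto simp: a_inv_def)
qed

lemma submodule_add_cancel:
  assumes N: "submodule N R M" and x: "x \<in> N" and y: "y \<in> carrier M"
    and xy: "x \<oplus>\<^bsub>M\<^esub> y \<in> N"
  shows "y \<in> N"
proof -
  have "\<ominus>\<^bsub>M\<^esub> x \<oplus>\<^bsub>M\<^esub> (x \<oplus>\<^bsub>M\<^esub> y) \<in> N"
    using submoduleD[OF N] x xy by auto
  then show ?thesis
    using submodule_subset[OF N] x y by (simp add: subsetD M.r_neg1)
qed

lemma submodule_carrier: "submodule (carrier M) R M"
  by (rule submoduleI) auto

lemma submodule_0: "submodule {\<zero>\<^bsub>M\<^esub>} R M"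
  by (rule submoduleI) auto

lemma submodule_inter:
  "\<lbrakk>submodule N R M; submodule L R M\<rbrakk> \<Longrightarrow> submodule (N \<inter> L) R M"
  by (rule submoduleI) (auto simp: submodule_zero submodule_add submodule_smult dest: submodule_subset)

lemma mem_set_add: "x \<in> N <+>\<^bsub>M\<^esub> L \<longleftrightarrow> (\<exists>n\<in>N. \<exists>l\<in>L. x = n \<oplus>\<^bsub>M\<^esub> l)"
  by (auto simp: set_add_def')

lemma submodule_set_add:
  assumes N: "submodule N R M" and L: "submodule L R M"
  shows "submodule (N <+>\<^bsub>M\<^esub> L) R M"
proof (rule submoduleI)
  note nd = submoduleD[OF N] and ld = submoduleD[OF L]
  have nc: "x \<in> carrier M" if "x \<in> N" for x using nd(1) that by auto
  have lc: "x \<in> carrier M" if "x \<in> L" for x using ld(1) that by auto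
  show "N <+>\<^bsub>M\<^esub> L \<subseteq> carrier M" using nc lc by (auto simp: mem_set_add)
  show "\<zero>\<^bsub>M\<^esub> \<in> N <+>\<^bsub>M\<^esub> L"
    unfolding mem_set_add
    using nd(2) ld(2) by (intro bexI[of _ "\<zero>\<^bsub>M\<^esub>"]) auto
  show "x \<oplus>\<^bsub>M\<^esub> y \<in> N <+>\<^bsub>M\<^esub> L" if x: "x \<in> N <+>\<^bsub>M\<^esub> L" and y: "y \<in> N <+>\<^bsub>M\<^esub> L" for x y
  proof -
    obtain n l n' l' where *: "n \<in> N" "l \<in> L" "n' \<in> N" "l' \<in> L"
      and e: "x = n \<oplus>\<^bsub>M\<^esub> l" "y = n' \<oplus>\<^bsub>M\<^esub> l'"
      using x y by (auto simp: mem_set_add)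
    have "x \<oplus>\<^bsub>M\<^esub> y = (n \<oplus>\<^bsub>M\<^esub> n') \<oplus>\<^bsub>M\<^esub> (l \<oplus>\<^bsub>M\<^esub> l')"
      using * nc lc e by (simp add: M.a_ac)
    moreover have "n \<oplus>\<^bsub>M\<^esub> n' \<in> N" "l \<oplus>\<^bsub>M\<^esub> l' \<in> L" using * nd(3) ld(3) by auto
    ultimately show ?thesis by (auto simp: mem_set_add)
  qed
  show "a \<odot>\<^bsub>M\<^esub> x \<in> N <+>\<^bsub>M\<^esub> L" if a: "a \<in> carrier R" and x: "x \<in> N <+>\<^bsub>M\<^esub> L" for a x
  proof -
    obtain n l where *: "n \<in> N" "l \<in> L" and e: "x = n \<oplus>\<^bsub>M\<^esub> l"
      using x by (auto simp: mem_set_add)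
    have "a \<odot>\<^bsub>M\<^esub> x = a \<odot>\<^bsub>M\<^esub> n \<oplus>\<^bsub>M\<^esub> a \<odot>\<^bsub>M\<^esub> l"
      using * nc lc e a by (simp add: smult_r_distr)
    moreover have "a \<odot>\<^bsub>M\<^esub> n \<in> N" "a \<odot>\<^bsub>M\<^esub> l \<in> L" using * nd(4) ld(4) a by auto
    ultimately show ?thesis by (auto simp: mem_set_add)
  qed
qed

lemma set_add_upper1:
  "\<lbrakk>submodule N R M; submodule L R M\<rbrakk> \<Longrightarrow> N \<subseteq> N <+>\<^bsub>M\<^esub> L"
  by (rule subsetI, unfold mem_set_add, rule bexI, rule bexI[of _ "\<zero>\<^bsub>M\<^esub>"])
    (auto simp: submodule_zero subsetD[OF submodule_subset])

lemma set_add_upper2: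
  "\<lbrakk>submodule N R M; submodule L R M\<rbrakk> \<Longrightarrow> L \<subseteq> N <+>\<^bsub>M\<^esub> L"
  by (rule subsetI, unfold mem_set_add, rule bexI[of _ "\<zero>\<^bsub>M\<^esub>"], rule bexI)
    (auto simp: submodule_zero subsetD[OF submodule_subset])

lemma set_add_least:
  "\<lbrakk>submodule X R M; N \<subseteq> X; L \<subseteq> X\<rbrakk> \<Longrightarrow> N <+>\<^bsub>M\<^esub> L \<subseteq> X"
  by (auto simp: mem_set_add submodule_add subset_iff)

lemma set_add_mono: "\<lbrakk>N \<subseteq> N'; L \<subseteq> L'\<rbrakk> \<Longrightarrow> N <+>\<^bsub>M\<^esub> L \<subseteq> N' <+>\<^bsub>M\<^esub> L'"
  unfolding set_add_def' by blast

lemma set_add_absorb: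
  "\<lbrakk>submodule N R M; submodule L R M; L \<subseteq> N\<rbrakk> \<Longrightarrow> N <+>\<^bsub>M\<^esub> L = N"
  by (intro equalityI set_add_least set_add_upper1) auto

lemma set_add_commute:
  "\<lbrakk>N \<subseteq> carrier M; L \<subseteq> carrier M\<rbrakk> \<Longrightarrow> N <+>\<^bsub>M\<^esub> L = L <+>\<^bsub>M\<^esub> N"
  unfolding set_add_def' by (fastforce simp: M.a_comm subset_iff)

lemma set_add_zero: "N \<subseteq> carrier M \<Longrightarrow> {\<zero>\<^bsub>M\<^esub>} <+>\<^bsub>M\<^esub> N = N"
  unfolding set_add_def' by (fastforce simp: subset_iff)

lemma set_add_assoc:
  assumes "N \<subseteq> carrier M" "L \<subseteq> carrier M" "X \<subseteq> carrier M"
  shows "(N <+>\<^bsub>M\<^esub> L) <+>\<^bsub>M\<^esub> X = N <+>\<^bsub>M\<^esub> (L <+>\<^bsub>M\<^esub> X)"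
  using assms M.add.set_mult_assoc by (simp add: set_add_def)

lemma modular_law:
  assumes "submodule X R M" "submodule Y R M" "submodule Z R M" and XZ: "X \<subseteq> Z"
  shows "(X <+>\<^bsub>M\<^esub> Y) \<inter> Z = X <+>\<^bsub>M\<^esub> (Y \<inter> Z)"
proof
  show "(X <+>\<^bsub>M\<^esub> Y) \<inter> Z \<subseteq> X <+>\<^bsub>M\<^esub> (Y \<inter> Z)"
  proof
    fix u assume u: "u \<in> (X <+>\<^bsub>M\<^esub> Y) \<inter> Z"
    then obtain x y where xy: "x \<in> X" "y \<in> Y" "u = x \<oplus>\<^bsub>M\<^esub> y" by (auto simp: mem_set_add)
    then have "y \<in> Z"
      using submodule_add_cancel[OF assms(3), of x y] u XZ submodule_subset[OF assms(2)] by auto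
    then show "u \<in> X <+>\<^bsub>M\<^esub> (Y \<inter> Z)" using xy by (auto simp: mem_set_add)
  qed
  show "X <+>\<^bsub>M\<^esub> (Y \<inter> Z) \<subseteq> (X <+>\<^bsub>M\<^esub> Y) \<inter> Z"
    using set_add_mono[of X X "Y \<inter> Z" Y] set_add_least[OF assms(3), of X "Y \<inter> Z"] XZ by auto
qed

text \<open>Over a field such a submodule \<open>H\<close> is a hyperplane, and over a local ring, if it contains the
  radical of the module, it still has \<open>R u\<close> as a supplement: as \<open>u \<in> H + R y\<close> for every
  \<open>y \<notin> H\<close>, a unit multiple of \<open>y\<close> lies in \<open>H + R u\<close>. Functionals are extended, and simple
  summands split off, in this way.\<close>

lemma maximal_submodule_avoiding:
  assumes N: "submodule N R M" and u: "u \<notin> N"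
  obtains H where "submodule H R M" "N \<subseteq> H" "u \<notin> H"
    "\<And>X. \<lbrakk>submodule X R M; H \<subset> X\<rbrakk> \<Longrightarrow> u \<in> X"
proof -
  let ?S = "{X. submodule X R M \<and> N \<subseteq> X \<and> u \<notin> X}"
  have "\<exists>H\<in>?S. \<forall>X\<in>?S. H \<subseteq> X \<longrightarrow> X = H"
  proof (rule subset_Zorn_nonempty)
    show "?S \<noteq> {}" using assms by auto
    fix C assume C: "C \<noteq> {}" "subset.chain ?S C"
    have cs: "X \<in> ?S" if "X \<in> C" for X using C that by (auto simp: subset.chain_def)
    have lin: "X \<subseteq> Y \<or> Y \<subseteq> X" if "X \<in> C" "Y \<in> C" for X Y
      using C that by (auto simp: subset.chain_def)
    obtain X0 where X0: "X0 \<in> C" using C by auto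
    have "submodule (\<Union>C) R M"
    proof (rule submoduleI)
      show "\<Union>C \<subseteq> carrier M" using cs submodule_subset by blast
      show "\<zero>\<^bsub>M\<^esub> \<in> \<Union>C" using cs[OF X0] X0 submodule_zero by blast
      show "a \<odot>\<^bsub>M\<^esub> x \<in> \<Union>C" if a: "a \<in> carrier R" and x: "x \<in> \<Union>C" for a x
      proof -
        obtain X where "X \<in> C" "x \<in> X" using x by auto
        then show ?thesis using submodule_smult[of X a x] cs a by blast
      qed
      show "x \<oplus>\<^bsub>M\<^esub> y \<in> \<Union>C" if xy: "x \<in> \<Union>C" "y \<in> \<Union>C" for x y
      proof -
        obtain X Y where *: "X \<in> C" "x \<in> X" "Y \<in> C" "y \<in> Y" using xy by auto
        then obtain Z where "Z \<in> C" "x \<in> Z" "y \<in> Z" using lin[of X Y] by auto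
        then show ?thesis using submodule_add[of Z x y] cs by blast
      qed
    qed
    then show "\<Union>C \<in> ?S" using cs X0 by auto
  qed
  then obtain H where H: "H \<in> ?S" and max: "\<forall>X\<in>?S. H \<subseteq> X \<longrightarrow> X = H" by (rule bexE)
  show thesis
  proof (rule that[of H])
    show "u \<in> X" if X: "submodule X R M" "H \<subset> X" for X
    proof (rule ccontr)
      assume "u \<notin> X"
      then have "X \<in> ?S" using X H by auto
      then show False using max X(2) by auto
    qed
  qed (use H in auto)
qed

end


section \<open>Length of intervals of submodules\<close>

text \<open>Lengths of quotients \<open>L/N\<close> are handled without forming quotients, as lengths of chains
  between two submodules of one fixed module.\<close>

definition interval_chain ::
  "('a, 'r) ring_scheme \<Rightarrow> ('a, 'm) module \<Rightarrow> 'm set \<Rightarrow> 'm set \<Rightarrow> nat \<Rightarrow> (nat \<Rightarrow> 'm set) \<Rightarrow> bool" where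
  "interval_chain R M N L n c \<longleftrightarrow> submodule_chain R M n c \<and> N \<subseteq> c 0 \<and> c n \<subseteq> L"

definition finite_interval ::
  "('a, 'r) ring_scheme \<Rightarrow> ('a, 'm) module \<Rightarrow> 'm set \<Rightarrow> 'm set \<Rightarrow> bool" where
  "finite_interval R M N L \<longleftrightarrow> (\<exists>b. \<forall>n c. interval_chain R M N L n c \<longrightarrow> n \<le> b)"

definition interval_length ::
  "('a, 'r) ring_scheme \<Rightarrow> ('a, 'm) module \<Rightarrow> 'm set \<Rightarrow> 'm set \<Rightarrow> nat" where
  "interval_length R M N L = (GREATEST n. \<exists>c. interval_chain R M N L n c)"

lemma finite_length_finite_interval:
  "finite_length R M \<Longrightarrow> finite_interval R M N L"
  unfolding finite_length_def finite_interval_def interval_chain_def by blast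

lemma finite_interval_subset:
  "\<lbrakk>finite_interval R M N L; N \<subseteq> N'; L' \<subseteq> L\<rbrakk> \<Longrightarrow> finite_interval R M N' L'"
  unfolding finite_interval_def interval_chain_def by (meson subset_trans)

lemma interval_chain_le:
  assumes "finite_interval R M N L" and "interval_chain R M N L n c"
  shows "n \<le> interval_length R M N L"
proof -
  obtain b where b: "\<forall>n c. interval_chain R M N L n c \<longrightarrow> n \<le> b"
    using assms(1) unfolding finite_interval_def by blast
  show ?thesis
    unfolding interval_length_def
    by (rule Greatest_le_nat[where b = b]) (use b assms(2) in auto)
qed

lemma interval_length_chain:
  assumes fin: "finite_interval R M N L" and "submodule N R M" "N \<subseteq> L"
  obtains c where "interval_chain R M N L (interval_length R M N L) c"
proof -
  obtain b where b: "\<And>n c. interval_chain R M N L n c \<Longrightarrow> n \<le> b"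
    using fin unfolding finite_interval_def by blast
  have "interval_chain R M N L 0 (\<lambda>_. N)"
    using assms by (simp add: interval_chain_def submodule_chain_def)
  then have "\<exists>c. interval_chain R M N L 0 c" by blast
  then have "\<exists>c. interval_chain R M N L (interval_length R M N L) c"
    unfolding interval_length_def by (rule GreatestI_nat) (use b in blast)
  then show thesis using that by blast
qed

lemma interval_length_bounded:
  assumes N: "submodule N R M" "N \<subseteq> L" and bd: "\<And>n c. interval_chain R M N L n c \<Longrightarrow> n \<le> b"
  shows "finite_interval R M N L" and "interval_length R M N L \<le> b"
proof -
  show fin: "finite_interval R M N L" using bd unfolding finite_interval_def by blast
  show "interval_length R M N L \<le> b"
    using interval_length_chain[OF fin N] bd by blast
qed

lemma submodule_chain_mono:
  assumes "submodule_chain R M n c" and "i \<le> j" and "j \<le> n"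
  shows "c i \<subseteq> c j"
  using assms(2,3)
proof (induction j rule: dec_induct)
  case (step m)
  then have "c m \<subset> c (Suc m)" using assms(1) by (simp add: submodule_chain_def)
  then show ?case using step by auto
qed simp

lemma interval_chain_between:
  assumes "interval_chain R M N L n c" and "i \<le> n"
  shows "submodule (c i) R M" "N \<subseteq> c i" "c i \<subseteq> L"
  using assms submodule_chain_mono[of R M n c 0 i] submodule_chain_mono[of R M n c i n]
  unfolding interval_chain_def by (auto simp: submodule_chain_def)

text \<open>All comparisons of lengths below come from this principle: a strictly monotone map between
  intervals carries chains to chains of the same length. The two modules may live over different
  rings.\<close>

lemma interval_length_transfer:
  assumes fin: "finite_interval R' M' N' L'" and N: "submodule N R M" "N \<subseteq> L"
    and sub: "\<And>X. \<lbrakk>submodule X R M; N \<subseteq> X; X \<subseteq> L\<rbrakk> \<Longrightarrow>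
      submodule (\<Phi> X) R' M' \<and> N' \<subseteq> \<Phi> X \<and> \<Phi> X \<subseteq> L'"
    and strict: "\<And>X Y. \<lbrakk>submodule X R M; N \<subseteq> X; X \<subset> Y; Y \<subseteq> L; submodule Y R M\<rbrakk> \<Longrightarrow> \<Phi> X \<subset> \<Phi> Y"
  shows "finite_interval R M N L"
    and "interval_length R M N L \<le> interval_length R' M' N' L'"
proof -
  have bd: "n \<le> interval_length R' M' N' L'" if c: "interval_chain R M N L n c" for n c
  proof (rule interval_chain_le[OF fin])
    note b = interval_chain_between[OF c]
    have "submodule (\<Phi> (c i)) R' M' \<and> N' \<subseteq> \<Phi> (c i) \<and> \<Phi> (c i) \<subseteq> L'" if "i \<le> n" for i
      using sub[of "c i"] b[OF that] by auto
    moreover have "\<Phi> (c i) \<subset> \<Phi> (c (Suc i))" if "i < n" for i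
      using strict[of "c i" "c (Suc i)"] b[of i] b[of "Suc i"] that c
      by (auto simp: interval_chain_def submodule_chain_def)
    ultimately show "interval_chain R' M' N' L' n (\<lambda>i. \<Phi> (c i))"
      by (auto simp: interval_chain_def submodule_chain_def)
  qed
  show "finite_interval R M N L" and "interval_length R M N L \<le> interval_length R' M' N' L'"
    using interval_length_bounded[OF N bd] by auto
qed

context plain_left_module
begin

lemma interval_length_self:
  assumes "submodule N R M"
  shows "interval_length R M N N = 0" and "finite_interval R M N N"
proof -
  have "n \<le> 0" if c: "interval_chain R M N N n c" for n c
  proof (rule ccontr)
    assume "\<not> n \<le> 0"
    then have "c 0 \<subset> c (Suc 0)"
      using c unfolding interval_chain_def submodule_chain_def by blast
    moreover have "c (Suc 0) \<subseteq> N" "N \<subseteq> c 0"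
      using \<open>\<not> n \<le> 0\<close> interval_chain_between[OF c] by auto
    ultimately show False by blast
  qed
  then show "interval_length R M N N = 0" "finite_interval R M N N"
    using interval_length_bounded[OF assms order_refl, of 0] by simp_all
qed

lemma interval_length_mono:
  assumes fin: "finite_interval R M N L" and "submodule N R M" "N \<subseteq> X" "X \<subseteq> L"
  shows "interval_length R M N X \<le> interval_length R M N L"
  by (rule interval_length_transfer(2)[OF fin, where \<Phi> = "\<lambda>X. X"]) (use assms in auto)

lemma interval_length_strict_mono:
  assumes fin: "finite_interval R M N L" and sub: "submodule N R M" "submodule L R M" "N \<subseteq> X" "X \<subset> L"
  shows "interval_length R M N X < interval_length R M N L"
proof -
  have fin': "finite_interval R M N X"
    using finite_interval_subset[OF fin] sub by blast
  obtain c where c: "interval_chain R M N X (interval_length R M N X) c"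
    using interval_length_chain[OF fin' sub(1) sub(3)] by blast
  let ?n = "interval_length R M N X"
  have "interval_chain R M N L (Suc ?n) (c(Suc ?n := L))"
    unfolding interval_chain_def submodule_chain_def
  proof (intro conjI allI impI)
    note cd = c[unfolded interval_chain_def submodule_chain_def]
    show "submodule ((c(Suc ?n := L)) i) R M" if "i \<le> Suc ?n" for i
      using cd sub(2) that by simp
    show "(c(Suc ?n := L)) i \<subset> (c(Suc ?n := L)) (Suc i)" if "i < Suc ?n" for i
    proof (cases "i = ?n")
      case True
      then show ?thesis using cd sub(4) by (simp, blast)
    next
      case False
      then have "i < ?n" using that by simp
      moreover then have "c i \<subset> c (Suc i)" using cd by blast
      ultimately show ?thesis by simp
    qed
  qed (use c in \<open>auto simp: interval_chain_def\<close>)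
  then show ?thesis using interval_chain_le[OF fin] Suc_le_lessD by blast
qed

text \<open>In each step of a chain from \<open>N\<close> to \<open>L\<close> the intersection with \<open>X\<close> or the sum with \<open>X\<close> has to
  grow, by the modular law; this bounds the length of the chain. Conversely, chains are
  concatenated.\<close>

lemma interval_length_add:
  assumes NX: "finite_interval R M N X" and XL: "finite_interval R M X L"
    and sub: "submodule N R M" "submodule X R M" "submodule L R M" "N \<subseteq> X" "X \<subseteq> L"
  shows "finite_interval R M N L"
    and "interval_length R M N L = interval_length R M N X + interval_length R M X L"
proof -
  let ?il = "interval_length R M"
  have bd: "n \<le> ?il N X + ?il X L" if c: "interval_chain R M N L n c" for n c
  proof -
    have "k \<le> ?il N (c k \<inter> X) + ?il X (c k <+>\<^bsub>M\<^esub> X)" if "k \<le> n" for k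
      using that
    proof (induction k)
      case (Suc k)
      let ?a = "\<lambda>k. c k \<inter> X" and ?b = "\<lambda>k. c k <+>\<^bsub>M\<^esub> X"
      have k: "k \<le> n" "Suc k \<le> n" using Suc.prems by auto
      note b = interval_chain_between[OF c k(1)] interval_chain_between[OF c k(2)]
      have cc: "c k \<subset> c (Suc k)" using c k by (auto simp: interval_chain_def submodule_chain_def)
      have as: "submodule (?a k) R M" "submodule (?a (Suc k)) R M"
        "submodule (?b k) R M" "submodule (?b (Suc k)) R M"
        using submodule_inter[OF b(1) sub(2)] submodule_inter[OF b(4) sub(2)]
          submodule_set_add[OF b(1) sub(2)] submodule_set_add[OF b(4) sub(2)] by simp_all
      have ab: "N \<subseteq> ?a k" "?a k \<subseteq> ?a (Suc k)" "X \<subseteq> ?b k" "?b k \<subseteq> ?b (Suc k)"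
        using b(2) sub(4) cc set_add_upper2[OF b(1) sub(2)] set_add_mono[of "c k" "c (Suc k)" X X]
        by blast+
      have fa: "finite_interval R M N (?a (Suc k))"
        by (rule finite_interval_subset[OF NX]) auto
      have fb: "finite_interval R M X (?b (Suc k))"
        by (rule finite_interval_subset[OF XL order_refl set_add_least[OF sub(3) b(6) sub(5)]])
      have "?a k \<noteq> ?a (Suc k) \<or> ?b k \<noteq> ?b (Suc k)"
      proof (rule ccontr)
        assume "\<not> ?thesis"
        then have e: "?a k = ?a (Suc k)" "?b k = ?b (Suc k)" by auto
        have "c (Suc k) \<subseteq> ?b k \<inter> c (Suc k)" using e(2) set_add_upper1[OF b(4) sub(2)] by auto
        also have "\<dots> = c k <+>\<^bsub>M\<^esub> (X \<inter> c (Suc k))"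
          using modular_law[OF b(1) sub(2) b(4)] cc by auto
        also have "\<dots> \<subseteq> c k"
          using set_add_least[OF b(1), of "c k" "X \<inter> c (Suc k)"] e(1) by auto
        finally show False using cc by auto
      qed
      then have "?il N (?a k) < ?il N (?a (Suc k)) \<or> ?il X (?b k) < ?il X (?b (Suc k))"
        using interval_length_strict_mono[OF fa sub(1) as(2) ab(1)]
          interval_length_strict_mono[OF fb sub(2) as(4) ab(3)] ab(2,4) by blast
      moreover have "?il N (?a k) \<le> ?il N (?a (Suc k))"
        using interval_length_mono[OF fa sub(1) ab(1,2)] .
      moreover have "?il X (?b k) \<le> ?il X (?b (Suc k))"
        using interval_length_mono[OF fb sub(2) ab(3,4)] .
      ultimately show ?case using Suc.IH[OF k(1)] by linarith
    qed simp
    from this[of n] have 1: "n \<le> ?il N (c n \<inter> X) + ?il X (c n <+>\<^bsub>M\<^esub> X)" by simp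
    note b = interval_chain_between[OF c order_refl]
    have "?il N (c n \<inter> X) \<le> ?il N X"
      by (rule interval_length_mono[OF NX sub(1)]) (use b(2) sub(4) in auto)
    moreover have "?il X (c n <+>\<^bsub>M\<^esub> X) \<le> ?il X L"
      using interval_length_mono[OF XL sub(2) set_add_upper2[OF b(1) sub(2)]
          set_add_least[OF sub(3) b(3) sub(5)]] .
    ultimately show ?thesis using 1 by linarith
  qed
  have NL: "N \<subseteq> L" using sub by auto
  show fin: "finite_interval R M N L"
    by (rule interval_length_bounded(1)[OF sub(1) NL bd])
  obtain c where c: "interval_chain R M N X (?il N X) c"
    using interval_length_chain[OF NX sub(1,4)] .
  obtain c' where c': "interval_chain R M X L (?il X L) c'"
    using interval_length_chain[OF XL sub(2,5)] .
  let ?p = "?il N X" and ?q = "?il X L"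
  let ?d = "\<lambda>i. if i < ?p then c i else if i = ?p then X else c' (i - ?p)"
  note cd = c[unfolded interval_chain_def submodule_chain_def]
    and cd' = c'[unfolded interval_chain_def submodule_chain_def]
  have d: "interval_chain R M N L (?p + ?q) ?d"
    unfolding interval_chain_def submodule_chain_def
  proof (intro conjI allI impI)
    fix i assume i: "i \<le> ?p + ?q"
    have "i - ?p \<le> ?q" using i by simp
    then have "submodule (c' (i - ?p)) R M" using cd' by blast
    moreover have "i < ?p \<Longrightarrow> submodule (c i) R M" using cd by simp
    ultimately show "submodule (?d i) R M" using sub(2) by simp
  next
    fix i assume i: "i < ?p + ?q"
    consider "Suc i < ?p" | "Suc i = ?p" | "i = ?p" | "i > ?p" by linarith
    then show "?d i \<subset> ?d (Suc i)"
    proof cases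
      case 1
      then have "c i \<subset> c (Suc i)" using cd by simp
      then show ?thesis using 1 by simp
    next
      case 2
      then have "i < ?p" by simp
      then have "c i \<subset> c (Suc i)" using cd by blast
      moreover have "c (Suc i) \<subseteq> X" using cd 2 by simp
      ultimately have "c i \<subset> X" by blast
      then show ?thesis using 2 by simp
    next
      case 3
      then have "0 < ?q" using i by simp
      then have "c' 0 \<subset> c' (Suc 0)" "X \<subseteq> c' 0" using cd' by simp_all
      then have "X \<subset> c' (Suc 0)" by blast
      then show ?thesis using 3 by simp
    next
      case 4
      then have "i - ?p < ?q" using i by simp
      then have "c' (i - ?p) \<subset> c' (Suc (i - ?p))" using cd' by blast
      then show ?thesis using 4 by (simp add: Suc_diff_le)
    qed
  next
    show "N \<subseteq> ?d 0" using cd sub(4) by simp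
    show "?d (?p + ?q) \<subseteq> L" using cd' sub(5) by simp
  qed
  show "?il N L = ?il N X + ?il X L"
  proof (rule antisym)
    show "?il N L \<le> ?il N X + ?il X L"
      by (rule interval_length_bounded(2)[OF sub(1) NL bd])
  qed (rule interval_chain_le[OF fin d])
qed

end

section \<open>Homomorphisms, submodules and quotients\<close>

locale plain_module_hom = M: plain_left_module R M + N: plain_left_module R N
  for R :: "('a, 'r) ring_scheme" and M :: "('a, 'm) module" and N :: "('a, 'n) module" +
  fixes f
  assumes hom: "f \<in> left_module_hom R M N"
begin

lemma hom_closed [simp, intro]: "x \<in> carrier M \<Longrightarrow> f x \<in> carrier N"
  using hom by (auto simp: left_module_hom_def hom_def)

lemma hom_add [simp]:
  "\<lbrakk>x \<in> carrier M; y \<in> carrier M\<rbrakk> \<Longrightarrow> f (x \<oplus>\<^bsub>M\<^esub> y) = f x \<oplus>\<^bsub>N\<^esub> f y"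
  using hom by (auto simp: left_module_hom_def hom_def)

lemma hom_smult [simp]:
  "\<lbrakk>a \<in> carrier R; x \<in> carrier M\<rbrakk> \<Longrightarrow> f (a \<odot>\<^bsub>M\<^esub> x) = a \<odot>\<^bsub>N\<^esub> f x"
  using hom by (auto simp: left_module_hom_def hom_def)

lemma hom_zero [simp]: "f \<zero>\<^bsub>M\<^esub> = \<zero>\<^bsub>N\<^esub>"
  using hom_smult[of "\<zero>\<^bsub>R\<^esub>" "\<zero>\<^bsub>M\<^esub>"] by (simp del: hom_smult)

lemma hom_a_inv [simp]: "x \<in> carrier M \<Longrightarrow> f (\<ominus>\<^bsub>M\<^esub> x) = \<ominus>\<^bsub>N\<^esub> f x"
  using hom_smult[of "\<ominus>\<^bsub>R\<^esub> \<one>\<^bsub>R\<^esub>" x]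
  by (simp add: M.smult_l_minus N.smult_l_minus del: hom_smult)

lemma hom_minus [simp]:
  "\<lbrakk>x \<in> carrier M; y \<in> carrier M\<rbrakk> \<Longrightarrow> f (x \<ominus>\<^bsub>M\<^esub> y) = f x \<ominus>\<^bsub>N\<^esub> f y"
  by (simp add: a_minus_def)

lemma kernel_eq: "a_kernel M N f = {x \<in> carrier M. f x = \<zero>\<^bsub>N\<^esub>}"
  by (simp add: a_kernel_def')

lemma submodule_image:
  assumes X: "submodule X R M" shows "submodule (f ` X) R N"
proof (rule N.submoduleI)
  note d = M.submoduleD[OF X]
  have c: "x \<in> carrier M" if "x \<in> X" for x using d(1) that by auto
  show "f ` X \<subseteq> carrier N" using c by auto
  show "\<zero>\<^bsub>N\<^esub> \<in> f ` X" using d(2) by (metis hom_zero imageI)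
  show "x \<oplus>\<^bsub>N\<^esub> y \<in> f ` X" if xy: "x \<in> f ` X" "y \<in> f ` X" for x y
  proof -
    obtain u v where "u \<in> X" "v \<in> X" "x = f u" "y = f v" using xy by auto
    then show ?thesis using d(3)[of u v] c by (auto intro!: image_eqI[of _ f "u \<oplus>\<^bsub>M\<^esub> v"])
  qed
  show "a \<odot>\<^bsub>N\<^esub> x \<in> f ` X" if a: "a \<in> carrier R" and x: "x \<in> f ` X" for a x
  proof -
    obtain u where "u \<in> X" "x = f u" using x by auto
    then show ?thesis using a d(4)[of a u] c by (auto intro!: image_eqI[of _ f "a \<odot>\<^bsub>M\<^esub> u"])
  qed
qed

lemma submodule_preimage:
  assumes X: "submodule X R M" and Y: "submodule Y R N"
  shows "submodule {x \<in> X. f x \<in> Y} R M"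
proof (rule M.submoduleI)
  have c: "x \<in> carrier M" if "x \<in> X" for x using M.submodule_subset[OF X] that by auto
  show "{x \<in> X. f x \<in> Y} \<subseteq> carrier M" using c by auto
  show "\<zero>\<^bsub>M\<^esub> \<in> {x \<in> X. f x \<in> Y}"
    using M.submodule_zero[OF X] N.submodule_zero[OF Y] by simp
  show "x \<oplus>\<^bsub>M\<^esub> y \<in> {x \<in> X. f x \<in> Y}" if "x \<in> {x \<in> X. f x \<in> Y}" "y \<in> {x \<in> X. f x \<in> Y}" for x y
    using that c M.submodule_add[OF X, of x y] N.submodule_add[OF Y, of "f x" "f y"] by simp
  show "a \<odot>\<^bsub>M\<^esub> x \<in> {x \<in> X. f x \<in> Y}" if "a \<in> carrier R" "x \<in> {x \<in> X. f x \<in> Y}" for a x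
    using that c M.submodule_smult[OF X, of a x] N.submodule_smult[OF Y, of a "f x"] by simp
qed

lemma submodule_kernel: "submodule (a_kernel M N f) R M"
  using submodule_preimage[OF M.submodule_carrier N.submodule_0] by (simp add: kernel_eq)

lemma image_set_add:
  assumes "X \<subseteq> carrier M" "Y \<subseteq> carrier M"
  shows "f ` (X <+>\<^bsub>M\<^esub> Y) = f ` X <+>\<^bsub>N\<^esub> f ` Y"
proof -
  have "f ` (X <+>\<^bsub>M\<^esub> Y) = (\<Union>h\<in>X. \<Union>k\<in>Y. {f (h \<oplus>\<^bsub>M\<^esub> k)})"
    by (simp add: set_add_def' image_UN)
  also have "\<dots> = (\<Union>h\<in>X. \<Union>k\<in>Y. {f h \<oplus>\<^bsub>N\<^esub> f k})"
    by (intro SUP_cong refl) (use assms in \<open>simp add: subsetD\<close>)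
  also have "\<dots> = f ` X <+>\<^bsub>N\<^esub> f ` Y"
    by (simp add: set_add_def')
  finally show ?thesis .
qed

lemma image_mem_iff:
  assumes X: "submodule X R M" and k: "a_kernel M N f \<subseteq> X" and x: "x \<in> carrier M"
  shows "f x \<in> f ` X \<longleftrightarrow> x \<in> X"
proof
  assume "f x \<in> f ` X"
  then obtain u where u: "u \<in> X" "f x = f u" by auto
  have uc: "u \<in> carrier M" using u M.submodule_subset[OF X] by auto
  have "x \<ominus>\<^bsub>M\<^esub> u \<in> a_kernel M N f"
    using u uc x by (simp add: kernel_eq) (simp add: a_minus_def N.M.r_neg)
  then have "(x \<ominus>\<^bsub>M\<^esub> u) \<oplus>\<^bsub>M\<^esub> u \<in> X" using k u M.submodule_add[OF X] by auto
  then show "x \<in> X" using x uc by (simp add: a_minus_def M.M.a_assoc M.M.l_neg)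
qed simp

text \<open>The bound comes from taking preimages in \<open>I\<close>. With \<open>f\<close> the map \<open>a \<mapsto> a p\<close> from the ring to a
  module, it limits how much one more generator can contribute to a length.\<close>

lemma interval_length_hom_le:
  assumes fin: "finite_interval R M L I" and Q: "submodule Q R N"
    and sub: "submodule L R M" "submodule I R M" and LQ: "f ` L \<subseteq> Q" and LI: "L \<subseteq> I"
  shows "finite_interval R N Q (Q <+>\<^bsub>N\<^esub> f ` I)"
    and "interval_length R N Q (Q <+>\<^bsub>N\<^esub> f ` I) \<le> interval_length R M L I"
proof -
  let ?P = "\<lambda>Y. {x \<in> I. f x \<in> Y}"
  have QI: "Q \<subseteq> Q <+>\<^bsub>N\<^esub> f ` I" using N.set_add_upper1[OF Q submodule_image[OF sub(2)]] .
  have 1: "submodule (?P Y) R M \<and> L \<subseteq> ?P Y \<and> ?P Y \<subseteq> I"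
    if "submodule Y R N" "Q \<subseteq> Y" for Y
    using submodule_preimage[OF sub(2) that(1)] that(2) LQ LI by blast
  have 2: "?P X \<subset> ?P Y" if X: "submodule X R N" "Q \<subseteq> X" and XY: "X \<subset> Y"
    and Y: "Y \<subseteq> Q <+>\<^bsub>N\<^esub> f ` I" "submodule Y R N" for X Y
  proof -
    obtain y where y: "y \<in> Y" "y \<notin> X" using psubset_imp_ex_mem[OF XY] by blast
    then have "y \<in> Q <+>\<^bsub>N\<^esub> f ` I" using Y(1) by blast
    then obtain q i where qi: "q \<in> Q" "i \<in> I" "y = q \<oplus>\<^bsub>N\<^esub> f i"
      unfolding N.mem_set_add by blast
    have "i \<in> carrier M" using qi(2) M.submodule_subset[OF sub(2)] by blast
    then have fi: "f i \<in> carrier N" by (rule hom_closed)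
    have q: "q \<in> X" "q \<in> Y" using qi(1) X(2) XY by blast+
    have "f i \<in> Y" by (rule N.submodule_add_cancel[OF Y(2) q(2) fi]) (use y(1) qi(3) in simp)
    moreover have "f i \<notin> X" using N.submodule_add[OF X(1) q(1), of "f i"] qi(3) y(2) by blast
    ultimately show ?thesis using qi(2) XY by blast
  qed
  show "finite_interval R N Q (Q <+>\<^bsub>N\<^esub> f ` I)"
    and "interval_length R N Q (Q <+>\<^bsub>N\<^esub> f ` I) \<le> interval_length R M L I"
    by (rule interval_length_transfer[OF fin Q QI, of ?P], erule (1) 1, erule (4) 2)+
qed

lemma interval_length_image_le:
  assumes fin: "finite_interval R M L I" and sub: "submodule L R M" "submodule I R M" "L \<subseteq> I"
  shows "finite_interval R N (f ` L) (f ` I)"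
    and "interval_length R N (f ` L) (f ` I) \<le> interval_length R M L I"
proof -
  have "f ` L <+>\<^bsub>N\<^esub> f ` I = f ` I <+>\<^bsub>N\<^esub> f ` L"
    by (intro N.set_add_commute N.submodule_subset submodule_image sub)
  also have "\<dots> = f ` I"
    using N.set_add_absorb[OF submodule_image[OF sub(2)] submodule_image[OF sub(1)]] sub by auto
  finally show "finite_interval R N (f ` L) (f ` I)"
    and "interval_length R N (f ` L) (f ` I) \<le> interval_length R M L I"
    using interval_length_hom_le[OF fin submodule_image[OF sub(1)] sub(1,2) order_refl sub(3)] by auto
qed

lemma interval_length_image:
  assumes fin: "finite_interval R N (f ` L) (f ` I)"
    and sub: "submodule L R M" "submodule I R M" "L \<subseteq> I" and k: "a_kernel M N f \<subseteq> L"
  shows "finite_interval R M L I"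
    and "interval_length R N (f ` L) (f ` I) = interval_length R M L I"
proof -
  have 1: "submodule (f ` X) R N \<and> f ` L \<subseteq> f ` X \<and> f ` X \<subseteq> f ` I"
    if "submodule X R M" "L \<subseteq> X" "X \<subseteq> I" for X
    by (intro conjI submodule_image image_mono that)
  have 2: "f ` X \<subset> f ` Y" if X: "submodule X R M" "L \<subseteq> X" "X \<subset> Y" "submodule Y R M" for X Y
  proof -
    obtain y where y: "y \<in> Y" "y \<notin> X" using psubset_imp_ex_mem[OF X(3)] by blast
    have "y \<in> carrier M" using y M.submodule_subset[OF X(4)] by blast
    then have "f y \<notin> f ` X" using image_mem_iff[OF X(1) subset_trans[OF k X(2)], of y] y(2) by blast
    then show ?thesis using y(1) X(3) by blast
  qed
  show fin': "finite_interval R M L I"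
    by (rule interval_length_transfer(1)[OF fin sub(1,3), of "\<lambda>X. f ` X"]) (erule (2) 1, rule 2)
  have "interval_length R M L I \<le> interval_length R N (f ` L) (f ` I)"
    by (rule interval_length_transfer(2)[OF fin sub(1,3), of "\<lambda>X. f ` X"]) (erule (2) 1, rule 2)
  then show "interval_length R N (f ` L) (f ` I) = interval_length R M L I"
    using interval_length_image_le(2)[OF fin' sub] by simp
qed

end

context plain_left_module
begin

lemma id_hom: "plain_module_hom R M M (\<lambda>x. x)"
  by unfold_locales (auto simp: left_module_hom_def hom_def)

lemma interval_length_second_iso:
  assumes fin: "finite_interval R M (Q \<inter> I) I" and Q: "submodule Q R M" and I: "submodule I R M"
  shows "finite_interval R M Q (Q <+>\<^bsub>M\<^esub> I)"
    and "interval_length R M Q (Q <+>\<^bsub>M\<^esub> I) = interval_length R M (Q \<inter> I) I"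
proof -
  interpret i: plain_module_hom R M M "\<lambda>x. x" by (rule id_hom)
  note QI = submodule_inter[OF Q I]
  show fin': "finite_interval R M Q (Q <+>\<^bsub>M\<^esub> I)"
    using i.interval_length_hom_le(1)[OF fin Q QI I] by auto
  have le: "interval_length R M Q (Q <+>\<^bsub>M\<^esub> I) \<le> interval_length R M (Q \<inter> I) I"
    using i.interval_length_hom_le(2)[OF fin Q QI I] by auto
  have 1: "submodule (Q <+>\<^bsub>M\<^esub> X) R M \<and> Q \<subseteq> Q <+>\<^bsub>M\<^esub> X \<and> Q <+>\<^bsub>M\<^esub> X \<subseteq> Q <+>\<^bsub>M\<^esub> I"
    if "submodule X R M" "X \<subseteq> I" for X
    using submodule_set_add[OF Q that(1)] set_add_upper1[OF Q that(1)] set_add_mono[OF order_refl that(2)]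
    by blast
  have 3: "(Q <+>\<^bsub>M\<^esub> X) \<inter> I = X" if X: "submodule X R M" "Q \<inter> I \<subseteq> X" "X \<subseteq> I" for X
  proof -
    have "(Q <+>\<^bsub>M\<^esub> X) \<inter> I = (X <+>\<^bsub>M\<^esub> Q) \<inter> I"
      using set_add_commute[OF submodule_subset[OF Q] submodule_subset[OF X(1)]] by simp
    also have "\<dots> = X <+>\<^bsub>M\<^esub> (Q \<inter> I)" using modular_law[OF X(1) Q I X(3)] .
    also have "\<dots> = X" using set_add_absorb[OF X(1) QI X(2)] .
    finally show ?thesis .
  qed
  have 2: "Q <+>\<^bsub>M\<^esub> X \<subset> Q <+>\<^bsub>M\<^esub> Y" if X: "submodule X R M" "Q \<inter> I \<subseteq> X" "X \<subset> Y" "Y \<subseteq> I" "submodule Y R M"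
    for X Y
  proof -
    have "Q \<inter> I \<subseteq> Y" "X \<subseteq> I" using X by blast+
    then have "(Q <+>\<^bsub>M\<^esub> X) \<inter> I \<noteq> (Q <+>\<^bsub>M\<^esub> Y) \<inter> I"
      using 3[OF X(1,2)] 3[OF X(5) _ X(4)] X(3) by simp
    moreover have "Q <+>\<^bsub>M\<^esub> X \<subseteq> Q <+>\<^bsub>M\<^esub> Y"
      by (rule set_add_mono[OF order_refl psubset_imp_subset[OF X(3)]])
    ultimately show ?thesis by blast
  qed
  have "interval_length R M (Q \<inter> I) I \<le> interval_length R M Q (Q <+>\<^bsub>M\<^esub> I)"
    by (rule interval_length_transfer(2)[OF fin' QI Int_lower2, of "\<lambda>X. Q <+>\<^bsub>M\<^esub> X"])
      (rule 1, assumption+, rule 2)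
  then show "interval_length R M Q (Q <+>\<^bsub>M\<^esub> I) = interval_length R M (Q \<inter> I) I"
    using le by simp
qed

lemma sub_module_plain:
  assumes L: "submodule L R M" shows "plain_left_module R (sub_module M L)"
proof -
  note d = submoduleD[OF L]
  have c: "x \<in> carrier M" if "x \<in> L" for x using d(1) that by auto
  have "abelian_group (sub_module M L)"
  proof (rule abelian_groupI)
    show "\<exists>y\<in>carrier (sub_module M L). y \<oplus>\<^bsub>sub_module M L\<^esub> x = \<zero>\<^bsub>sub_module M L\<^esub>"
      if "x \<in> carrier (sub_module M L)" for x
      using that d(5) c by (auto intro!: bexI[of _ "\<ominus>\<^bsub>M\<^esub> x"] simp: M.l_neg)
  qed (use d(2,3) c in \<open>auto simp: M.a_ac\<close>)
  then show ?thesis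
    unfolding plain_left_module_def
    by (intro left_module.intro R.ring_axioms left_module_axioms.intro)
      (use d(4) c in \<open>auto simp: smult_l_distr smult_r_distr smult_assoc1\<close>)
qed

lemma submodule_sub_module_iff:
  assumes L: "submodule L R M"
  shows "submodule X R (sub_module M L) \<longleftrightarrow> submodule X R M \<and> X \<subseteq> L"
proof -
  interpret L: plain_left_module R "sub_module M L" by (rule sub_module_plain[OF L])
  show ?thesis
  proof
    assume "submodule X R (sub_module M L)"
    note X = L.submoduleD[OF this, simplified]
    have "submodule X R M"
      by (rule submoduleI) (use X(1-4) submodule_subset[OF L] in auto)
    then show "submodule X R M \<and> X \<subseteq> L" using X(1) by simp
  next
    assume X: "submodule X R M \<and> X \<subseteq> L"
    note d = submoduleD(2-4)[OF conjunct1[OF X]]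
    show "submodule X R (sub_module M L)"
      by (rule L.submoduleI) (use X d in auto)
  qed
qed

lemma interval_chain_sub_module:
  assumes L: "submodule L R M" and Y: "Y \<subseteq> L"
  shows "interval_chain R (sub_module M L) X Y n c \<longleftrightarrow> interval_chain R M X Y n c"
proof
  assume "interval_chain R (sub_module M L) X Y n c"
  then show "interval_chain R M X Y n c"
    unfolding interval_chain_def submodule_chain_def submodule_sub_module_iff[OF L] by blast
next
  assume c: "interval_chain R M X Y n c"
  then have "c i \<subseteq> L" if "i \<le> n" for i using interval_chain_between(3)[OF c that] Y by auto
  then show "interval_chain R (sub_module M L) X Y n c"
    using c unfolding interval_chain_def submodule_chain_def submodule_sub_module_iff[OF L] by blast
qed

lemma interval_length_sub_module:
  assumes "submodule L R M" "Y \<subseteq> L"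
  shows "interval_length R (sub_module M L) X Y = interval_length R M X Y"
    and "finite_interval R (sub_module M L) X Y = finite_interval R M X Y"
  by (simp_all add: interval_length_def finite_interval_def interval_chain_sub_module[OF assms])

lemma interval_chain_full:
  "interval_chain R M {\<zero>\<^bsub>M\<^esub>} (carrier M) n c \<longleftrightarrow> submodule_chain R M n c"
proof
  assume "submodule_chain R M n c"
  then have "submodule (c 0) R M" "submodule (c n) R M" by (auto simp: submodule_chain_def)
  then show "interval_chain R M {\<zero>\<^bsub>M\<^esub>} (carrier M) n c"
    using submodule_subset submodule_zero \<open>submodule_chain R M n c\<close> by (simp add: interval_chain_def)
qed (simp add: interval_chain_def)

lemma module_length_eq: "module_length R M = interval_length R M {\<zero>\<^bsub>M\<^esub>} (carrier M)"
  by (simp add: module_length_def interval_length_def interval_chain_full)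

lemma finite_length_eq: "finite_length R M = finite_interval R M {\<zero>\<^bsub>M\<^esub>} (carrier M)"
  by (simp add: finite_length_def finite_interval_def interval_chain_full)

lemma module_length_sub_module:
  assumes "submodule L R M"
  shows "module_length R (sub_module M L) = interval_length R M {\<zero>\<^bsub>M\<^esub>} L"
  using plain_left_module.module_length_eq[OF sub_module_plain[OF assms]]
    interval_length_sub_module(1)[OF assms order_refl, of "{\<zero>\<^bsub>M\<^esub>}"] by simp

context
  fixes N assumes N: "submodule N R M"
begin

interpretation abelian_subgroup N M
  by (rule abelian_subgroupI3)
    (use N M.abelian_group_axioms in \<open>auto simp: additive_subgroup_def submodule_def\<close>)

lemma quotient_carrier: "carrier (quotient_module M N) = (\<lambda>x. N +>\<^bsub>M\<^esub> x) ` carrier M"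
  by (auto simp: quotient_module_def A_RCOSETS_def')

lemma coset_eq_iff:
  assumes "x \<in> carrier M" "y \<in> carrier M"
  shows "N +>\<^bsub>M\<^esub> x = N +>\<^bsub>M\<^esub> y \<longleftrightarrow> x \<ominus>\<^bsub>M\<^esub> y \<in> N"
proof -
  have "N +>\<^bsub>M\<^esub> x = N +>\<^bsub>M\<^esub> y \<longleftrightarrow> x \<in> N +>\<^bsub>M\<^esub> y"
    using a_repr_independence'[of x y] a_repr_independenceD[of x y] assms by metis
  then show ?thesis using a_rcos_module[of y x] assms by (simp add: a_minus_def)
qed

lemma quotient_smult:
  assumes a: "a \<in> carrier R" and x: "x \<in> carrier M"
  shows "a \<odot>\<^bsub>quotient_module M N\<^esub> (N +>\<^bsub>M\<^esub> x) = N +>\<^bsub>M\<^esub> (a \<odot>\<^bsub>M\<^esub> x)"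
proof -
  have "N +>\<^bsub>M\<^esub> (a \<odot>\<^bsub>M\<^esub> y) = N +>\<^bsub>M\<^esub> (a \<odot>\<^bsub>M\<^esub> x)" if y: "y \<in> N +>\<^bsub>M\<^esub> x" for y
  proof -
    have yc: "y \<in> carrier M" using y x a_elemrcos_carrier by blast
    have "y \<ominus>\<^bsub>M\<^esub> x \<in> N" using y x yc a_rcos_module[of x y] by (simp add: a_minus_def)
    then have "a \<odot>\<^bsub>M\<^esub> (y \<ominus>\<^bsub>M\<^esub> x) \<in> N" using submodule_smult[OF N a] by auto
    then have "a \<odot>\<^bsub>M\<^esub> y \<ominus>\<^bsub>M\<^esub> a \<odot>\<^bsub>M\<^esub> x \<in> N"
      using a x yc by (simp add: a_minus_def smult_r_distr smult_r_minus)
    then show ?thesis using coset_eq_iff a x yc by simp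
  qed
  moreover have "x \<in> N +>\<^bsub>M\<^esub> x" using x a_rcos_self by blast
  ultimately have "(\<Union>y\<in>N +>\<^bsub>M\<^esub> x. N +>\<^bsub>M\<^esub> (a \<odot>\<^bsub>M\<^esub> y)) = N +>\<^bsub>M\<^esub> (a \<odot>\<^bsub>M\<^esub> x)"
    by blast
  then show ?thesis unfolding quotient_module_def by simp
qed

lemma quotient_add:
  assumes "x \<in> carrier M" "y \<in> carrier M"
  shows "(N +>\<^bsub>M\<^esub> x) \<oplus>\<^bsub>quotient_module M N\<^esub> (N +>\<^bsub>M\<^esub> y) = N +>\<^bsub>M\<^esub> (x \<oplus>\<^bsub>M\<^esub> y)"
  using a_rcos_sum[OF assms] by (simp add: quotient_module_def)

lemma quotient_zero: "\<zero>\<^bsub>quotient_module M N\<^esub> = N +>\<^bsub>M\<^esub> \<zero>\<^bsub>M\<^esub>"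
  using submodule_subset[OF N] by (simp add: quotient_module_def M.a_coset_add_zero)

lemma quotient_plain: "plain_left_module R (quotient_module M N)"
proof -
  let ?Q = "quotient_module M N"
  have coset: "\<exists>u\<in>carrier M. x = N +>\<^bsub>M\<^esub> u" if "x \<in> carrier ?Q" for x
    using that unfolding quotient_carrier by blast
  have closed: "N +>\<^bsub>M\<^esub> u \<in> carrier ?Q" if "u \<in> carrier M" for u
    using that unfolding quotient_carrier by blast
  have "abelian_group ?Q"
  proof (rule abelian_groupI)
    fix x y assume xy: "x \<in> carrier ?Q" "y \<in> carrier ?Q"
    obtain u where u: "u \<in> carrier M" "x = N +>\<^bsub>M\<^esub> u" using coset[OF xy(1)] by blast
    obtain v where v: "v \<in> carrier M" "y = N +>\<^bsub>M\<^esub> v" using coset[OF xy(2)] by blast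
    show "x \<oplus>\<^bsub>?Q\<^esub> y \<in> carrier ?Q" using u v closed by (simp add: quotient_add)
    show "x \<oplus>\<^bsub>?Q\<^esub> y = y \<oplus>\<^bsub>?Q\<^esub> x" using u v by (simp add: quotient_add M.a_comm)
    show "x \<oplus>\<^bsub>?Q\<^esub> y \<oplus>\<^bsub>?Q\<^esub> z = x \<oplus>\<^bsub>?Q\<^esub> (y \<oplus>\<^bsub>?Q\<^esub> z)" if z: "z \<in> carrier ?Q" for z
    proof -
      obtain w where "w \<in> carrier M" "z = N +>\<^bsub>M\<^esub> w" using coset[OF z] by blast
      then show ?thesis using u v by (simp add: quotient_add M.a_assoc)
    qed
  next
    show "\<zero>\<^bsub>?Q\<^esub> \<in> carrier ?Q" using closed[of "\<zero>\<^bsub>M\<^esub>"] by (simp only: quotient_zero M.zero_closed)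
    fix x assume "x \<in> carrier ?Q"
    then obtain u where u: "u \<in> carrier M" "x = N +>\<^bsub>M\<^esub> u" using coset by blast
    show "\<zero>\<^bsub>?Q\<^esub> \<oplus>\<^bsub>?Q\<^esub> x = x"
      using quotient_add[of "\<zero>\<^bsub>M\<^esub>" u] u by (simp only: quotient_zero M.l_zero M.zero_closed)
    have "(N +>\<^bsub>M\<^esub> (\<ominus>\<^bsub>M\<^esub> u)) \<oplus>\<^bsub>?Q\<^esub> x = \<zero>\<^bsub>?Q\<^esub>"
      using quotient_add[of "\<ominus>\<^bsub>M\<^esub> u" u] u
      by (simp only: quotient_zero M.l_neg M.a_inv_closed)
    then show "\<exists>y\<in>carrier ?Q. y \<oplus>\<^bsub>?Q\<^esub> x = \<zero>\<^bsub>?Q\<^esub>" using closed u(1) by blast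
  qed
  moreover have "left_module_axioms R ?Q"
  proof (rule left_module_axioms.intro)
    fix a x assume a: "a \<in> carrier R" and x: "x \<in> carrier ?Q"
    obtain u where u: "u \<in> carrier M" "x = N +>\<^bsub>M\<^esub> u" using coset[OF x] by blast
    show "a \<odot>\<^bsub>?Q\<^esub> x \<in> carrier ?Q" using u a closed by (simp add: quotient_smult)
    show "(a \<oplus> b) \<odot>\<^bsub>?Q\<^esub> x = a \<odot>\<^bsub>?Q\<^esub> x \<oplus>\<^bsub>?Q\<^esub> b \<odot>\<^bsub>?Q\<^esub> x" if b: "b \<in> carrier R" for b
      using u a b by (simp add: quotient_add quotient_smult smult_l_distr)
    show "(a \<otimes> b) \<odot>\<^bsub>?Q\<^esub> x = a \<odot>\<^bsub>?Q\<^esub> (b \<odot>\<^bsub>?Q\<^esub> x)" if b: "b \<in> carrier R" for b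
      using u a b by (simp add: quotient_smult smult_assoc1)
    show "a \<odot>\<^bsub>?Q\<^esub> (x \<oplus>\<^bsub>?Q\<^esub> y) = a \<odot>\<^bsub>?Q\<^esub> x \<oplus>\<^bsub>?Q\<^esub> a \<odot>\<^bsub>?Q\<^esub> y"
      if y: "y \<in> carrier ?Q" for y
    proof -
      obtain v where "v \<in> carrier M" "y = N +>\<^bsub>M\<^esub> v" using coset[OF y] by blast
      then show ?thesis using u a by (simp add: quotient_add quotient_smult smult_r_distr)
    qed
  next
    fix x assume x: "x \<in> carrier ?Q"
    obtain u where "u \<in> carrier M" "x = N +>\<^bsub>M\<^esub> u" using coset[OF x] by blast
    then show "\<one> \<odot>\<^bsub>?Q\<^esub> x = x" by (simp add: quotient_smult)
  qed
  ultimately show ?thesis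
    unfolding plain_left_module_def by (intro left_module.intro R.ring_axioms)
qed

lemma quotient_hom: "plain_module_hom R M (quotient_module M N) (\<lambda>x. N +>\<^bsub>M\<^esub> x)"
proof -
  interpret Q: plain_left_module R "quotient_module M N" by (rule quotient_plain)
  show ?thesis
  proof unfold_locales
    have "(\<lambda>x. N +>\<^bsub>M\<^esub> x) \<in> carrier M \<rightarrow> carrier (quotient_module M N)"
      unfolding quotient_carrier by blast
    then show "(\<lambda>x. N +>\<^bsub>M\<^esub> x) \<in> left_module_hom R M (quotient_module M N)"
      by (simp add: left_module_hom_def hom_def quotient_add quotient_smult)
  qed
qed

lemma module_length_quotient:
  assumes fin: "finite_interval R M N (carrier M)"
  shows "module_length R (quotient_module M N) = interval_length R M N (carrier M)"
proof -
  interpret q: plain_module_hom R M "quotient_module M N" "\<lambda>x. N +>\<^bsub>M\<^esub> x" by (rule quotient_hom)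
  have mem: "N +>\<^bsub>M\<^esub> x = \<zero>\<^bsub>quotient_module M N\<^esub> \<longleftrightarrow> x \<in> N" if "x \<in> carrier M" for x
  proof -
    have "\<ominus>\<^bsub>M\<^esub> \<zero>\<^bsub>M\<^esub> = \<zero>\<^bsub>M\<^esub>" by (rule M.minus_equality) auto
    then have "x \<ominus>\<^bsub>M\<^esub> \<zero>\<^bsub>M\<^esub> = x" using that unfolding a_minus_def by (simp only: M.r_zero)
    then show ?thesis using coset_eq_iff[OF that M.zero_closed] unfolding quotient_zero by (simp only:)
  qed
  have Nc: "x \<in> carrier M" if "x \<in> N" for x using submodule_subset[OF N] that by (rule subsetD)
  have k: "a_kernel M (quotient_module M N) (\<lambda>x. N +>\<^bsub>M\<^esub> x) = N"
    unfolding q.kernel_eq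
  proof (rule Set.set_eqI)
    fix x
    show "x \<in> {x \<in> carrier M. N +>\<^bsub>M\<^esub> x = \<zero>\<^bsub>quotient_module M N\<^esub>} \<longleftrightarrow> x \<in> N"
      using mem[of x] Nc[of x] unfolding mem_Collect_eq by argo
  qed
  have i: "(\<lambda>x. N +>\<^bsub>M\<^esub> x) ` N = {\<zero>\<^bsub>quotient_module M N\<^esub>}"
  proof (rule Set.set_eqI, rule iffI)
    fix X assume "X \<in> (\<lambda>x. N +>\<^bsub>M\<^esub> x) ` N"
    then obtain x where "x \<in> N" "X = N +>\<^bsub>M\<^esub> x" by (rule imageE)
    then show "X \<in> {\<zero>\<^bsub>quotient_module M N\<^esub>}" using mem[OF Nc] by (simp only: singleton_iff)
  next
    fix X assume "X \<in> {\<zero>\<^bsub>quotient_module M N\<^esub>}"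
    then show "X \<in> (\<lambda>x. N +>\<^bsub>M\<^esub> x) ` N"
      using submodule_zero[OF N] unfolding singleton_iff quotient_zero by (rule image_eqI)
  qed
  note s = N submodule_carrier submodule_subset[OF N]
  have "module_length R (quotient_module M N) = interval_length R (quotient_module M N)
      ((\<lambda>x. N +>\<^bsub>M\<^esub> x) ` N) ((\<lambda>x. N +>\<^bsub>M\<^esub> x) ` carrier M)"
    by (simp only: q.N.module_length_eq i quotient_carrier)
  also have "\<dots> = interval_length R M N (carrier M)"
    by (rule q.interval_length_image(2)[OF q.interval_length_image_le(1)[OF fin s] s equalityD1[OF k]])
  finally show ?thesis .
qed

end

end


section \<open>Submodules spanned by the multiples of finitely many elements\<close>

lemma regular_module_simps [simp]:
  "carrier (regular_module R) = carrier R" "\<zero>\<^bsub>regular_module R\<^esub> = \<zero>\<^bsub>R\<^esub>"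
  "x \<oplus>\<^bsub>regular_module R\<^esub> y = x \<oplus>\<^bsub>R\<^esub> y" "x \<odot>\<^bsub>regular_module R\<^esub> y = x \<otimes>\<^bsub>R\<^esub> y"
  by (simp_all add: regular_module_def)

lemma (in ring) regular_module_plain: "plain_left_module R (regular_module R)"
proof -
  have "abelian_group (regular_module R)"
    by (rule abelian_groupI) (auto simp: a_ac intro!: bexI[of _ "\<ominus> _"] l_neg)
  then show ?thesis
    unfolding plain_left_module_def
    by (intro left_module.intro ring_axioms left_module_axioms.intro)
      (auto simp: l_distr r_distr m_assoc)
qed

lemma (in ring) length_le_1:
  assumes L: "submodule L R (regular_module R)"
    and inv: "\<And>x. \<lbrakk>x \<in> carrier R; x \<notin> L\<rbrakk> \<Longrightarrow> \<exists>y\<in>carrier R. y \<otimes> x = \<one>"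
  shows "finite_interval R (regular_module R) L (carrier R)"
    and "interval_length R (regular_module R) L (carrier R) \<le> 1"
proof -
  interpret reg: plain_left_module R "regular_module R" by (rule regular_module_plain)
  have one: "X = carrier R" if X: "submodule X R (regular_module R)" "L \<subset> X" for X
  proof -
    obtain x where x: "x \<in> X" "x \<notin> L" using X by auto
    then have "x \<in> carrier R" using reg.submodule_subset[OF X(1)] by auto
    then obtain y where "y \<in> carrier R" "y \<otimes> x = \<one>" using inv x by auto
    then have 1: "\<one> \<in> X" using reg.submodule_smult[OF X(1), of y x] x by auto
    have "z \<in> X" if "z \<in> carrier R" for z using reg.submodule_smult[OF X(1) that 1] that by simp
    then show ?thesis using reg.submodule_subset[OF X(1)] by auto
  qed
  have bd: "n \<le> 1" if c: "interval_chain R (regular_module R) L (carrier R) n c" for n c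
  proof (rule ccontr)
    assume n: "\<not> n \<le> 1"
    have st: "c i \<subset> c (Suc i)" if "i < n" for i
      using c that unfolding interval_chain_def submodule_chain_def by blast
    have "L \<subseteq> c 0" "c 0 \<subset> c (Suc 0)" "c (Suc 0) \<subset> c (Suc (Suc 0))"
      using interval_chain_between(2)[OF c, of 0] st[of 0] st[of "Suc 0"] n by auto
    moreover have "submodule (c (Suc 0)) R (regular_module R)" "c (Suc (Suc 0)) \<subseteq> carrier R"
      using interval_chain_between[OF c] n by auto
    ultimately show False using one[of "c (Suc 0)"] by blast
  qed
  have "L \<subseteq> carrier R" using reg.submodule_subset[OF L] by simp
  then show "finite_interval R (regular_module R) L (carrier R)"
    and "interval_length R (regular_module R) L (carrier R) \<le> 1"
    using interval_length_bounded[OF L _ bd] by auto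
qed

primrec multiples_span ::
  "('a, 'r) ring_scheme \<Rightarrow> ('a, 'm) module \<Rightarrow> 'a set \<Rightarrow> 'm list \<Rightarrow> 'm set" where
  "multiples_span R M I [] = {\<zero>\<^bsub>M\<^esub>}"
| "multiples_span R M I (p # ps) = (\<lambda>a. a \<odot>\<^bsub>M\<^esub> p) ` I <+>\<^bsub>M\<^esub> multiples_span R M I ps"

context plain_left_module
begin

lemma smult_hom:
  assumes "p \<in> carrier M"
  shows "plain_module_hom R (regular_module R) M (\<lambda>a. a \<odot>\<^bsub>M\<^esub> p)"
proof -
  interpret r: plain_left_module R "regular_module R" by (rule R.regular_module_plain)
  show ?thesis
    using assms by unfold_locales (auto simp: left_module_hom_def hom_def smult_l_distr smult_assoc1)
qed

lemma submodule_multiples: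
  "\<lbrakk>submodule I R (regular_module R); p \<in> carrier M\<rbrakk> \<Longrightarrow> submodule ((\<lambda>a. a \<odot>\<^bsub>M\<^esub> p) ` I) R M"
  using plain_module_hom.submodule_image[OF smult_hom] .

lemma submodule_multiples_span:
  "\<lbrakk>submodule I R (regular_module R); set ps \<subseteq> carrier M\<rbrakk> \<Longrightarrow> submodule (multiples_span R M I ps) R M"
  by (induction ps) (simp_all add: submodule_0 submodule_set_add submodule_multiples)

text \<open>The bound for a single generator, added up: every generator contributes at most the length of
  \<open>I/L\<close>, because its multiples by elements of \<open>L\<close> already lie in \<open>Q\<close>. All upper bounds for the
  layers of modules are instances.\<close>

lemma interval_length_multiples_span:
  assumes I: "submodule I R (regular_module R)" and L: "submodule L R (regular_module R)" "L \<subseteq> I"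
    and fin: "finite_interval R (regular_module R) L I"
  shows "\<lbrakk>submodule Q R M; set ps \<subseteq> carrier M; \<And>p a. p \<in> set ps \<Longrightarrow> a \<in> L \<Longrightarrow> a \<odot>\<^bsub>M\<^esub> p \<in> Q\<rbrakk> \<Longrightarrow>
    finite_interval R M Q (Q <+>\<^bsub>M\<^esub> multiples_span R M I ps) \<and>
    interval_length R M Q (Q <+>\<^bsub>M\<^esub> multiples_span R M I ps)
      \<le> length ps * interval_length R (regular_module R) L I"
proof (induction ps arbitrary: Q)
  case Nil
  have "Q <+>\<^bsub>M\<^esub> {\<zero>\<^bsub>M\<^esub>} = Q"
    by (rule set_add_absorb[OF Nil(1) submodule_0]) (simp add: submodule_zero[OF Nil(1)])
  then show ?case using interval_length_self[OF Nil(1)] by simp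
next
  case (Cons p ps)
  let ?k = "interval_length R (regular_module R) L I"
  let ?Ip = "(\<lambda>a. a \<odot>\<^bsub>M\<^esub> p) ` I" and ?S = "multiples_span R M I ps"
  have p: "p \<in> carrier M" and ps: "set ps \<subseteq> carrier M" using Cons.prems by auto
  interpret h: plain_module_hom R "regular_module R" M "\<lambda>a. a \<odot>\<^bsub>M\<^esub> p" by (rule smult_hom[OF p])
  have Ip: "submodule ?Ip R M" by (rule submodule_multiples[OF I p])
  have S: "submodule ?S R M" by (rule submodule_multiples_span[OF I ps])
  let ?Q' = "Q <+>\<^bsub>M\<^esub> ?Ip"
  have Q': "submodule ?Q' R M" by (rule submodule_set_add[OF Cons.prems(1) Ip])
  have QQ': "Q \<subseteq> ?Q'" by (rule set_add_upper1[OF Cons.prems(1) Ip])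
  have LQ: "(\<lambda>a. a \<odot>\<^bsub>M\<^esub> p) ` L \<subseteq> Q" by (rule image_subsetI) (rule Cons.prems(3), simp_all)
  note 1 = h.interval_length_hom_le[OF fin Cons.prems(1) L(1) I LQ L(2)]
  have 2: "finite_interval R M ?Q' (?Q' <+>\<^bsub>M\<^esub> ?S) \<and>
      interval_length R M ?Q' (?Q' <+>\<^bsub>M\<^esub> ?S) \<le> length ps * ?k"
    by (rule Cons.IH[OF Q' ps]) (use Cons.prems(3) QQ' in \<open>simp add: subsetD\<close>)
  have e: "?Q' <+>\<^bsub>M\<^esub> ?S = Q <+>\<^bsub>M\<^esub> multiples_span R M I (p # ps)"
    using set_add_assoc[of Q ?Ip ?S] submodule_subset[OF Cons.prems(1)] submodule_subset[OF Ip]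
      submodule_subset[OF S] by simp
  note 3 = interval_length_add[OF 1(1) conjunct1[OF 2] Cons.prems(1) Q' submodule_set_add[OF Q' S]
      QQ' set_add_upper1[OF Q' S]]
  show ?case using 1(2) 2 3 unfolding e by simp
qed

lemma submodule_regular_carrier: "submodule (carrier R) R (regular_module R)"
  using plain_left_module.submodule_carrier[OF R.regular_module_plain] by simp

lemma multiples_span_subset:
  assumes X: "submodule X R M" and "set ps \<subseteq> X" and "I \<subseteq> carrier R"
  shows "multiples_span R M I ps \<subseteq> X"
  using assms(2)
proof (induction ps)
  case (Cons p ps)
  have "(\<lambda>a. a \<odot>\<^bsub>M\<^esub> p) ` I \<subseteq> X"
  proof
    fix x assume "x \<in> (\<lambda>a. a \<odot>\<^bsub>M\<^esub> p) ` I"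
    then obtain b where "b \<in> I" "x = b \<odot>\<^bsub>M\<^esub> p" by (elim imageE)
    then show "x \<in> X" using submodule_smult[OF X subsetD[OF assms(3)], of b p] Cons.prems by simp
  qed
  moreover have "multiples_span R M I ps \<subseteq> X" using Cons by simp
  ultimately show ?case unfolding multiples_span.simps by (rule set_add_least[OF X])
qed (use submodule_zero[OF X] in simp)

lemma mem_multiples_span:
  assumes "p \<in> set ps" "set ps \<subseteq> carrier M" "submodule I R (regular_module R)" "a \<in> I"
  shows "a \<odot>\<^bsub>M\<^esub> p \<in> multiples_span R M I ps"
  using assms(1,2)
proof (induction ps)
  case (Cons q ps)
  have s: "submodule ((\<lambda>a. a \<odot>\<^bsub>M\<^esub> q) ` I) R M" "submodule (multiples_span R M I ps) R M"
    using submodule_multiples[OF assms(3), of q] submodule_multiples_span[OF assms(3), of ps] Cons.prems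
    by simp_all
  show ?case
  proof (cases "p = q")
    case True
    then have "a \<odot>\<^bsub>M\<^esub> p \<in> (\<lambda>a. a \<odot>\<^bsub>M\<^esub> q) ` I" using assms(4) by simp
    then show ?thesis unfolding multiples_span.simps by (rule subsetD[OF set_add_upper1[OF s]])
  next
    case False
    then have "a \<odot>\<^bsub>M\<^esub> p \<in> multiples_span R M I ps" using Cons by simp
    then show ?thesis unfolding multiples_span.simps by (rule subsetD[OF set_add_upper2[OF s]])
  qed
qed simp

lemma set_subset_multiples_span:
  assumes ps: "set ps \<subseteq> carrier M"
  shows "set ps \<subseteq> multiples_span R M (carrier R) ps"
proof
  fix p assume p: "p \<in> set ps"
  then show "p \<in> multiples_span R M (carrier R) ps"
    using mem_multiples_span[OF p ps submodule_regular_carrier R.one_closed] ps by (simp add: subsetD)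
qed

text \<open>Each generator that is added makes the interval below it longer, so at most
  \<open>interval_length R M Q N\<close> of them are needed.\<close>

lemma exists_generators:
  assumes "submodule Q R M" "submodule N R M" "Q \<subseteq> N" "finite_interval R M Q N"
  shows "\<exists>ps. set ps \<subseteq> N \<and> length ps \<le> interval_length R M Q N \<and>
    N = Q <+>\<^bsub>M\<^esub> multiples_span R M (carrier R) ps"
  using assms
proof (induction "interval_length R M Q N" arbitrary: Q rule: less_induct)
  case less
  note Q = less.prems(1) and N = less.prems(2) and fin = less.prems(4)
  show ?case
  proof (cases "Q = N")
    case True
    then have "N = Q <+>\<^bsub>M\<^esub> multiples_span R M (carrier R) []"
      using set_add_absorb[OF N submodule_0] submodule_zero[OF N] by simp
    then show ?thesis by (intro exI[of _ "[]"]) auto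
  next
    case False
    then obtain p where p: "p \<in> N" "p \<notin> Q" using less.prems(3) by auto
    have pc: "p \<in> carrier M" using p submodule_subset[OF N] by auto
    let ?Rp = "(\<lambda>a. a \<odot>\<^bsub>M\<^esub> p) ` carrier R"
    let ?Q' = "Q <+>\<^bsub>M\<^esub> ?Rp"
    have Rp: "submodule ?Rp R M" by (rule submodule_multiples[OF submodule_regular_carrier pc])
    have Q': "submodule ?Q' R M" by (rule submodule_set_add[OF Q Rp])
    have pR: "p \<in> ?Rp" using pc by (intro image_eqI[of _ _ "\<one>"]) auto
    have pQ': "p \<in> ?Q'" by (rule subsetD[OF set_add_upper2[OF Q Rp] pR])
    have QQ': "Q \<subseteq> ?Q'" by (rule set_add_upper1[OF Q Rp])
    have "?Rp \<subseteq> N" by (rule image_subsetI) (rule submodule_smult[OF N _ p(1)])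
    then have Q'N: "?Q' \<subseteq> N" by (rule set_add_least[OF N less.prems(3)])
    have fin': "finite_interval R M ?Q' N" by (rule finite_interval_subset[OF fin QQ' order_refl])
    have fin1: "finite_interval R M Q ?Q'" by (rule finite_interval_subset[OF fin order_refl Q'N])
    have "Q \<subset> ?Q'" using pQ' p QQ' by auto
    then have 1: "0 < interval_length R M Q ?Q'"
      using interval_length_strict_mono[OF fin1 Q Q' order_refl] by auto
    note 2 = interval_length_add(2)[OF fin1 fin' Q Q' N QQ' Q'N]
    then obtain ps where ps: "set ps \<subseteq> N" "length ps \<le> interval_length R M ?Q' N"
      "N = ?Q' <+>\<^bsub>M\<^esub> multiples_span R M (carrier R) ps"
      using less.hyps[OF _ Q' N Q'N fin'] 1 by (metis less_add_same_cancel2)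
    have S: "submodule (multiples_span R M (carrier R) ps) R M"
      by (rule submodule_multiples_span[OF submodule_regular_carrier subset_trans[OF ps(1) submodule_subset[OF N]]])
    have "N = Q <+>\<^bsub>M\<^esub> multiples_span R M (carrier R) (p # ps)"
      using ps(3) set_add_assoc[OF submodule_subset[OF Q] submodule_subset[OF Rp] submodule_subset[OF S]]
      by simp
    moreover have "set (p # ps) \<subseteq> N" "length (p # ps) \<le> interval_length R M Q N"
      using ps(1,2) p(1) 1 2 by simp_all
    ultimately show ?thesis by blast
  qed
qed

end

section \<open>Modules over short local rings\<close>

text \<open>These are the properties of short local algebras on which the study of complexes rests. Keeping
  the field of scalars out of it leaves the length over the ring as the only notion of size.\<close>

locale short_local_ring = ring R for R (structure) +
  assumes rad_left: "submodule (radical R) R (regular_module R)"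
    and rad_right: "\<lbrakk>j \<in> radical R; x \<in> carrier R\<rbrakk> \<Longrightarrow> j \<otimes> x \<in> radical R"
    and one_notin_rad: "\<one> \<notin> radical R"
    and left_inverse: "\<lbrakk>x \<in> carrier R; x \<notin> radical R\<rbrakk> \<Longrightarrow> \<exists>y\<in>carrier R. y \<otimes> x = \<one>"
    and rad_nilpotent: "\<lbrakk>i \<in> radical R; j \<in> radical R; k \<in> radical R\<rbrakk> \<Longrightarrow> i \<otimes> (j \<otimes> k) = \<zero>"
    and finite_regular: "finite_length R (regular_module R)"
begin

abbreviation J :: "'a set" where "J \<equiv> radical R"
abbreviation J2 :: "'a set" where "J2 \<equiv> ideal_prod R J J"

definition e :: nat where "e = interval_length R (regular_module R) J2 J"
definition a :: nat where "a = interval_length R (regular_module R) {\<zero>} J2"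

sublocale reg: plain_left_module R "regular_module R" by (rule regular_module_plain)

lemma J_subset: "J \<subseteq> carrier R"
  using reg.submodule_subset[OF rad_left] by simp

lemma J_closed: "j \<in> J \<Longrightarrow> j \<in> carrier R" using J_subset by auto

lemma ideal_submodule: "ideal I R \<Longrightarrow> submodule I R (regular_module R)"
  by (rule reg.submoduleI)
    (auto simp: ideal.Icarr ideal.I_l_closed additive_subgroup.a_closed ideal.axioms(1)
      additive_subgroup.zero_closed)

lemma J_ideal: "ideal J R"
proof (rule idealI[OF ring_axioms])
  show "subgroup J (add_monoid R)"
    using rad_left[unfolded submodule_def]
    by (auto simp: regular_module_def subgroup_def m_inv_def)
qed (use rad_right reg.submodule_smult[OF rad_left] in auto)

lemma J2_ideal: "ideal J2 R" by (rule ideal_prod_is_ideal[OF J_ideal J_ideal])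

lemma J2_sub: "J2 \<subseteq> J" using ideal_prod_inter[OF J_ideal J_ideal] by auto

lemma J2_left: "submodule J2 R (regular_module R)" by (rule ideal_submodule[OF J2_ideal])

lemma zero_left: "submodule {\<zero>} R (regular_module R)" using reg.submodule_0 by simp

lemma R_left: "submodule (carrier R) R (regular_module R)" by (rule reg.submodule_regular_carrier)

lemma finite_reg [simp]: "finite_interval R (regular_module R) X Y"
  by (rule finite_length_finite_interval[OF finite_regular])

lemma J2_least:
  assumes X: "submodule X R (regular_module R)" and "\<And>i j. \<lbrakk>i \<in> J; j \<in> J\<rbrakk> \<Longrightarrow> i \<otimes> j \<in> X"
  shows "J2 \<subseteq> X"
proof
  fix x assume "x \<in> J2"
  then show "x \<in> X"
    by (induction rule: ideal_prod.induct) (use assms reg.submodule_add[OF X] in auto)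
qed

lemma length_R_mod_J: "interval_length R (regular_module R) J (carrier R) = 1"
proof -
  have "J \<subset> carrier R" using one_notin_rad J_subset by auto
  then have "0 < interval_length R (regular_module R) J (carrier R)"
    using reg.interval_length_strict_mono[OF finite_reg rad_left R_left order_refl] by (metis gr_zeroI not_less_zero)
  moreover have "interval_length R (regular_module R) J (carrier R) \<le> 1"
    by (rule length_le_1(2)[OF rad_left left_inverse])
  ultimately show ?thesis by simp
qed

lemma length_R: "interval_length R (regular_module R) {\<zero>} (carrier R) = 1 + e + a"
proof -
  have z: "{\<zero>} \<subseteq> J2" "{\<zero>} \<subseteq> J" using reg.submodule_zero[OF J2_left] J2_sub by auto
  have "interval_length R (regular_module R) {\<zero>} (carrier R) =
      interval_length R (regular_module R) {\<zero>} J + interval_length R (regular_module R) J (carrier R)"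
    by (rule reg.interval_length_add(2)[OF finite_reg finite_reg zero_left rad_left R_left z(2) J_subset])
  moreover have "interval_length R (regular_module R) {\<zero>} J = a + e" unfolding a_def e_def
    by (rule reg.interval_length_add(2)[OF finite_reg finite_reg zero_left J2_left rad_left z(1) J2_sub])
  ultimately show ?thesis using length_R_mod_J by simp
qed

end

locale short_local_module = short_local_ring R + plain_left_module R M
  for R :: "('a, 'r) ring_scheme" (structure) and M :: "('a, 'm) module" (structure) +
  assumes fin_len: "finite_length R M"
begin

abbreviation rad :: "'m set \<Rightarrow> 'm set" where "rad N \<equiv> rad_mult R (sub_module M N)"

text \<open>\<open>len N L\<close> is the length of \<open>L/N\<close>, and \<open>top N\<close> the least number of generators
  of \<open>N\<close>.\<close>

abbreviation len :: "'m set \<Rightarrow> 'm set \<Rightarrow> nat" where "len \<equiv> interval_length R M"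
abbreviation top :: "'m set \<Rightarrow> nat" where "top N \<equiv> len (rad N) N"

lemma fin [simp]: "finite_interval R M X Y"
  by (rule finite_length_finite_interval[OF fin_len])

lemma len_add:
  "\<lbrakk>submodule N R M; submodule X R M; submodule L R M; N \<subseteq> X; X \<subseteq> L\<rbrakk> \<Longrightarrow> len N L = len N X + len X L"
  by (rule interval_length_add(2)[OF fin fin])

lemma len_eq_0:
  assumes "submodule N R M" "submodule L R M" "N \<subseteq> L" "len N L = 0" shows "N = L"
  using interval_length_strict_mono[OF fin assms(1,2) order_refl] assms by auto

lemma rad_generate:
  assumes N: "submodule N R M"
  shows "rad N = generate (add_monoid M) {j \<odot>\<^bsub>M\<^esub> x | j x. j \<in> J \<and> x \<in> N}"
proof -
  have "{j \<odot>\<^bsub>M\<^esub> x | j x. j \<in> J \<and> x \<in> N} \<subseteq> N"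
    using submodule_smult[OF N] J_closed by blast
  moreover have "subgroup N (add_monoid M)" using N by (simp add: submodule_def)
  ultimately have "generate (add_monoid M \<lparr>carrier := N\<rparr>) {j \<odot>\<^bsub>M\<^esub> x | j x. j \<in> J \<and> x \<in> N}
      = generate (add_monoid M) {j \<odot>\<^bsub>M\<^esub> x | j x. j \<in> J \<and> x \<in> N}"
    using group.generate_consistent[OF M.a_group] by blast
  then show ?thesis by (simp add: rad_mult_def)
qed

lemma mem_rad: "\<lbrakk>submodule N R M; j \<in> J; x \<in> N\<rbrakk> \<Longrightarrow> j \<odot>\<^bsub>M\<^esub> x \<in> rad N"
  by (auto simp: rad_generate intro!: generate.incl)

lemma rad_least:
  assumes N: "submodule N R M" and X: "submodule X R M"
    and "\<And>j x. \<lbrakk>j \<in> J; x \<in> N\<rbrakk> \<Longrightarrow> j \<odot>\<^bsub>M\<^esub> x \<in> X"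
  shows "rad N \<subseteq> X"
proof -
  have "{j \<odot>\<^bsub>M\<^esub> x | j x. j \<in> J \<and> x \<in> N} \<subseteq> X"
  proof
    fix y assume "y \<in> {j \<odot>\<^bsub>M\<^esub> x | j x. j \<in> J \<and> x \<in> N}"
    then obtain j x where "y = j \<odot>\<^bsub>M\<^esub> x" "j \<in> J" "x \<in> N" unfolding mem_Collect_eq by (elim exE conjE)
    then show "y \<in> X" using assms(3) by simp
  qed
  moreover have "subgroup X (add_monoid M)" using X by (simp add: submodule_def)
  ultimately show ?thesis
    unfolding rad_generate[OF N] by (rule group.generate_subgroup_incl[OF M.a_group])
qed

lemma submodule_rad:
  assumes N: "submodule N R M" shows "submodule (rad N) R M"
proof -
  let ?S = "{j \<odot>\<^bsub>M\<^esub> x | j x. j \<in> J \<and> x \<in> N}"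
  have Nc: "x \<in> carrier M" if "x \<in> N" for x using submodule_subset[OF N] that by auto
  have S: "?S \<subseteq> carrier M" using Nc J_closed by auto
  have gc: "g \<in> carrier M" if "g \<in> generate (add_monoid M) ?S" for g
    using group.generate_in_carrier[OF M.a_group, of ?S g] S that by simp
  have "r \<odot>\<^bsub>M\<^esub> g \<in> generate (add_monoid M) ?S" if r: "r \<in> carrier R"
    and g: "g \<in> generate (add_monoid M) ?S" for r g
    using g
  proof (induction rule: generate.induct)
    case one
    then show ?case using r generate.one[of "add_monoid M" ?S] by simp
  next
    case (incl h)
    then obtain j x where jx: "h = j \<odot>\<^bsub>M\<^esub> x" "j \<in> J" "x \<in> N" by auto
    then have "r \<odot>\<^bsub>M\<^esub> h = (r \<otimes> j) \<odot>\<^bsub>M\<^esub> x" "r \<otimes> j \<in> J"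
      using r Nc J_closed reg.submodule_smult[OF rad_left] by (auto simp: smult_assoc1)
    then show ?case using jx by (auto intro!: generate.incl)
  next
    case (inv h)
    then obtain j x where jx: "h = j \<odot>\<^bsub>M\<^esub> x" "j \<in> J" "x \<in> N" by auto
    then have "r \<odot>\<^bsub>M\<^esub> (\<ominus>\<^bsub>M\<^esub> h) = \<ominus>\<^bsub>M\<^esub> ((r \<otimes> j) \<odot>\<^bsub>M\<^esub> x)" "r \<otimes> j \<in> J"
      using r Nc J_closed reg.submodule_smult[OF rad_left] by (auto simp: smult_assoc1 smult_r_minus)
    moreover then have "(r \<otimes> j) \<odot>\<^bsub>M\<^esub> x \<in> ?S" using jx by auto
    ultimately show ?case using generate.inv[of "(r \<otimes> j) \<odot>\<^bsub>M\<^esub> x" ?S "add_monoid M"]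
      by (simp add: a_inv_def)
  next
    case (eng h1 h2)
    then show ?case
      using generate.eng[OF eng.IH] r gc[OF eng.hyps(1)] gc[OF eng.hyps(2)] by (simp add: smult_r_distr)
  qed
  moreover have "subgroup (rad N) (add_monoid M)"
    unfolding rad_generate[OF N] using group.generate_is_subgroup[OF M.a_group] S by simp
  ultimately show ?thesis
    by (intro submodule.intro submodule_axioms.intro) (simp_all add: rad_generate[OF N])
qed

lemma rad_subset: "submodule N R M \<Longrightarrow> rad N \<subseteq> N"
  by (rule rad_least) (simp_all add: J_closed submodule_smult)

lemma rad_mono:
  "\<lbrakk>submodule N R M; submodule L R M; N \<subseteq> L\<rbrakk> \<Longrightarrow> rad N \<subseteq> rad L"
  by (rule rad_least) (simp_all add: submodule_rad mem_rad subsetD)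

lemma rad_zero: "rad {\<zero>\<^bsub>M\<^esub>} = {\<zero>\<^bsub>M\<^esub>}"
  by (rule subset_antisym[OF rad_subset[OF submodule_0]])
    (simp add: submodule_zero[OF submodule_rad[OF submodule_0]])

lemma rad_set_add:
  assumes N: "submodule N R M" and L: "submodule L R M"
  shows "rad (N <+>\<^bsub>M\<^esub> L) = rad N <+>\<^bsub>M\<^esub> rad L"
proof
  note NL = submodule_set_add[OF N L] and r = submodule_rad[OF N] submodule_rad[OF L]
  show "rad (N <+>\<^bsub>M\<^esub> L) \<subseteq> rad N <+>\<^bsub>M\<^esub> rad L"
  proof (rule rad_least[OF NL submodule_set_add[OF r]])
    fix j x assume j: "j \<in> J" and "x \<in> N <+>\<^bsub>M\<^esub> L"
    then obtain n l where nl: "n \<in> N" "l \<in> L" "x = n \<oplus>\<^bsub>M\<^esub> l" unfolding mem_set_add by blast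
    have nlc: "n \<in> carrier M" "l \<in> carrier M"
      using nl submodule_subset[OF N] submodule_subset[OF L] by (simp_all add: subsetD)
    then have "j \<odot>\<^bsub>M\<^esub> x = j \<odot>\<^bsub>M\<^esub> n \<oplus>\<^bsub>M\<^esub> j \<odot>\<^bsub>M\<^esub> l"
      using J_closed[OF j] nl(3) by (simp add: smult_r_distr)
    then show "j \<odot>\<^bsub>M\<^esub> x \<in> rad N <+>\<^bsub>M\<^esub> rad L"
      unfolding mem_set_add using mem_rad[OF N j nl(1)] mem_rad[OF L j nl(2)] by (intro bexI)
  qed
  show "rad N <+>\<^bsub>M\<^esub> rad L \<subseteq> rad (N <+>\<^bsub>M\<^esub> L)"
    by (intro set_add_least submodule_rad NL rad_mono N L set_add_upper1 set_add_upper2)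
qed

definition killed :: "'m set" where "killed = {x \<in> carrier M. \<forall>j\<in>J. j \<odot>\<^bsub>M\<^esub> x = \<zero>\<^bsub>M\<^esub>}"

lemma submodule_killed: "submodule killed R M"
proof (rule submoduleI)
  show "r \<odot>\<^bsub>M\<^esub> x \<in> killed" if r: "r \<in> carrier R" and x: "x \<in> killed" for r x
  proof -
    have "j \<odot>\<^bsub>M\<^esub> (r \<odot>\<^bsub>M\<^esub> x) = \<zero>\<^bsub>M\<^esub>" if "j \<in> J" for j
      using smult_assoc1[of j r x, symmetric] rad_right[OF that r] that J_closed r x
      by (simp add: killed_def)
    then show ?thesis using r x by (simp add: killed_def)
  qed
qed (simp_all add: killed_def smult_r_distr J_closed subset_iff)

lemma rad_eq_zero_iff:
  assumes N: "submodule N R M" shows "rad N = {\<zero>\<^bsub>M\<^esub>} \<longleftrightarrow> N \<subseteq> killed"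
proof
  assume "rad N = {\<zero>\<^bsub>M\<^esub>}"
  then have "j \<odot>\<^bsub>M\<^esub> x = \<zero>\<^bsub>M\<^esub>" if "j \<in> J" "x \<in> N" for j x using mem_rad[OF N that] by simp
  then show "N \<subseteq> killed" using submodule_subset[OF N] by (simp add: killed_def subset_iff)
next
  assume "N \<subseteq> killed"
  then have "rad N \<subseteq> {\<zero>\<^bsub>M\<^esub>}"
    by (intro rad_least[OF N submodule_0]) (simp add: killed_def subset_iff)
  then show "rad N = {\<zero>\<^bsub>M\<^esub>}"
    by (rule subset_antisym) (simp add: submodule_zero[OF submodule_rad[OF N]])
qed

lemma rad_rad_killed:
  assumes N: "submodule N R M" shows "rad (rad N) \<subseteq> killed"
proof -
  let ?X = "{x \<in> carrier M. \<forall>i\<in>J. \<forall>j\<in>J. i \<odot>\<^bsub>M\<^esub> (j \<odot>\<^bsub>M\<^esub> x) = \<zero>\<^bsub>M\<^esub>}"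
  have X: "submodule ?X R M"
  proof (rule submoduleI)
    show "r \<odot>\<^bsub>M\<^esub> x \<in> ?X" if r: "r \<in> carrier R" and x: "x \<in> ?X" for r x
    proof -
      have "i \<odot>\<^bsub>M\<^esub> (j \<odot>\<^bsub>M\<^esub> (r \<odot>\<^bsub>M\<^esub> x)) = \<zero>\<^bsub>M\<^esub>" if "i \<in> J" "j \<in> J" for i j
        using smult_assoc1[of j r x, symmetric] rad_right[OF that(2) r] that J_closed r x by simp
      then show ?thesis using r x by simp
    qed
  qed (simp_all add: smult_r_distr J_closed subset_iff)
  have "rad N \<subseteq> ?X"
  proof (rule rad_least[OF N X])
    fix k x assume k: "k \<in> J" and "x \<in> N"
    then have x: "x \<in> carrier M" using submodule_subset[OF N] by auto
    have "i \<odot>\<^bsub>M\<^esub> (j \<odot>\<^bsub>M\<^esub> (k \<odot>\<^bsub>M\<^esub> x)) = \<zero>\<^bsub>M\<^esub>" if "i \<in> J" "j \<in> J" for i j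
      using smult_assoc1[of j k x] smult_assoc1[of i "j \<otimes> k" x] rad_nilpotent[OF that k] that k x
      by (simp add: J_closed)
    then show "k \<odot>\<^bsub>M\<^esub> x \<in> ?X" using k x J_closed by simp
  qed
  then show ?thesis
    by (intro rad_least[OF submodule_rad[OF N] submodule_killed])
      (simp add: killed_def J_closed subset_iff)
qed

lemma rad_rad_rad: "submodule N R M \<Longrightarrow> rad (rad (rad N)) = {\<zero>\<^bsub>M\<^esub>}"
  using rad_rad_killed rad_eq_zero_iff submodule_rad by simp

text \<open>Nakayama's lemma: substituting the equation \<open>N = JN + G\<close> into itself removes the first summand,
  as \<open>J\<close> is nilpotent.\<close>

lemma nakayama:
  assumes N: "submodule N R M" and G: "submodule G R M" and GN: "G \<subseteq> N"
    and NG: "N \<subseteq> rad N <+>\<^bsub>M\<^esub> G"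
  shows "N = G"
proof -
  have step: "N \<subseteq> rad X <+>\<^bsub>M\<^esub> G" if X: "submodule X R M" and NX: "N \<subseteq> X <+>\<^bsub>M\<^esub> G" for X
  proof -
    have rX: "submodule (rad X) R M" by (rule submodule_rad[OF X])
    have XG: "submodule (X <+>\<^bsub>M\<^esub> G) R M" by (rule submodule_set_add[OF X G])
    have rXG: "submodule (rad X <+>\<^bsub>M\<^esub> G) R M" by (rule submodule_set_add[OF rX G])
    have "rad N \<subseteq> rad (X <+>\<^bsub>M\<^esub> G)" by (rule rad_mono[OF N XG NX])
    also have "\<dots> = rad X <+>\<^bsub>M\<^esub> rad G" by (rule rad_set_add[OF X G])
    also have "\<dots> \<subseteq> rad X <+>\<^bsub>M\<^esub> G" by (rule set_add_mono[OF order_refl rad_subset[OF G]])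
    finally have "rad N <+>\<^bsub>M\<^esub> G \<subseteq> rad X <+>\<^bsub>M\<^esub> G"
      by (rule set_add_least[OF rXG]) (rule set_add_upper2[OF rX G])
    with NG show ?thesis by (rule subset_trans)
  qed
  have "N \<subseteq> rad (rad (rad N)) <+>\<^bsub>M\<^esub> G"
    using step[OF submodule_rad[OF submodule_rad[OF N]] step[OF submodule_rad[OF N] NG]] .
  then have "N \<subseteq> G" unfolding rad_rad_rad[OF N] set_add_zero[OF submodule_subset[OF G]] .
  then show ?thesis using GN by auto
qed

lemma rad_multiples_span:
  assumes I: "submodule I R (regular_module R)" and I': "submodule I' R (regular_module R)"
    and JI: "\<And>j i. \<lbrakk>j \<in> J; i \<in> I\<rbrakk> \<Longrightarrow> j \<otimes> i \<in> I'"
  shows "set ps \<subseteq> carrier M \<Longrightarrow> rad (multiples_span R M I ps) \<subseteq> multiples_span R M I' ps"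
proof (induction ps)
  case Nil
  then show ?case by (simp add: rad_zero)
next
  case (Cons p ps)
  then have p: "p \<in> carrier M" and ps: "set ps \<subseteq> carrier M" by auto
  have Ic: "i \<in> carrier R" if "i \<in> I" for i using reg.submodule_subset[OF I] that by auto
  have "rad ((\<lambda>a. a \<odot>\<^bsub>M\<^esub> p) ` I) \<subseteq> (\<lambda>a. a \<odot>\<^bsub>M\<^esub> p) ` I'"
  proof (rule rad_least[OF submodule_multiples[OF I p] submodule_multiples[OF I' p]])
    fix j x assume j: "j \<in> J" and "x \<in> (\<lambda>a. a \<odot>\<^bsub>M\<^esub> p) ` I"
    then obtain i where i: "i \<in> I" "x = i \<odot>\<^bsub>M\<^esub> p" by (elim imageE)
    then have "j \<odot>\<^bsub>M\<^esub> x = (j \<otimes> i) \<odot>\<^bsub>M\<^esub> p"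
      using p Ic[OF i(1)] J_closed[OF j] by (simp add: smult_assoc1)
    then show "j \<odot>\<^bsub>M\<^esub> x \<in> (\<lambda>a. a \<odot>\<^bsub>M\<^esub> p) ` I'" using JI[OF j i(1)] by (rule image_eqI)
  qed
  moreover have "rad (multiples_span R M I (p # ps)) =
      rad ((\<lambda>a. a \<odot>\<^bsub>M\<^esub> p) ` I) <+>\<^bsub>M\<^esub> rad (multiples_span R M I ps)"
    using rad_set_add[OF submodule_multiples[OF I p] submodule_multiples_span[OF I ps]] by simp
  ultimately show ?case using set_add_mono Cons.IH[OF ps] by simp
qed

lemma generators:
  assumes N: "submodule N R M"
  obtains ps where "set ps \<subseteq> N" "length ps \<le> top N" "N = multiples_span R M (carrier R) ps"
proof -
  obtain ps where ps: "set ps \<subseteq> N" "length ps \<le> top N"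
    "N = rad N <+>\<^bsub>M\<^esub> multiples_span R M (carrier R) ps"
    using exists_generators[OF submodule_rad[OF N] N rad_subset[OF N] fin] by blast
  have S: "submodule (multiples_span R M (carrier R) ps) R M"
    by (rule submodule_multiples_span[OF R_left subset_trans[OF ps(1) submodule_subset[OF N]]])
  have "N = multiples_span R M (carrier R) ps"
    by (rule nakayama[OF N S multiples_span_subset[OF N ps(1) order_refl]]) (use ps(3) in simp)
  then show thesis using that ps by blast
qed

lemma top_le:
  assumes N: "submodule N R M" and ps: "set ps \<subseteq> N"
    and "N \<subseteq> rad N <+>\<^bsub>M\<^esub> multiples_span R M (carrier R) ps"
  shows "top N \<le> length ps"
proof -
  have psM: "set ps \<subseteq> carrier M" using ps submodule_subset[OF N] by auto
  have "rad N <+>\<^bsub>M\<^esub> multiples_span R M (carrier R) ps \<subseteq> N"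
    by (rule set_add_least[OF N rad_subset[OF N] multiples_span_subset[OF N ps order_refl]])
  then have "N = rad N <+>\<^bsub>M\<^esub> multiples_span R M (carrier R) ps" using assms(3) by auto
  moreover have "len (rad N) (rad N <+>\<^bsub>M\<^esub> multiples_span R M (carrier R) ps) \<le> length ps * 1"
    using conjunct2[OF interval_length_multiples_span[OF R_left rad_left J_subset finite_reg
          submodule_rad[OF N] psM mem_rad[OF N _ subsetD[OF ps]]]]
    unfolding length_R_mod_J by simp
  ultimately show ?thesis by simp
qed

text \<open>Each layer of a module with \<open>n\<close> generators is a quotient of the corresponding layer of \<open>R\<^sup>n\<close>.\<close>

lemma length_bounds:
  assumes ps: "set ps \<subseteq> carrier M" and N: "N = multiples_span R M (carrier R) ps"
  shows "len {\<zero>\<^bsub>M\<^esub>} N \<le> length ps * (1 + e + a)"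
    and "len (rad (rad N)) (rad N) \<le> length ps * e"
    and "len {\<zero>\<^bsub>M\<^esub>} (rad (rad N)) \<le> length ps * a"
    and "rad N \<subseteq> multiples_span R M J ps" and "rad (rad N) \<subseteq> multiples_span R M J2 ps"
proof -
  have sN: "submodule N R M" unfolding N by (rule submodule_multiples_span[OF R_left ps])
  have sJ: "submodule (multiples_span R M J ps) R M" by (rule submodule_multiples_span[OF rad_left ps])
  have sJ2: "submodule (multiples_span R M J2 ps) R M" by (rule submodule_multiples_span[OF J2_left ps])
  note r = submodule_rad[OF sN] and rr = submodule_rad[OF submodule_rad[OF sN]]
  have z: "{\<zero>} \<subseteq> carrier R" "{\<zero>} \<subseteq> J2" using reg.submodule_zero[OF J2_left] by auto
  have zp: "x \<odot>\<^bsub>M\<^esub> p \<in> {\<zero>\<^bsub>M\<^esub>}" if "p \<in> set ps" "x \<in> {\<zero>}" for p x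
    using that ps by (simp add: subsetD)
  have e0: "{\<zero>\<^bsub>M\<^esub>} <+>\<^bsub>M\<^esub> X = X" if "submodule X R M" for X by (rule set_add_zero[OF submodule_subset[OF that]])
  show "len {\<zero>\<^bsub>M\<^esub>} N \<le> length ps * (1 + e + a)"
    using conjunct2[OF interval_length_multiples_span[OF R_left zero_left z(1) finite_reg submodule_0 ps zp]]
      e0[OF sN] unfolding length_R N[symmetric] by simp
  show 1: "rad N \<subseteq> multiples_span R M J ps" unfolding N
    by (rule rad_multiples_span[OF R_left rad_left rad_right ps])
  have "rad (rad N) \<subseteq> rad (multiples_span R M J ps)" by (rule rad_mono[OF r sJ 1])
  also have "\<dots> \<subseteq> multiples_span R M J2 ps"
    by (rule rad_multiples_span[OF rad_left J2_left ideal_prod.prod ps])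
  finally show 2: "rad (rad N) \<subseteq> multiples_span R M J2 ps" .
  have pN: "p \<in> N" if "p \<in> set ps" for p unfolding N by (rule subsetD[OF set_subset_multiples_span[OF ps] that])
  have J2p: "x \<odot>\<^bsub>M\<^esub> p \<in> rad (rad N)" if p: "p \<in> set ps" and x: "x \<in> J2" for p x
  proof -
    have pc: "p \<in> carrier M" using p ps by auto
    interpret h: plain_module_hom R "regular_module R" M "\<lambda>a. a \<odot>\<^bsub>M\<^esub> p" by (rule smult_hom[OF pc])
    let ?X = "{y \<in> carrier R. y \<odot>\<^bsub>M\<^esub> p \<in> rad (rad N)}"
    have "J2 \<subseteq> ?X"
    proof (rule J2_least)
      show "submodule ?X R (regular_module R)" using h.submodule_preimage[OF R_left rr] .
      show "i \<otimes> j \<in> ?X" if "i \<in> J" "j \<in> J" for i j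
        using that mem_rad[OF r that(1) mem_rad[OF sN that(2) pN[OF p]]] pc
        by (simp add: J_closed smult_assoc1)
    qed
    then show ?thesis using x by auto
  qed
  have "len (rad (rad N)) (rad (rad N) <+>\<^bsub>M\<^esub> multiples_span R M J ps) \<le> length ps * e"
    using conjunct2[OF interval_length_multiples_span[OF rad_left J2_left J2_sub finite_reg rr ps J2p]]
    by (simp add: e_def)
  moreover have "rad N \<subseteq> rad (rad N) <+>\<^bsub>M\<^esub> multiples_span R M J ps"
    by (rule subset_trans[OF 1 set_add_upper2[OF rr sJ]])
  then have "len (rad (rad N)) (rad N) \<le> len (rad (rad N)) (rad (rad N) <+>\<^bsub>M\<^esub> multiples_span R M J ps)"
    by (rule interval_length_mono[OF fin rr rad_subset[OF r]])
  ultimately show "len (rad (rad N)) (rad N) \<le> length ps * e" by simp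
  have "len {\<zero>\<^bsub>M\<^esub>} ({\<zero>\<^bsub>M\<^esub>} <+>\<^bsub>M\<^esub> multiples_span R M J2 ps) \<le> length ps * a"
    using conjunct2[OF interval_length_multiples_span[OF J2_left zero_left z(2) finite_reg submodule_0 ps zp]]
    by (simp add: a_def)
  moreover have "len {\<zero>\<^bsub>M\<^esub>} (rad (rad N)) \<le> len {\<zero>\<^bsub>M\<^esub>} (multiples_span R M J2 ps)"
    by (rule interval_length_mono[OF fin submodule_0 _ 2]) (use submodule_zero[OF rr] in auto)
  ultimately show "len {\<zero>\<^bsub>M\<^esub>} (rad (rad N)) \<le> length ps * a" using e0[OF sJ2] by simp
qed

end

locale short_local_hom = M: short_local_module R M + N: short_local_module R N +
  plain_module_hom R M N f
  for R :: "('a, 'r) ring_scheme" and M :: "('a, 'm) module" and N :: "('a, 'n) module" and f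
begin

lemma image_rad:
  assumes X: "submodule X R M"
  shows "f ` (M.rad X) = N.rad (f ` X)"
proof
  note fX = submodule_image[OF X]
  have Xc: "x \<in> carrier M" if "x \<in> X" for x using M.submodule_subset[OF X] that by auto
  have "M.rad X \<subseteq> {x \<in> carrier M. f x \<in> N.rad (f ` X)}"
    by (rule M.rad_least[OF X submodule_preimage[OF M.submodule_carrier N.submodule_rad[OF fX]]])
      (use N.mem_rad[OF fX] Xc M.J_closed in auto)
  then show "f ` (M.rad X) \<subseteq> N.rad (f ` X)" by auto
  show "N.rad (f ` X) \<subseteq> f ` (M.rad X)"
  proof (rule N.rad_least[OF fX submodule_image[OF M.submodule_rad[OF X]]])
    fix j y assume j: "j \<in> M.J" and "y \<in> f ` X"
    then obtain x where x: "x \<in> X" "y = f x" by auto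
    then show "j \<odot>\<^bsub>N\<^esub> y \<in> f ` (M.rad X)"
      using M.mem_rad[OF X j x(1)] hom_smult[of j x] Xc j M.J_closed by (metis imageI)
  qed
qed

end

section \<open>Free and projective modules\<close>

text \<open>The free module of rank \<open>n\<close>, realised in the type that carries the test modules for
  projectivity.\<close>

definition free_module :: "('a, 'r) ring_scheme \<Rightarrow> nat \<Rightarrow> ('a, nat \<Rightarrow> 'a) module" where
  "free_module R n = \<lparr> carrier = {f. (\<forall>i<n. f i \<in> carrier R) \<and> (\<forall>i\<ge>n. f i = \<zero>\<^bsub>R\<^esub>)},
     mult = undefined, one = undefined, zero = (\<lambda>i. \<zero>\<^bsub>R\<^esub>),
     add = (\<lambda>f g i. f i \<oplus>\<^bsub>R\<^esub> g i), smult = (\<lambda>a f i. a \<otimes>\<^bsub>R\<^esub> f i) \<rparr>"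

primrec linear_combination ::
  "('a, 'r) ring_scheme \<Rightarrow> ('a, 'm) module \<Rightarrow> 'm list \<Rightarrow> (nat \<Rightarrow> 'a) \<Rightarrow> 'm" where
  "linear_combination R M [] f = \<zero>\<^bsub>M\<^esub>"
| "linear_combination R M (p # ps) f =
     f 0 \<odot>\<^bsub>M\<^esub> p \<oplus>\<^bsub>M\<^esub> linear_combination R M ps (\<lambda>i. f (Suc i))"

context ring
begin

lemma mem_free_module:
  "f \<in> carrier (free_module R n) \<longleftrightarrow> (\<forall>i. f i \<in> carrier R) \<and> (\<forall>i\<ge>n. f i = \<zero>)"
  unfolding free_module_def by (auto, metis linorder_not_less zero_closed)

lemma free_module_simps [simp]:
  "\<zero>\<^bsub>free_module R n\<^esub> = (\<lambda>i. \<zero>)"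
  "f \<oplus>\<^bsub>free_module R n\<^esub> g = (\<lambda>i. f i \<oplus> g i)"
  "b \<odot>\<^bsub>free_module R n\<^esub> f = (\<lambda>i. b \<otimes> f i)"
  by (simp_all add: free_module_def)

lemma free_module_plain: "plain_left_module R (free_module R n)"
proof -
  have "abelian_group (free_module R n)"
  proof (rule abelian_groupI)
    fix x assume "x \<in> carrier (free_module R n)"
    then have "(\<lambda>i. \<ominus> x i) \<in> carrier (free_module R n)"
      "(\<lambda>i. \<ominus> x i) \<oplus>\<^bsub>free_module R n\<^esub> x = \<zero>\<^bsub>free_module R n\<^esub>"
      by (auto simp: mem_free_module l_neg minus_equality)
    then show "\<exists>y\<in>carrier (free_module R n). y \<oplus>\<^bsub>free_module R n\<^esub> x = \<zero>\<^bsub>free_module R n\<^esub>"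
      by blast
  qed (auto simp: mem_free_module a_ac)
  then show ?thesis
    unfolding plain_left_module_def
    by (intro left_module.intro ring_axioms left_module_axioms.intro)
      (auto simp: mem_free_module l_distr r_distr m_assoc)
qed

end

context plain_left_module
begin

lemma linear_combination_hom:
  assumes "set ps \<subseteq> carrier M"
  shows "plain_module_hom R (free_module R (length ps)) M (linear_combination R M ps)"
proof -
  interpret F: plain_left_module R "free_module R (length ps)" by (rule R.free_module_plain)
  have closed: "linear_combination R M ps f \<in> carrier M" if "\<forall>i. f i \<in> carrier R" for f
    using assms that by (induction ps arbitrary: f) simp_all
  have add: "linear_combination R M ps (\<lambda>i. f i \<oplus> g i) =
      linear_combination R M ps f \<oplus>\<^bsub>M\<^esub> linear_combination R M ps g"
    if "\<forall>i. f i \<in> carrier R" "\<forall>i. g i \<in> carrier R" for f g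
    using assms that
  proof (induction ps arbitrary: f g)
    case (Cons p ps)
    have c: "linear_combination R M ps h \<in> carrier M" if "\<forall>i. h i \<in> carrier R" for h
      using Cons.prems(1) that by (induction ps arbitrary: h) simp_all
    show ?case using Cons by (simp add: c smult_l_distr M.a_ac)
  qed simp
  have smult: "linear_combination R M ps (\<lambda>i. b \<otimes> f i) = b \<odot>\<^bsub>M\<^esub> linear_combination R M ps f"
    if "b \<in> carrier R" "\<forall>i. f i \<in> carrier R" for b f
    using assms that
  proof (induction ps arbitrary: f)
    case (Cons p ps)
    have c: "linear_combination R M ps h \<in> carrier M" if "\<forall>i. h i \<in> carrier R" for h
      using Cons.prems(1) that by (induction ps arbitrary: h) simp_all
    show ?case using Cons by (simp add: c smult_r_distr smult_assoc1)
  qed simp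
  show ?thesis
    by unfold_locales
      (simp add: left_module_hom_def hom_def R.mem_free_module closed add smult Pi_def)
qed

lemma linear_combination_image:
  assumes "set ps \<subseteq> carrier M"
  shows "linear_combination R M ps ` carrier (free_module R (length ps))
    = multiples_span R M (carrier R) ps"
  using assms
proof (induction ps)
  case Nil
  have "(\<lambda>i. \<zero>) \<in> carrier (free_module R 0)" by (simp add: R.mem_free_module)
  then show ?case by (auto intro!: image_eqI)
next
  case (Cons p ps)
  let ?F = "\<lambda>n. carrier (free_module R n)"
  have IH: "linear_combination R M ps ` ?F (length ps) = multiples_span R M (carrier R) ps"
    using Cons by simp
  show ?case
  proof (rule Set.set_eqI, rule iffI)
    fix x assume "x \<in> linear_combination R M (p # ps) ` ?F (length (p # ps))"
    then obtain f where f: "f \<in> ?F (Suc (length ps))" "x = linear_combination R M (p # ps) f" by auto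
    then have "f 0 \<in> carrier R" "(\<lambda>i. f (Suc i)) \<in> ?F (length ps)" by (simp_all add: R.mem_free_module)
    then have 1: "f 0 \<odot>\<^bsub>M\<^esub> p \<in> (\<lambda>b. b \<odot>\<^bsub>M\<^esub> p) ` carrier R"
      and 2: "linear_combination R M ps (\<lambda>i. f (Suc i)) \<in> multiples_span R M (carrier R) ps"
      unfolding IH[symmetric] by (simp_all)
    show "x \<in> multiples_span R M (carrier R) (p # ps)"
      unfolding multiples_span.simps mem_set_add f(2) linear_combination.simps
      by (rule bexI[OF bexI[OF refl 2] 1])
  next
    fix x assume "x \<in> multiples_span R M (carrier R) (p # ps)"
    then obtain u v where uv: "u \<in> (\<lambda>b. b \<odot>\<^bsub>M\<^esub> p) ` carrier R"
      "v \<in> multiples_span R M (carrier R) ps" "x = u \<oplus>\<^bsub>M\<^esub> v"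
      unfolding multiples_span.simps mem_set_add by (elim bexE)
    then obtain b where b: "b \<in> carrier R" "u = b \<odot>\<^bsub>M\<^esub> p" by (elim imageE)
    obtain f where f: "f \<in> ?F (length ps)" "v = linear_combination R M ps f"
      using uv(2) unfolding IH[symmetric] by (elim imageE)
    have "case_nat b f \<in> ?F (length (p # ps))"
      using b f by (auto simp: R.mem_free_module split: nat.split)
    then show "x \<in> linear_combination R M (p # ps) ` ?F (length (p # ps))"
      using uv(3) b(2) f(2) by (intro image_eqI[of _ _ "case_nat b f"]) simp_all
  qed
qed

end

context short_local_ring
begin

text \<open>The unit vectors generate the free module; that its length is not smaller than \<open>n\<close> times the
  length of \<open>R\<close> is seen from the filtration by the vectors supported on \<open>{..<m}\<close>.\<close>

lemma free_module_short_local: "short_local_module R (free_module R n)"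
  and free_module_generated:
    "\<exists>us. set us \<subseteq> carrier (free_module R n) \<and> length us = n \<and>
      carrier (free_module R n) = multiples_span R (free_module R n) (carrier R) us"
  and free_module_length:
    "n * (1 + e + a) \<le> interval_length R (free_module R n) {\<zero>\<^bsub>free_module R n\<^esub>} (carrier (free_module R n))"
proof -
  let ?F = "free_module R n"
  interpret F: plain_left_module R ?F by (rule free_module_plain)
  define u where "u = (\<lambda>(i :: nat) j. if j = i then \<one> else \<zero> :: 'a)"
  let ?us = "map u [0..<n]"
  have uc: "set ?us \<subseteq> carrier ?F" by (auto simp: mem_free_module u_def)
  let ?S = "multiples_span R ?F (carrier R) ?us"
  have S: "submodule ?S R ?F" by (rule F.submodule_multiples_span[OF R_left uc])
  have uS: "u i \<in> ?S" if "i < n" for i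
    by (rule subsetD[OF F.set_subset_multiples_span[OF uc]]) (use that in simp)
  define G where "G = (\<lambda>m. {f \<in> carrier ?F. \<forall>i\<ge>m. f i = \<zero>})"
  have GS: "m \<le> n \<Longrightarrow> f \<in> G m \<Longrightarrow> f \<in> ?S" for m f
  proof (induction m arbitrary: f)
    case 0
    then have "f = (\<lambda>i. \<zero>)" by (auto simp: G_def)
    then show ?case using F.submodule_zero[OF S] by simp
  next
    case (Suc m)
    have fc: "f i \<in> carrier R" for i using Suc.prems(2) by (simp add: G_def mem_free_module)
    have "f(m := \<zero>) \<in> G m"
      using Suc.prems by (auto simp: G_def mem_free_module not_less_eq_eq le_Suc_eq)
    then have "f(m := \<zero>) \<in> ?S" using Suc by simp
    moreover have "f m \<odot>\<^bsub>?F\<^esub> u m \<in> ?S"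
      by (rule F.submodule_smult[OF S fc uS]) (use Suc.prems(1) in simp)
    ultimately have "f(m := \<zero>) \<oplus>\<^bsub>?F\<^esub> (f m \<odot>\<^bsub>?F\<^esub> u m) \<in> ?S" by (rule F.submodule_add[OF S])
    also have "f(m := \<zero>) \<oplus>\<^bsub>?F\<^esub> (f m \<odot>\<^bsub>?F\<^esub> u m) = f"
      using fc by (auto simp: u_def)
    finally show ?case .
  qed
  have "carrier ?F \<subseteq> ?S" using GS[of n] by (auto simp: G_def mem_free_module)
  then have FS: "carrier ?F = ?S" using F.submodule_subset[OF S] by (rule subset_antisym)
  show "\<exists>us. set us \<subseteq> carrier ?F \<and> length us = n \<and> carrier ?F = multiples_span R ?F (carrier R) us"
    using uc FS by (intro exI[of _ ?us]) simp
  have "finite_interval R ?F {\<zero>\<^bsub>?F\<^esub>} ({\<zero>\<^bsub>?F\<^esub>} <+>\<^bsub>?F\<^esub> ?S)"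
    by (rule conjunct1[OF F.interval_length_multiples_span[OF R_left zero_left _ finite_reg F.submodule_0 uc]])
      (auto simp: mem_free_module u_def)
  then have fin: "finite_length R ?F"
    unfolding F.set_add_zero[OF F.submodule_subset[OF S]] F.finite_length_eq FS .
  show F: "short_local_module R ?F"
    by (intro short_local_module.intro short_local_ring_axioms free_module_plain
        short_local_module_axioms.intro fin)
  interpret F: short_local_module R ?F by (rule F)
  have G: "submodule (G m) R ?F" for m
    by (rule F.submoduleI) (auto simp: G_def mem_free_module)
  have GG: "G m \<subseteq> G (Suc m)" for m by (auto simp: G_def)
  have "m \<le> n \<Longrightarrow> m * (1 + e + a) \<le> F.len {\<zero>\<^bsub>?F\<^esub>} (G m)" for m
  proof (induction m)
    case (Suc m)
    have "plain_module_hom R ?F (regular_module R) (\<lambda>f. f m)"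
      by unfold_locales (auto simp: left_module_hom_def hom_def mem_free_module)
    then interpret ev: plain_module_hom R ?F "regular_module R" "\<lambda>f. f m" .
    have "(\<lambda>f. f m) ` G m = {\<zero>}"
      using F.submodule_zero[OF G[of m]] by (force simp: G_def)
    moreover have "(\<lambda>f. f m) ` G (Suc m) = carrier R"
    proof
      show "carrier R \<subseteq> (\<lambda>f. f m) ` G (Suc m)"
      proof
        fix b assume "b \<in> carrier R"
        then have "(\<lambda>i. if i = m then b else \<zero>) \<in> G (Suc m)"
          using Suc.prems by (auto simp: G_def mem_free_module)
        then show "b \<in> (\<lambda>f. f m) ` G (Suc m)" by (rule rev_image_eqI) simp
      qed
    qed (auto simp: G_def mem_free_module)
    ultimately have "1 + e + a \<le> F.len (G m) (G (Suc m))"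
      using ev.interval_length_image_le(2)[OF F.fin G G GG, of m] length_R by simp
    moreover have "F.len {\<zero>\<^bsub>?F\<^esub>} (G (Suc m)) = F.len {\<zero>\<^bsub>?F\<^esub>} (G m) + F.len (G m) (G (Suc m))"
      by (rule F.len_add[OF F.submodule_0 G G _ GG]) (simp add: F.submodule_zero[OF G, simplified])
    ultimately show ?case using Suc by simp
  qed simp
  moreover have "G n = carrier ?F" by (auto simp: G_def mem_free_module)
  ultimately show "n * (1 + e + a) \<le> F.len {\<zero>\<^bsub>?F\<^esub>} (carrier ?F)" by (metis order_refl)
qed

end

context short_local_module
begin

text \<open>A projective module \<open>M\<close> with \<open>n = top M\<close> generators is a direct summand of the free module
  \<open>R\<^sup>n\<close> by a split epimorphism whose kernel lies in the radical, so that Nakayama's lemma makes the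
  splitting surjective. The epimorphism is presented to the definition of projectivity by a copy of
  \<open>M\<close> on a set of representatives in \<open>R\<^sup>n\<close>.\<close>

lemma projective_length:
  assumes proj: "projective_module R M"
  shows "len {\<zero>\<^bsub>M\<^esub>} (carrier M) = top (carrier M) * (1 + e + a)"
proof -
  obtain ps where ps: "set ps \<subseteq> carrier M" "length ps \<le> top (carrier M)"
    "carrier M = multiples_span R M (carrier R) ps"
    using generators[OF submodule_carrier] by blast
  let ?n = "length ps"
  let ?F = "free_module R ?n"
  let ?\<pi> = "linear_combination R M ps"
  have rM: "submodule (rad (carrier M)) R M" by (rule submodule_rad[OF submodule_carrier])
  have "top (carrier M) \<le> ?n"
    by (rule top_le[OF submodule_carrier ps(1)])
      (subst ps(3)[symmetric], rule set_add_upper2[OF rM submodule_carrier])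
  then have n: "?n = top (carrier M)" using ps(2) by simp
  interpret F: short_local_module R ?F by (rule free_module_short_local)
  interpret \<pi>: plain_module_hom R ?F M ?\<pi> by (rule linear_combination_hom[OF ps(1)])
  interpret \<pi>: short_local_hom R ?F M ?\<pi> by unfold_locales
  have surj: "?\<pi> ` carrier ?F = carrier M"
    using linear_combination_image[OF ps(1)] ps(3) by simp
  define \<sigma> where "\<sigma> x = (SOME f. f \<in> carrier ?F \<and> ?\<pi> f = x)" for x
  have \<sigma>: "\<sigma> x \<in> carrier ?F" "?\<pi> (\<sigma> x) = x" if "x \<in> carrier M" for x
  proof -
    have "\<exists>f. f \<in> carrier ?F \<and> ?\<pi> f = x" using that surj by (metis imageE)
    then have "\<sigma> x \<in> carrier ?F \<and> ?\<pi> (\<sigma> x) = x" unfolding \<sigma>_def by (rule someI_ex)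
    then show "\<sigma> x \<in> carrier ?F" "?\<pi> (\<sigma> x) = x" by simp_all
  qed
  \<comment> \<open>\<open>Y\<close> is \<open>M\<close> with its structure transported to the representatives \<open>\<sigma> x\<close>.\<close>
  define Y :: "('a, nat \<Rightarrow> 'a) module" where
    "Y = \<lparr>carrier = \<sigma> ` carrier M, mult = undefined, one = undefined, zero = \<sigma> \<zero>\<^bsub>M\<^esub>,
      add = (\<lambda>u v. \<sigma> (?\<pi> u \<oplus>\<^bsub>M\<^esub> ?\<pi> v)), smult = (\<lambda>b u. \<sigma> (b \<odot>\<^bsub>M\<^esub> ?\<pi> u))\<rparr>"
  have Ys: "carrier Y = \<sigma> ` carrier M" "\<zero>\<^bsub>Y\<^esub> = \<sigma> \<zero>\<^bsub>M\<^esub>"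
    "\<And>x y. \<lbrakk>x \<in> carrier M; y \<in> carrier M\<rbrakk> \<Longrightarrow> \<sigma> x \<oplus>\<^bsub>Y\<^esub> \<sigma> y = \<sigma> (x \<oplus>\<^bsub>M\<^esub> y)"
    "\<And>b x. x \<in> carrier M \<Longrightarrow> b \<odot>\<^bsub>Y\<^esub> \<sigma> x = \<sigma> (b \<odot>\<^bsub>M\<^esub> x)"
    by (simp_all add: Y_def \<sigma>)
  have "abelian_group Y"
  proof (rule abelian_groupI)
    fix x assume "x \<in> carrier Y"
    then obtain y where "y \<in> carrier M" "x = \<sigma> y" by (auto simp: Ys)
    then have "\<sigma> (\<ominus>\<^bsub>M\<^esub> y) \<in> carrier Y" "\<sigma> (\<ominus>\<^bsub>M\<^esub> y) \<oplus>\<^bsub>Y\<^esub> x = \<zero>\<^bsub>Y\<^esub>"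
      by (simp_all add: Ys M.l_neg)
    then show "\<exists>y\<in>carrier Y. y \<oplus>\<^bsub>Y\<^esub> x = \<zero>\<^bsub>Y\<^esub>" by blast
  qed (auto simp: Ys M.a_ac)
  then have "left_module R Y"
    by (intro left_module.intro ring_axioms left_module_axioms.intro)
      (auto simp: Ys smult_l_distr smult_r_distr smult_assoc1)
  then interpret Y: plain_left_module R Y by (simp add: plain_left_module_def)
  have "(\<lambda>f. \<sigma> (?\<pi> f)) \<in> left_module_hom R ?F Y"
    unfolding left_module_hom_def hom_def
    using \<pi>.hom_closed \<pi>.hom_add \<pi>.hom_smult
    by (auto simp: Ys simp del: free_module_simps)
  then interpret g: plain_module_hom R ?F Y "\<lambda>f. \<sigma> (?\<pi> f)" by unfold_locales
  have gsurj: "(\<lambda>f. \<sigma> (?\<pi> f)) ` carrier ?F = carrier Y"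
    using surj by (simp add: Ys image_image[symmetric])
  have "finite_interval R Y ((\<lambda>f. \<sigma> (?\<pi> f)) ` {\<zero>\<^bsub>?F\<^esub>}) ((\<lambda>f. \<sigma> (?\<pi> f)) ` carrier ?F)"
    by (rule g.interval_length_image_le(1)[OF F.fin F.submodule_0 F.submodule_carrier])
      (simp add: mem_free_module)
  then have "finite_length R Y"
    unfolding Y.finite_length_eq gsurj using g.hom_zero by simp
  then have Y_fl: "fl_module R Y" and F_fl: "fl_module R ?F"
    using \<open>left_module R Y\<close> F.fin_len F.left_module_axioms by (simp_all add: fl_module_def)
  have "\<sigma> \<in> left_module_hom R M Y"
    by (auto simp: left_module_hom_def hom_def Ys)
  then obtain h where h: "h \<in> left_module_hom R M ?F" and hs: "\<And>x. x \<in> carrier M \<Longrightarrow> \<sigma> (?\<pi> (h x)) = \<sigma> x"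
    using proj[unfolded projective_module_def] F_fl Y_fl g.hom gsurj by blast
  interpret h: plain_module_hom R M ?F h using h by unfold_locales
  have \<pi>h: "?\<pi> (h x) = x" if "x \<in> carrier M" for x
    using arg_cong[OF hs[OF that], of ?\<pi>] \<sigma>(2)[OF that] \<sigma>(2)[OF \<pi>.hom_closed[OF h.hom_closed[OF that]]] by simp
  let ?W = "a_kernel ?F M ?\<pi>"
  have W: "submodule ?W R ?F" by (rule \<pi>.submodule_kernel)
  have r: "submodule (F.rad (carrier ?F)) R ?F" by (rule F.submodule_rad[OF F.submodule_carrier])
  let ?rW = "F.rad (carrier ?F) <+>\<^bsub>?F\<^esub> ?W"
  have rW: "submodule ?rW R ?F" by (rule F.submodule_set_add[OF r W])
  have rWF: "?rW \<subseteq> carrier ?F" by (rule F.submodule_subset[OF rW])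
  have "?\<pi> ` ?W = {\<zero>\<^bsub>M\<^esub>}"
    using F.submodule_zero[OF W] \<pi>.hom_zero by (force simp: \<pi>.kernel_eq)
  then have "?\<pi> ` ?rW = rad (carrier M)"
    using \<pi>.image_set_add[OF F.submodule_subset[OF r] F.submodule_subset[OF W]]
      \<pi>.image_rad[OF F.submodule_carrier] surj set_add_commute[OF submodule_subset[OF rM] submodule_subset[OF submodule_0]]
      set_add_zero[OF submodule_subset[OF rM]] by simp
  then have "F.len ?rW (carrier ?F) = ?n"
    using \<pi>.interval_length_image(2)[OF fin rW F.submodule_carrier rWF F.set_add_upper2[OF r W]]
      surj n by simp
  moreover have "F.top (carrier ?F) \<le> ?n"
  proof -
    obtain us where us: "set us \<subseteq> carrier ?F" "length us = ?n"
      "carrier ?F = multiples_span R ?F (carrier R) us"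
      using free_module_generated by blast
    have "F.top (carrier ?F) \<le> length us"
      by (rule F.top_le[OF F.submodule_carrier us(1)])
        (subst us(3)[symmetric], rule F.set_add_upper2[OF r F.submodule_carrier])
    then show ?thesis using us(2) by simp
  qed
  ultimately have "F.len (F.rad (carrier ?F)) ?rW = 0"
    using F.len_add[OF r rW F.submodule_carrier F.set_add_upper1[OF r W] rWF] by simp
  then have "F.rad (carrier ?F) = ?rW"
    by (rule F.len_eq_0[OF r rW F.set_add_upper1[OF r W]])
  then have Wr: "?W \<subseteq> F.rad (carrier ?F)" using F.set_add_upper2[OF r W] by simp
  let ?H = "h ` carrier M"
  have H: "submodule ?H R ?F" by (rule h.submodule_image[OF submodule_carrier])
  have "carrier ?F \<subseteq> F.rad (carrier ?F) <+>\<^bsub>?F\<^esub> ?H"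
  proof
    fix y assume y: "y \<in> carrier ?F"
    let ?z = "h (?\<pi> y)"
    have z: "?z \<in> carrier ?F" using y h.hom_closed \<pi>.hom_closed by simp
    have "?\<pi> (y \<ominus>\<^bsub>?F\<^esub> ?z) = \<zero>\<^bsub>M\<^esub>"
      using \<pi>.hom_minus[OF y z] \<pi>h[OF \<pi>.hom_closed[OF y]] \<pi>.hom_closed[OF y] by (simp add: M.r_neg a_minus_def)
    then have "y \<ominus>\<^bsub>?F\<^esub> ?z \<in> F.rad (carrier ?F)"
      using Wr y z by (auto simp: \<pi>.kernel_eq)
    moreover have "y = (y \<ominus>\<^bsub>?F\<^esub> ?z) \<oplus>\<^bsub>?F\<^esub> ?z"
      using y z by (simp add: a_minus_def F.M.a_assoc F.M.l_neg del: free_module_simps)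
    moreover have "?z \<in> ?H" using \<pi>.hom_closed[OF y] by simp
    ultimately show "y \<in> F.rad (carrier ?F) <+>\<^bsub>?F\<^esub> ?H" unfolding F.mem_set_add by (intro bexI)
  qed
  then have "carrier ?F = ?H"
    by (rule F.nakayama[OF F.submodule_carrier H F.submodule_subset[OF H]])
  then have "F.len {\<zero>\<^bsub>?F\<^esub>} (carrier ?F) \<le> len {\<zero>\<^bsub>M\<^esub>} (carrier M)"
    using h.interval_length_image_le(2)[OF fin submodule_0 submodule_carrier] h.hom_zero by simp
  then have "?n * (1 + e + a) \<le> len {\<zero>\<^bsub>M\<^esub>} (carrier M)"
    using free_module_length[of ?n] by linarith
  moreover have "len {\<zero>\<^bsub>M\<^esub>} (carrier M) \<le> ?n * (1 + e + a)"
    by (rule length_bounds(1)[OF ps(1,3)])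
  ultimately show ?thesis using n by simp
qed

end

section \<open>Syzygies\<close>

context short_local_module
begin

lemma len_second_iso:
  "\<lbrakk>submodule Q R M; submodule I R M\<rbrakk> \<Longrightarrow> len Q (Q <+>\<^bsub>M\<^esub> I) = len (Q \<inter> I) I"
  by (rule interval_length_second_iso(2)[OF fin])

lemma zero_subset: "submodule N R M \<Longrightarrow> {\<zero>\<^bsub>M\<^esub>} \<subseteq> N"
  by (simp add: submodule_zero)

lemma set_add_inter_of_direct:
  assumes X: "submodule X R M" and Y: "submodule Y R M" and XY: "X \<inter> Y = {\<zero>\<^bsub>M\<^esub>}"
    and Z: "submodule Z R M" "Z \<subseteq> X" and V: "submodule V R M" "V \<subseteq> Y"
  shows "(Z <+>\<^bsub>M\<^esub> V) \<inter> X = Z"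
proof -
  have "V \<inter> X \<subseteq> {\<zero>\<^bsub>M\<^esub>}" using XY V(2) by auto
  then have VX: "V \<inter> X = {\<zero>\<^bsub>M\<^esub>}"
    by (rule subset_antisym) (rule zero_subset[OF submodule_inter[OF V(1) X]])
  have "(Z <+>\<^bsub>M\<^esub> V) \<inter> X = Z <+>\<^bsub>M\<^esub> (V \<inter> X)" by (rule modular_law[OF Z(1) V(1) X Z(2)])
  also have "\<dots> = Z" unfolding VX by (rule set_add_absorb[OF Z(1) submodule_0 zero_subset[OF Z(1)]])
  finally show ?thesis .
qed

lemma top_direct_sum:
  assumes X: "submodule X R M" and Y: "submodule Y R M" and XY: "X \<inter> Y = {\<zero>\<^bsub>M\<^esub>}"
  shows "top (X <+>\<^bsub>M\<^esub> Y) = top X + top Y"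
proof -
  let ?r = "rad X <+>\<^bsub>M\<^esub> rad Y"
  note rX = submodule_rad[OF X] and rY = submodule_rad[OF Y]
  have r: "submodule ?r R M" by (rule submodule_set_add[OF rX rY])
  have XrY: "submodule (X <+>\<^bsub>M\<^esub> rad Y) R M" by (rule submodule_set_add[OF X rY])
  have XYs: "submodule (X <+>\<^bsub>M\<^esub> Y) R M" by (rule submodule_set_add[OF X Y])
  note c = submodule_subset
  have r_comm: "?r = rad Y <+>\<^bsub>M\<^esub> rad X" by (rule set_add_commute[OF c[OF rX] c[OF rY]])
  have "X <+>\<^bsub>M\<^esub> rad X = X" by (rule set_add_absorb[OF X rX rad_subset[OF X]])
  then have "rad X <+>\<^bsub>M\<^esub> X = X" using set_add_commute[OF c[OF X] c[OF rX]] by simp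
  then have 1: "?r <+>\<^bsub>M\<^esub> X = X <+>\<^bsub>M\<^esub> rad Y"
    unfolding r_comm using set_add_assoc[OF c[OF rY] c[OF rX] c[OF X]]
      set_add_commute[OF c[OF X] c[OF rY]] by simp
  have "Y <+>\<^bsub>M\<^esub> rad Y = Y" by (rule set_add_absorb[OF Y rY rad_subset[OF Y]])
  then have "rad Y <+>\<^bsub>M\<^esub> Y = Y" using set_add_commute[OF c[OF Y] c[OF rY]] by simp
  then have 2: "(X <+>\<^bsub>M\<^esub> rad Y) <+>\<^bsub>M\<^esub> Y = X <+>\<^bsub>M\<^esub> Y"
    using set_add_assoc[OF c[OF X] c[OF rY] c[OF Y]] by simp
  have 3: "?r \<inter> X = rad X" by (rule set_add_inter_of_direct[OF X Y XY rX rad_subset[OF X] rY rad_subset[OF Y]])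
  have "(rad Y <+>\<^bsub>M\<^esub> X) \<inter> Y = rad Y"
    using set_add_inter_of_direct[OF Y X _ rY rad_subset[OF Y] X order_refl] XY by (simp add: Int_commute)
  then have 4: "(X <+>\<^bsub>M\<^esub> rad Y) \<inter> Y = rad Y" using set_add_commute[OF c[OF X] c[OF rY]] by simp
  have s1: "?r \<subseteq> X <+>\<^bsub>M\<^esub> rad Y" by (rule set_add_mono[OF rad_subset[OF X] order_refl])
  have s2: "X <+>\<^bsub>M\<^esub> rad Y \<subseteq> X <+>\<^bsub>M\<^esub> Y" by (rule set_add_mono[OF order_refl rad_subset[OF Y]])
  have "top (X <+>\<^bsub>M\<^esub> Y) = len ?r (X <+>\<^bsub>M\<^esub> Y)" unfolding rad_set_add[OF X Y] by (rule refl)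
  also have "\<dots> = len ?r (X <+>\<^bsub>M\<^esub> rad Y) + len (X <+>\<^bsub>M\<^esub> rad Y) (X <+>\<^bsub>M\<^esub> Y)"
    by (rule len_add[OF r XrY XYs s1 s2])
  also have "len ?r (X <+>\<^bsub>M\<^esub> rad Y) = top X"
    using len_second_iso[OF r X] unfolding 1 3 .
  also have "len (X <+>\<^bsub>M\<^esub> rad Y) (X <+>\<^bsub>M\<^esub> Y) = top Y"
    using len_second_iso[OF XrY Y] unfolding 2 4 .
  finally show ?thesis .
qed

text \<open>The bounds on the layers add up to the length of a free module, so equality in the sum forces
  equality in each layer.\<close>

lemma free_layers:
  assumes free: "len {\<zero>\<^bsub>M\<^esub>} (carrier M) = top (carrier M) * (1 + e + a)"
  shows "len (rad (rad (carrier M))) (rad (carrier M)) = top (carrier M) * e"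
    and "len {\<zero>\<^bsub>M\<^esub>} (rad (rad (carrier M))) = top (carrier M) * a"
proof -
  let ?P = "carrier M"
  note P = submodule_carrier
  note r = submodule_rad[OF P] and rr = submodule_rad[OF submodule_rad[OF P]]
  obtain ps where ps: "set ps \<subseteq> ?P" "length ps \<le> top ?P" "?P = multiples_span R M (carrier R) ps"
    using generators[OF P] by blast
  note b = length_bounds[OF ps(1,3)]
  have "len {\<zero>\<^bsub>M\<^esub>} ?P = len {\<zero>\<^bsub>M\<^esub>} (rad ?P) + top ?P"
    by (rule len_add[OF submodule_0 r P zero_subset[OF r] rad_subset[OF P]])
  moreover have "len {\<zero>\<^bsub>M\<^esub>} (rad ?P) = len {\<zero>\<^bsub>M\<^esub>} (rad (rad ?P)) + len (rad (rad ?P)) (rad ?P)"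
    by (rule len_add[OF submodule_0 rr r zero_subset[OF rr] rad_subset[OF r]])
  moreover have "length ps * e \<le> top ?P * e" "length ps * a \<le> top ?P * a"
    using ps(2) by (rule mult_le_mono1)+
  moreover have "len {\<zero>\<^bsub>M\<^esub>} ?P = top ?P + top ?P * e + top ?P * a"
    unfolding free by (simp only: add_mult_distrib2 mult_1_right)
  ultimately show "len (rad (rad ?P)) (rad ?P) = top ?P * e"
    and "len {\<zero>\<^bsub>M\<^esub>} (rad (rad ?P)) = top ?P * a"
    using b(2,3) by linarith+
qed

text \<open>The elements of \<open>J\<^sup>2M\<close> are killed by \<open>J\<close>, so only generators of \<open>X\<close> outside \<open>J\<^sup>2M\<close> contribute
  to \<open>JX\<close>, each at most \<open>e\<close>.\<close>

lemma rad_length_bound: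
  assumes X: "submodule X R M" and Xr: "X \<subseteq> rad (carrier M)" and rX: "rad (rad (carrier M)) \<subseteq> X"
  shows "len {\<zero>\<^bsub>M\<^esub>} (rad X) \<le> len (rad (rad (carrier M))) X * e"
proof -
  let ?Q = "rad (rad (carrier M))"
  note r = submodule_rad[OF submodule_carrier]
  note Q = submodule_rad[OF r]
  obtain ps where ps: "set ps \<subseteq> X" "length ps \<le> len ?Q X" "X = ?Q <+>\<^bsub>M\<^esub> multiples_span R M (carrier R) ps"
    using exists_generators[OF Q X rX fin] by blast
  have psM: "set ps \<subseteq> carrier M" by (rule subset_trans[OF ps(1) submodule_subset[OF X]])
  have S: "submodule (multiples_span R M (carrier R) ps) R M" by (rule submodule_multiples_span[OF R_left psM])
  have T: "submodule (multiples_span R M J ps) R M" by (rule submodule_multiples_span[OF rad_left psM])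
  have "rad X = rad ?Q <+>\<^bsub>M\<^esub> rad (multiples_span R M (carrier R) ps)"
    using rad_set_add[OF Q S] ps(3) by simp
  also have "\<dots> = rad (multiples_span R M (carrier R) ps)"
    unfolding rad_rad_rad[OF submodule_carrier] by (rule set_add_zero[OF submodule_subset[OF submodule_rad[OF S]]])
  also have "\<dots> \<subseteq> multiples_span R M J ps" by (rule rad_multiples_span[OF R_left rad_left rad_right psM])
  finally have 1: "rad X \<subseteq> multiples_span R M J ps" .
  have J2p: "x \<odot>\<^bsub>M\<^esub> p \<in> {\<zero>\<^bsub>M\<^esub>}" if p: "p \<in> set ps" and x: "x \<in> J2" for p x
  proof -
    have pc: "p \<in> carrier M" and pr: "p \<in> rad (carrier M)" using p psM ps(1) Xr by auto
    interpret h: plain_module_hom R "regular_module R" M "\<lambda>b. b \<odot>\<^bsub>M\<^esub> p" by (rule smult_hom[OF pc])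
    let ?X = "{y \<in> carrier R. y \<odot>\<^bsub>M\<^esub> p \<in> {\<zero>\<^bsub>M\<^esub>}}"
    have "J2 \<subseteq> ?X"
    proof (rule J2_least)
      show "submodule ?X R (regular_module R)" by (rule h.submodule_preimage[OF R_left submodule_0])
      show "i \<otimes> j \<in> ?X" if ij: "i \<in> J" "j \<in> J" for i j
      proof -
        have "j \<odot>\<^bsub>M\<^esub> p \<in> killed"
          by (rule subsetD[OF rad_rad_killed[OF submodule_carrier] mem_rad[OF r ij(2) pr]])
        then show ?thesis using ij pc by (simp add: killed_def J_closed smult_assoc1)
      qed
    qed
    then show ?thesis using x by auto
  qed
  have "len {\<zero>\<^bsub>M\<^esub>} ({\<zero>\<^bsub>M\<^esub>} <+>\<^bsub>M\<^esub> multiples_span R M J ps) \<le> length ps * e"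
    using conjunct2[OF interval_length_multiples_span[OF rad_left J2_left J2_sub finite_reg submodule_0 psM J2p]]
    by (simp add: e_def)
  moreover have "len {\<zero>\<^bsub>M\<^esub>} (rad X) \<le> len {\<zero>\<^bsub>M\<^esub>} (multiples_span R M J ps)"
    by (rule interval_length_mono[OF fin submodule_0 zero_subset[OF submodule_rad[OF X]] 1])
  moreover have "length ps * e \<le> len ?Q X * e" using ps(2) by simp
  ultimately show ?thesis unfolding set_add_zero[OF submodule_subset[OF T]] by linarith
qed

text \<open>Modulo \<open>J\<^sup>2M\<close>, an element \<open>x\<close> of \<open>J - J\<^sup>2\<close> acts freely on a module of the length of a free
  module: modulo the multiples of \<open>x\<close> the layer \<open>JM/J\<^sup>2M\<close> has at most \<open>e - 1\<close> dimensions for each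
  generator.\<close>

lemma length_of_multiples:
  assumes free: "len {\<zero>\<^bsub>M\<^esub>} (carrier M) = top (carrier M) * (1 + e + a)"
    and x: "x \<in> J" "x \<notin> J2"
    and X: "submodule X R M" "X \<subseteq> rad (carrier M)" "rad (rad (carrier M)) \<subseteq> X"
    and xX: "\<And>p. p \<in> carrier M \<Longrightarrow> x \<odot>\<^bsub>M\<^esub> p \<in> X"
  shows "top (carrier M) \<le> len (rad (rad (carrier M))) X"
proof -
  let ?P = "carrier M" and ?Q = "rad (rad (carrier M))"
  note P = submodule_carrier
  note r = submodule_rad[OF P]
  note Q = submodule_rad[OF r]
  obtain ps where ps: "set ps \<subseteq> ?P" "length ps \<le> top ?P" "?P = multiples_span R M (carrier R) ps"
    using generators[OF P] by blast
  have xc: "x \<in> carrier R" using x(1) by (rule J_closed)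
  let ?Rx = "(\<lambda>b. b \<otimes> x) ` carrier R"
  have Rx: "submodule ?Rx R (regular_module R)"
    using reg.submodule_multiples[OF R_left, of x] xc by simp
  let ?L = "J2 <+>\<^bsub>regular_module R\<^esub> ?Rx"
  have L: "submodule ?L R (regular_module R)" by (rule reg.submodule_set_add[OF J2_left Rx])
  have RxJ: "?Rx \<subseteq> J"
    by (rule image_subsetI) (use reg.submodule_smult[OF rad_left _ x(1)] in simp)
  have LJ: "?L \<subseteq> J" by (rule reg.set_add_least[OF rad_left J2_sub RxJ])
  have J2L: "J2 \<subseteq> ?L" by (rule reg.set_add_upper1[OF J2_left Rx])
  have "x \<in> ?Rx" by (rule image_eqI[of _ _ \<one>]) (use xc in simp_all)
  then have "x \<in> ?L" by (rule subsetD[OF reg.set_add_upper2[OF J2_left Rx]])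
  then have "J2 \<subset> ?L" using x(2) J2L by auto
  then have "0 < interval_length R (regular_module R) J2 ?L"
    using reg.interval_length_strict_mono[OF finite_reg J2_left L order_refl] by (metis gr_zeroI not_less_zero)
  moreover have "e = interval_length R (regular_module R) J2 ?L + interval_length R (regular_module R) ?L J"
    unfolding e_def
    by (rule reg.interval_length_add(2)[OF finite_reg finite_reg J2_left L rad_left J2L LJ])
  ultimately have LJ_len: "interval_length R (regular_module R) ?L J + 1 \<le> e" by simp
  have Lp: "y \<odot>\<^bsub>M\<^esub> p \<in> X" if p: "p \<in> set ps" and y: "y \<in> ?L" for p y
  proof -
    have pc: "p \<in> carrier M" using p ps(1) by auto
    interpret h: plain_module_hom R "regular_module R" M "\<lambda>b. b \<odot>\<^bsub>M\<^esub> p" by (rule smult_hom[OF pc])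
    let ?X = "{y \<in> carrier R. y \<odot>\<^bsub>M\<^esub> p \<in> X}"
    have X': "submodule ?X R (regular_module R)" by (rule h.submodule_preimage[OF R_left X(1)])
    have "J2 \<subseteq> ?X"
    proof (rule J2_least[OF X'])
      show "i \<otimes> j \<in> ?X" if ij: "i \<in> J" "j \<in> J" for i j
        using subsetD[OF X(3) mem_rad[OF r ij(1) mem_rad[OF P ij(2) pc]]] ij pc
        by (simp add: J_closed smult_assoc1)
    qed
    moreover have "?Rx \<subseteq> ?X"
      by (rule image_subsetI)
        (use submodule_smult[OF X(1) _ xX[OF pc]] xc pc in \<open>simp add: smult_assoc1\<close>)
    ultimately have "?L \<subseteq> ?X" by (rule reg.set_add_least[OF X'])
    then show ?thesis using y by auto
  qed
  have S: "submodule (multiples_span R M J ps) R M" by (rule submodule_multiples_span[OF rad_left ps(1)])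
  have "len X (X <+>\<^bsub>M\<^esub> multiples_span R M J ps) \<le> length ps * interval_length R (regular_module R) ?L J"
    by (rule conjunct2[OF interval_length_multiples_span[OF rad_left L LJ finite_reg X(1) ps(1) Lp]])
  moreover have "rad ?P \<subseteq> X <+>\<^bsub>M\<^esub> multiples_span R M J ps"
    by (rule subset_trans[OF length_bounds(4)[OF ps(1,3)] set_add_upper2[OF X(1) S]])
  then have "len X (rad ?P) \<le> len X (X <+>\<^bsub>M\<^esub> multiples_span R M J ps)"
    by (rule interval_length_mono[OF fin X(1,2)])
  moreover have "length ps * interval_length R (regular_module R) ?L J
      \<le> top ?P * interval_length R (regular_module R) ?L J"
    using ps(2) by simp
  moreover have "top ?P * e = len ?Q X + len X (rad ?P)"
    using len_add[OF Q X(1) r X(3,2)] free_layers(1)[OF free] by simp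
  moreover have "top ?P * interval_length R (regular_module R) ?L J + top ?P \<le> top ?P * e"
    using mult_le_mono2[OF LJ_len, of "top ?P"] by (simp add: algebra_simps)
  ultimately show ?thesis by linarith
qed

end

context plain_module_hom
begin

lemma image_multiples_span:
  "set ps \<subseteq> carrier M \<Longrightarrow> I \<subseteq> carrier R \<Longrightarrow>
    f ` multiples_span R M I ps = multiples_span R N I (map f ps)"
proof (induction ps)
  case (Cons p ps)
  have p: "p \<in> carrier M" and ps: "set ps \<subseteq> carrier M" using Cons.prems by auto
  have "(\<lambda>b. b \<odot>\<^bsub>M\<^esub> p) ` I \<subseteq> carrier M"
    by (rule image_subsetI) (use Cons.prems p in \<open>simp add: subsetD\<close>)
  moreover have "multiples_span R M I ps \<subseteq> carrier M"
    by (rule M.multiples_span_subset[OF M.submodule_carrier ps Cons.prems(2)])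
  moreover have "f ` (\<lambda>b. b \<odot>\<^bsub>M\<^esub> p) ` I = (\<lambda>b. b \<odot>\<^bsub>N\<^esub> f p) ` I"
    unfolding image_image by (rule image_cong[OF refl]) (use Cons.prems p in \<open>simp add: subsetD\<close>)
  ultimately show ?case using image_set_add Cons.IH[OF ps Cons.prems(2)] by simp
qed simp

end

context short_local_hom
begin

abbreviation ker :: "'m set" where "ker \<equiv> a_kernel M N f"

text \<open>A decomposition of the image of a free module lifts to one of the module, because the numbers
  of generators add up; it therefore induces a decomposition of the kernel. The kernel part that
  belongs to \<open>X\<close> is the syzygy of \<open>X\<close>.\<close>

lemma kernel_decomposition:
  assumes free: "M.len {\<zero>\<^bsub>M\<^esub>} (carrier M) = M.top (carrier M) * (1 + M.e + M.a)"
    and ker_rad: "ker \<subseteq> M.rad (carrier M)"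
    and X: "submodule X R N" and Y: "submodule Y R N"
    and XY: "X <+>\<^bsub>N\<^esub> Y = f ` carrier M" and disj: "X \<inter> Y = {\<zero>\<^bsub>N\<^esub>}"
  shows "\<exists>X' Y'. submodule X' R M \<and> submodule Y' R M \<and> X' <+>\<^bsub>M\<^esub> Y' = ker \<and> X' \<inter> Y' = {\<zero>\<^bsub>M\<^esub>} \<and>
    M.top X' + M.len {\<zero>\<^bsub>M\<^esub>} (M.rad X') + N.len {\<zero>\<^bsub>N\<^esub>} (N.rad X) = (M.e + M.a) * N.top X \<and>
    M.len {\<zero>\<^bsub>M\<^esub>} (M.rad X') \<le> M.a * N.top X"
proof -
  let ?P = "carrier M" and ?Z = "f ` carrier M" and ?A = "1 + M.e + M.a"
  note P = M.submodule_carrier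
  note r = M.submodule_rad[OF P]
  have W: "submodule ker R M" by (rule submodule_kernel)
  have Z: "submodule ?Z R N" by (rule submodule_image[OF P])
  have XZ: "X \<subseteq> ?Z" and YZ: "Y \<subseteq> ?Z" unfolding XY[symmetric]
    by (rule N.set_add_upper1[OF X Y], rule N.set_add_upper2[OF X Y])
  have "N.top ?Z = M.top ?P"
    using interval_length_image(2)[OF N.fin r P M.rad_subset[OF P] ker_rad] image_rad[OF P] by simp
  then have t: "M.top ?P = N.top X + N.top Y"
    using N.top_direct_sum[OF X Y disj] unfolding XY by simp
  obtain ps where ps: "set ps \<subseteq> X" "length ps \<le> N.top X" "X = multiples_span R N (carrier R) ps"
    using N.generators[OF X] by blast
  obtain qs where qs: "set qs \<subseteq> Y" "length qs \<le> N.top Y" "Y = multiples_span R N (carrier R) qs"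
    using N.generators[OF Y] by blast
  have lift: "\<exists>us. set us \<subseteq> ?P \<and> map f us = vs" if "set vs \<subseteq> ?Z" for vs
    using that
  proof (induction vs)
    case (Cons v vs)
    then obtain us u where "set us \<subseteq> ?P" "map f us = vs" "u \<in> ?P" "f u = v" by auto
    then show ?case by (intro exI[of _ "u # us"]) simp
  qed simp
  obtain us where us: "set us \<subseteq> ?P" "map f us = ps" using lift[OF subset_trans[OF ps(1) XZ]] by blast
  obtain vs where vs: "set vs \<subseteq> ?P" "map f vs = qs" using lift[OF subset_trans[OF qs(1) YZ]] by blast
  have len_us: "length us \<le> N.top X" and len_vs: "length vs \<le> N.top Y"
    using ps(2) qs(2) us(2) vs(2) by (metis length_map)+
  define F where "F = multiples_span R M (carrier R) us"
  define G where "G = multiples_span R M (carrier R) vs"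
  have F: "submodule F R M" unfolding F_def by (rule M.submodule_multiples_span[OF M.R_left us(1)])
  have G: "submodule G R M" unfolding G_def by (rule M.submodule_multiples_span[OF M.R_left vs(1)])
  note Fc = M.submodule_subset[OF F] and Gc = M.submodule_subset[OF G] and Wc = M.submodule_subset[OF W]
  have fF: "f ` F = X" unfolding F_def image_multiples_span[OF us(1) order_refl] us(2) by (rule ps(3)[symmetric])
  have fG: "f ` G = Y" unfolding G_def image_multiples_span[OF vs(1) order_refl] vs(2) by (rule qs(3)[symmetric])
  let ?FG = "F <+>\<^bsub>M\<^esub> G"
  have FG: "submodule ?FG R M" by (rule M.submodule_set_add[OF F G])
  have fFG: "f ` ?FG = ?Z" unfolding image_set_add[OF Fc Gc] fF fG XY ..
  have "?P \<subseteq> M.rad ?P <+>\<^bsub>M\<^esub> ?FG"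
  proof
    fix p assume p: "p \<in> ?P"
    then have "f p \<in> f ` ?FG" unfolding fFG by simp
    then obtain g where g: "g \<in> ?FG" "f p = f g" by (elim imageE)
    have gc: "g \<in> ?P" using g(1) M.submodule_subset[OF FG] by auto
    have "f (p \<ominus>\<^bsub>M\<^esub> g) = \<zero>\<^bsub>N\<^esub>" using g(2) p gc by (simp add: a_minus_def N.M.r_neg)
    then have "p \<ominus>\<^bsub>M\<^esub> g \<in> M.rad ?P" using ker_rad p gc by (auto simp: kernel_eq)
    moreover have "p = (p \<ominus>\<^bsub>M\<^esub> g) \<oplus>\<^bsub>M\<^esub> g" using p gc by (simp add: a_minus_def M.M.a_assoc M.M.l_neg)
    ultimately show "p \<in> M.rad ?P <+>\<^bsub>M\<^esub> ?FG" using g(1) M.mem_set_add[of p] by blast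
  qed
  then have PFG: "?P = ?FG" by (rule M.nakayama[OF P FG M.submodule_subset[OF FG]])
  have FiG: "submodule (F \<inter> G) R M" by (rule M.submodule_inter[OF F G])
  \<comment> \<open>The generators of \<open>F\<close> and \<open>G\<close> allow at most the length of \<open>P\<close>, which \<open>F + G\<close> attains; so
    nothing is left for \<open>F \<inter> G\<close>.\<close>
  have "M.len {\<zero>\<^bsub>M\<^esub>} ?P = M.len {\<zero>\<^bsub>M\<^esub>} F + M.len F ?FG"
    unfolding PFG by (rule M.len_add[OF M.submodule_0 F FG M.zero_subset[OF F] M.set_add_upper1[OF F G]])
  moreover have "M.len F ?FG = M.len (F \<inter> G) G" by (rule M.len_second_iso[OF F G])
  moreover have "M.len {\<zero>\<^bsub>M\<^esub>} G = M.len {\<zero>\<^bsub>M\<^esub>} (F \<inter> G) + M.len (F \<inter> G) G"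
    by (rule M.len_add[OF M.submodule_0 FiG G M.zero_subset[OF FiG] Int_lower2])
  moreover have "M.len {\<zero>\<^bsub>M\<^esub>} F \<le> length us * ?A" by (rule M.length_bounds(1)[OF us(1) F_def])
  moreover have "M.len {\<zero>\<^bsub>M\<^esub>} G \<le> length vs * ?A" by (rule M.length_bounds(1)[OF vs(1) G_def])
  moreover have "length us * ?A \<le> N.top X * ?A" using len_us by (rule mult_le_mono1)
  moreover have "length vs * ?A \<le> N.top Y * ?A" using len_vs by (rule mult_le_mono1)
  moreover have "M.len {\<zero>\<^bsub>M\<^esub>} ?P = N.top X * ?A + N.top Y * ?A"
    using free unfolding t by (simp only: add_mult_distrib)
  ultimately have lenF: "M.len {\<zero>\<^bsub>M\<^esub>} F = N.top X * ?A" and "M.len {\<zero>\<^bsub>M\<^esub>} (F \<inter> G) = 0"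
    by linarith+
  then have FG0: "F \<inter> G = {\<zero>\<^bsub>M\<^esub>}"
    using M.len_eq_0[OF M.submodule_0 FiG M.zero_subset[OF FiG]] by simp
  let ?X' = "ker \<inter> F" and ?Y' = "ker \<inter> G"
  have X': "submodule ?X' R M" and Y': "submodule ?Y' R M"
    by (rule M.submodule_inter[OF W F], rule M.submodule_inter[OF W G])
  have "ker \<subseteq> ?X' <+>\<^bsub>M\<^esub> ?Y'"
  proof
    fix w assume w: "w \<in> ker"
    then have wc: "w \<in> ?P" and fw: "f w = \<zero>\<^bsub>N\<^esub>" by (simp_all add: kernel_eq)
    then obtain g h where gh: "g \<in> F" "h \<in> G" "w = g \<oplus>\<^bsub>M\<^esub> h" using PFG M.mem_set_add by metis
    have c: "g \<in> ?P" "h \<in> ?P" using gh Fc Gc by auto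
    have "f g \<oplus>\<^bsub>N\<^esub> f h = \<zero>\<^bsub>N\<^esub>" using fw gh(3) c by simp
    then have "f g = \<ominus>\<^bsub>N\<^esub> f h" using c by (simp add: N.M.minus_equality)
    moreover have fg: "f g \<in> X" "f h \<in> Y" using gh fF fG by auto
    ultimately have "f g \<in> X \<inter> Y" using N.submodule_a_inv[OF Y] by simp
    then have 0: "f g = \<zero>\<^bsub>N\<^esub>" unfolding disj by simp
    then have "f h = \<zero>\<^bsub>N\<^esub>" using fw gh(3) c by simp
    then have "g \<in> ?X'" "h \<in> ?Y'" using 0 c gh by (simp_all add: kernel_eq)
    then show "w \<in> ?X' <+>\<^bsub>M\<^esub> ?Y'" using M.mem_set_add[of w ?X' ?Y'] gh(3) by blast
  qed
  moreover have "?X' <+>\<^bsub>M\<^esub> ?Y' \<subseteq> ker" by (rule M.set_add_least[OF W Int_lower1 Int_lower1])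
  ultimately have sum: "?X' <+>\<^bsub>M\<^esub> ?Y' = ker" by simp
  have "?X' \<inter> ?Y' \<subseteq> {\<zero>\<^bsub>M\<^esub>}" using FG0 by auto
  then have int: "?X' \<inter> ?Y' = {\<zero>\<^bsub>M\<^esub>}"
    by (rule subset_antisym) (rule M.zero_subset[OF M.submodule_inter[OF X' Y']])
  have WF: "submodule (ker <+>\<^bsub>M\<^esub> F) R M" by (rule M.submodule_set_add[OF W F])
  have fW: "f ` ker = {\<zero>\<^bsub>N\<^esub>}" using M.submodule_zero[OF W] hom_zero by (force simp: kernel_eq)
  have "f ` (ker <+>\<^bsub>M\<^esub> F) = X"
    unfolding image_set_add[OF Wc Fc] fW fF by (rule N.set_add_zero[OF N.submodule_subset[OF X]])
  then have "N.len {\<zero>\<^bsub>N\<^esub>} X = M.len ker (ker <+>\<^bsub>M\<^esub> F)"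
    using interval_length_image(2)[OF N.fin W WF M.set_add_upper1[OF W F] order_refl] fW by simp
  also have "\<dots> = M.len ?X' F" by (rule M.len_second_iso[OF W F])
  finally have 1: "M.len ?X' F = N.len {\<zero>\<^bsub>N\<^esub>} (N.rad X) + N.top X"
    using N.len_add[OF N.submodule_0 N.submodule_rad[OF X] X N.zero_subset[OF N.submodule_rad[OF X]]
        N.rad_subset[OF X]] by simp
  have 2: "M.len {\<zero>\<^bsub>M\<^esub>} F = M.len {\<zero>\<^bsub>M\<^esub>} ?X' + M.len ?X' F"
    by (rule M.len_add[OF M.submodule_0 X' F M.zero_subset[OF X'] Int_lower2])
  have 3: "M.len {\<zero>\<^bsub>M\<^esub>} ?X' = M.len {\<zero>\<^bsub>M\<^esub>} (M.rad ?X') + M.top ?X'"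
    by (rule M.len_add[OF M.submodule_0 M.submodule_rad[OF X'] X'
          M.zero_subset[OF M.submodule_rad[OF X']] M.rad_subset[OF X']])
  have dims: "M.top ?X' + M.len {\<zero>\<^bsub>M\<^esub>} (M.rad ?X') + N.len {\<zero>\<^bsub>N\<^esub>} (N.rad X) = (M.e + M.a) * N.top X"
    using 1 2 3 lenF by (simp add: algebra_simps)
  have rF: "submodule (M.rad F) R M" and rrF: "submodule (M.rad (M.rad F)) R M"
    by (rule M.submodule_rad[OF F], rule M.submodule_rad[OF M.submodule_rad[OF F]])
  have "?X' \<subseteq> M.rad ?FG \<inter> F" using ker_rad unfolding PFG by auto
  also have "\<dots> = M.rad F"
    unfolding M.rad_set_add[OF F G]
    by (rule M.set_add_inter_of_direct[OF F G FG0 rF M.rad_subset[OF F] M.submodule_rad[OF G] M.rad_subset[OF G]])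
  finally have "M.rad ?X' \<subseteq> M.rad (M.rad F)" by (rule M.rad_mono[OF X' rF])
  then have "M.len {\<zero>\<^bsub>M\<^esub>} (M.rad ?X') \<le> M.len {\<zero>\<^bsub>M\<^esub>} (M.rad (M.rad F))"
    by (rule M.interval_length_mono[OF M.fin M.submodule_0 M.zero_subset[OF M.submodule_rad[OF X']]])
  also have "\<dots> \<le> length us * M.a" by (rule M.length_bounds(3)[OF us(1) F_def])
  also have "\<dots> \<le> M.a * N.top X" using mult_le_mono1[OF len_us, of M.a] by (simp add: mult.commute)
  finally show ?thesis using X' Y' sum int dims by (intro exI[of _ ?X'] exI[of _ ?Y']) simp
qed

end

section \<open>The socle\<close>

context short_local_module
begin

lemma zero_of_rad_eq:
  assumes N: "submodule N R M" and "rad N = N" shows "N = {\<zero>\<^bsub>M\<^esub>}"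
proof (rule nakayama[OF N submodule_0 zero_subset[OF N]])
  show "N \<subseteq> rad N <+>\<^bsub>M\<^esub> {\<zero>\<^bsub>M\<^esub>}"
    using set_add_upper1[OF submodule_rad[OF N] submodule_0] assms(2) by simp
qed

lemma unit_multiple:
  assumes N: "submodule N R M" and b: "b \<in> carrier R" "b \<notin> J" and x: "x \<in> carrier M"
    and bx: "b \<odot>\<^bsub>M\<^esub> x \<in> N"
  shows "x \<in> N"
proof -
  obtain c where c: "c \<in> carrier R" "c \<otimes> b = \<one>" using left_inverse[OF b] by auto
  then have "c \<odot>\<^bsub>M\<^esub> (b \<odot>\<^bsub>M\<^esub> x) = x" using b x smult_assoc1[of c b x] by simp
  then show ?thesis using submodule_smult[OF N c(1) bx] by simp
qed

text \<open>A simple submodule \<open>S\<close> satisfies \<open>JS = 0\<close> by Nakayama's lemma. Conversely, if \<open>Jx = 0\<close> then every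
  non-zero multiple of \<open>x\<close> is a unit multiple, so \<open>Rx\<close> is simple or zero.\<close>

lemma socle_eq_killed: "socle R M = killed"
proof
  have "\<Union>{S. simple_submodule R M S} \<subseteq> killed"
  proof (rule Union_least)
    fix S assume "S \<in> {S. simple_submodule R M S}"
    then have S: "submodule S R M" "S \<noteq> {\<zero>\<^bsub>M\<^esub>}"
      and simple: "\<And>N. submodule N R M \<Longrightarrow> N \<subseteq> S \<Longrightarrow> N = {\<zero>\<^bsub>M\<^esub>} \<or> N = S"
      by (auto simp: simple_submodule_def)
    have "rad S \<noteq> S" using zero_of_rad_eq[OF S(1)] S(2) by auto
    then have "rad S = {\<zero>\<^bsub>M\<^esub>}" using simple[OF submodule_rad[OF S(1)] rad_subset[OF S(1)]] by auto
    then show "S \<subseteq> killed" using rad_eq_zero_iff[OF S(1)] by simp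
  qed
  moreover have "subgroup killed (add_monoid M)" using submodule_killed by (simp add: submodule_def)
  ultimately show "socle R M \<subseteq> killed"
    unfolding socle_def by (rule group.generate_subgroup_incl[OF M.a_group])
  show "killed \<subseteq> socle R M"
  proof
    fix x assume x: "x \<in> killed"
    then have xc: "x \<in> carrier M" by (simp add: killed_def)
    show "x \<in> socle R M"
    proof (cases "x = \<zero>\<^bsub>M\<^esub>")
      case True
      then show ?thesis unfolding socle_def using generate.one[of "add_monoid M"] by simp
    next
      case False
      let ?S = "(\<lambda>b. b \<odot>\<^bsub>M\<^esub> x) ` carrier R"
      have S: "submodule ?S R M" by (rule submodule_multiples[OF R_left xc])
      have xS: "x \<in> ?S" by (rule image_eqI[of _ _ \<one>]) (use xc in simp_all)
      have "N = ?S" if N: "submodule N R M" "N \<subseteq> ?S" "N \<noteq> {\<zero>\<^bsub>M\<^esub>}" for N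
      proof
        obtain y where y: "y \<in> N" "y \<noteq> \<zero>\<^bsub>M\<^esub>" using N(3) submodule_zero[OF N(1)] by auto
        then obtain b where b: "b \<in> carrier R" "y = b \<odot>\<^bsub>M\<^esub> x" using N(2) by auto
        have "b \<notin> J" using x y(2) b(2) by (auto simp: killed_def)
        then have "x \<in> N" using unit_multiple[OF N(1) b(1) _ xc] y(1) b(2) by simp
        then show "?S \<subseteq> N" by (intro image_subsetI submodule_smult[OF N(1)])
      qed (rule N(2))
      then have "simple_submodule R M ?S"
        unfolding simple_submodule_def using S xS False by blast
      then show ?thesis unfolding socle_def using xS by (auto intro!: generate.incl)
    qed
  qed
qed

lemma sub_module_short_local:
  assumes L: "submodule L R M" shows "short_local_module R (sub_module M L)"
proof -
  interpret L: plain_left_module R "sub_module M L" by (rule sub_module_plain[OF L])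
  have "finite_length R (sub_module M L)"
    unfolding L.finite_length_eq using interval_length_sub_module(2)[OF L order_refl] by simp
  then show ?thesis
    by (intro short_local_module.intro short_local_ring_axioms L.plain_left_module_axioms
        short_local_module_axioms.intro)
qed

lemma bipartite_iff:
  assumes L: "submodule L R M"
  shows "bipartite R (sub_module M L) \<longleftrightarrow> killed \<inter> L = rad L"
proof -
  interpret L: short_local_module R "sub_module M L" by (rule sub_module_short_local[OF L])
  have "L.killed = killed \<inter> L" using submodule_subset[OF L] by (auto simp: L.killed_def killed_def)
  then show ?thesis by (simp add: bipartite_def L.socle_eq_killed)
qed

lemma top_length_sub_module:
  assumes L: "submodule L R M"
  shows "top_length R (sub_module M L) = top L"
proof -
  interpret L: short_local_module R "sub_module M L" by (rule sub_module_short_local[OF L])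
  have "submodule (rad L) R (sub_module M L)"
    using submodule_sub_module_iff[OF L] submodule_rad[OF L] rad_subset[OF L] by simp
  then show ?thesis
    unfolding top_length_def using L.module_length_quotient[OF _ L.fin]
      interval_length_sub_module(1)[OF L order_refl] by simp
qed

lemma top_length_eq: "top_length R M = top (carrier M)"
  using top_length_sub_module[OF submodule_carrier] by simp

lemma rad_length_sub_module:
  assumes L: "submodule L R M"
  shows "rad_length R (sub_module M L) = len {\<zero>\<^bsub>M\<^esub>} (rad L)"
  unfolding rad_length_def using module_length_sub_module[OF submodule_rad[OF L]] by simp

lemma dim_vector_sub_module:
  assumes L: "submodule L R M" and "rad (rad L) = {\<zero>\<^bsub>M\<^esub>}"
  shows "dim_vector R (sub_module M L) = (top L, len {\<zero>\<^bsub>M\<^esub>} (rad L))"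
  using assms by (simp add: dim_vector_def top_length_sub_module rad_length_sub_module)

lemma top_zero_imp_zero:
  assumes N: "submodule N R M" and "top N = 0" shows "N = {\<zero>\<^bsub>M\<^esub>}"
  using zero_of_rad_eq[OF N] len_eq_0[OF submodule_rad[OF N] N rad_subset[OF N] assms(2)] by simp

text \<open>An element of the socle of \<open>X\<close> outside \<open>JX\<close> spans a simple direct summand: a submodule of \<open>X\<close>
  that contains \<open>JX\<close> and is maximal without that element is a complement.\<close>

lemma simple_summand:
  assumes X: "submodule X R M" and z: "z \<in> X" "z \<in> killed" "z \<notin> rad X"
  shows "\<exists>S Y. submodule S R M \<and> submodule Y R M \<and> S <+>\<^bsub>M\<^esub> Y = X \<and> S \<inter> Y = {\<zero>\<^bsub>M\<^esub>} \<and>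
    top S = 1 \<and> len {\<zero>\<^bsub>M\<^esub>} (rad S) = 0"
proof -
  have zc: "z \<in> carrier M" using z(2) by (simp add: killed_def)
  obtain H where H: "submodule H R M" "rad X \<subseteq> H" "z \<notin> H"
    and max: "\<And>Y. \<lbrakk>submodule Y R M; H \<subset> Y\<rbrakk> \<Longrightarrow> z \<in> Y"
    using maximal_submodule_avoiding[OF submodule_rad[OF X] z(3)] by blast
  let ?S = "(\<lambda>b. b \<odot>\<^bsub>M\<^esub> z) ` carrier R" and ?Y = "H \<inter> X"
  have S: "submodule ?S R M" by (rule submodule_multiples[OF R_left zc])
  have Y: "submodule ?Y R M" by (rule submodule_inter[OF H(1) X])
  have zS: "z \<in> ?S" by (rule image_eqI[of _ _ \<one>]) (use zc in simp_all)
  have SX: "?S \<subseteq> X" by (rule image_subsetI) (rule submodule_smult[OF X _ z(1)])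
  have Sk: "?S \<subseteq> killed" by (rule image_subsetI) (rule submodule_smult[OF submodule_killed _ z(2)])
  have "X \<subseteq> ?S <+>\<^bsub>M\<^esub> ?Y"
  proof
    fix x assume x: "x \<in> X"
    then have xc: "x \<in> carrier M" using submodule_subset[OF X] by auto
    show "x \<in> ?S <+>\<^bsub>M\<^esub> ?Y"
    proof (cases "x \<in> H")
      case True
      then show ?thesis using subsetD[OF set_add_upper2[OF S Y], of x] x by simp
    next
      case False
      let ?T = "(\<lambda>b. b \<odot>\<^bsub>M\<^esub> x) ` carrier R"
      have T: "submodule ?T R M" by (rule submodule_multiples[OF R_left xc])
      have "x \<in> ?T" by (rule image_eqI[of _ _ \<one>]) (use xc in simp_all)
      then have "H \<subset> H <+>\<^bsub>M\<^esub> ?T"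
        using False subsetD[OF set_add_upper2[OF H(1) T], of x] set_add_upper1[OF H(1) T] by auto
      then have "z \<in> H <+>\<^bsub>M\<^esub> ?T" by (rule max[OF submodule_set_add[OF H(1) T]])
      then obtain h y where "h \<in> H" "y \<in> ?T" "z = h \<oplus>\<^bsub>M\<^esub> y" unfolding mem_set_add by (elim bexE)
      then obtain b where b: "b \<in> carrier R" and h: "h \<in> H" and zb: "z = h \<oplus>\<^bsub>M\<^esub> b \<odot>\<^bsub>M\<^esub> x"
        by auto
      have hc: "h \<in> carrier M" using h submodule_subset[OF H(1)] by auto
      have "b \<notin> J"
      proof
        assume "b \<in> J"
        then have "b \<odot>\<^bsub>M\<^esub> x \<in> H" using mem_rad[OF X _ x] H(2) by auto
        then show False using submodule_add[OF H(1) h] zb H(3) by simp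
      qed
      have bx: "b \<odot>\<^bsub>M\<^esub> x \<in> X" "b \<odot>\<^bsub>M\<^esub> x \<in> carrier M"
        using submodule_smult[OF X b x] b xc by simp_all
      have "b \<odot>\<^bsub>M\<^esub> x \<oplus>\<^bsub>M\<^esub> h \<in> X" using z(1) zb M.a_comm[OF hc bx(2)] by simp
      then have "h \<in> ?Y" using submodule_add_cancel[OF X bx(1) hc] h by simp
      then have nh: "\<ominus>\<^bsub>M\<^esub> h \<in> ?Y" by (rule submodule_a_inv[OF Y])
      have "b \<odot>\<^bsub>M\<^esub> x = \<ominus>\<^bsub>M\<^esub> h \<oplus>\<^bsub>M\<^esub> z" unfolding zb using M.r_neg1[OF hc bx(2)] by simp
      also have "\<dots> = z \<oplus>\<^bsub>M\<^esub> \<ominus>\<^bsub>M\<^esub> h" by (rule M.a_comm[OF M.a_inv_closed[OF hc] zc])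
      finally have "b \<odot>\<^bsub>M\<^esub> x \<in> ?S <+>\<^bsub>M\<^esub> ?Y" using zS nh mem_set_add[of _ ?S ?Y] by blast
      then show ?thesis by (rule unit_multiple[OF submodule_set_add[OF S Y] b \<open>b \<notin> J\<close> xc])
    qed
  qed
  moreover have "?S <+>\<^bsub>M\<^esub> ?Y \<subseteq> X" by (rule set_add_least[OF X SX Int_lower2])
  ultimately have sum: "?S <+>\<^bsub>M\<^esub> ?Y = X" by simp
  have "y = \<zero>\<^bsub>M\<^esub>" if y: "y \<in> ?S" "y \<in> ?Y" for y
  proof -
    obtain b where b: "b \<in> carrier R" "y = b \<odot>\<^bsub>M\<^esub> z" using y(1) by (elim imageE)
    then have "b \<in> J" using unit_multiple[OF H(1) b(1) _ zc] y(2) H(3) by auto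
    then show ?thesis using b z(2) by (simp add: killed_def)
  qed
  then have "?S \<inter> ?Y \<subseteq> {\<zero>\<^bsub>M\<^esub>}" by auto
  then have int: "?S \<inter> ?Y = {\<zero>\<^bsub>M\<^esub>}"
    by (rule subset_antisym) (rule zero_subset[OF submodule_inter[OF S Y]])
  have rS: "rad ?S = {\<zero>\<^bsub>M\<^esub>}" using rad_eq_zero_iff[OF S] Sk by simp
  have "?S = multiples_span R M (carrier R) [z]"
    using set_add_absorb[OF S submodule_0 zero_subset[OF S]] by simp
  then have "top ?S \<le> length [z]"
    using set_add_upper2[OF submodule_rad[OF S] S] zS by (intro top_le[OF S]) simp_all
  moreover have "z \<noteq> \<zero>\<^bsub>M\<^esub>" using z(3) submodule_zero[OF submodule_rad[OF X]] by auto
  then have "top ?S \<noteq> 0" using top_zero_imp_zero[OF S] zS by auto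
  ultimately have "top ?S = 1" by simp
  moreover have "len {\<zero>\<^bsub>M\<^esub>} (rad ?S) = 0" unfolding rS by (rule interval_length_self(1)[OF submodule_0])
  ultimately show ?thesis using S Y sum int by blast
qed

end


section \<open>Minimal exact complexes of projective modules\<close>

locale minimal_exact_complex = short_local_ring R
  for R :: "('a, 'r) ring_scheme" (structure) +
  fixes P :: "int \<Rightarrow> ('a, 'm) module" and d :: "int \<Rightarrow> 'm \<Rightarrow> 'm"
  assumes exact: "exact_projective_complex R P d" and minimal: "minimal_complex R P d"
begin

definition img :: "int \<Rightarrow> 'm set" where "img i = d i ` carrier (P i)"

definition t :: "int \<Rightarrow> nat" where
  "t i = interval_length R (P (i - 1)) (rad_mult R (sub_module (P (i - 1)) (img i))) (img i)"

definition r :: "int \<Rightarrow> nat" where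
  "r i = interval_length R (P (i - 1)) {\<zero>\<^bsub>P (i - 1)\<^esub>} (rad_mult R (sub_module (P (i - 1)) (img i)))"

lemma P_module: "short_local_module R (P i)"
proof -
  have "left_module R (P i)" "finite_length R (P i)"
    using exact by (auto simp: exact_projective_complex_def fl_module_def)
  then show ?thesis
    by (intro short_local_module.intro short_local_ring_axioms short_local_module_axioms.intro)
      (simp_all add: plain_left_module_def)
qed

lemma d_hom: "short_local_hom R (P i) (P (i - 1)) (d i)"
proof -
  interpret M: short_local_module R "P i" by (rule P_module)
  interpret N: short_local_module R "P (i - 1)" by (rule P_module)
  have "d i \<in> left_module_hom R (P i) (P (i - 1))"
    using exact by (simp add: exact_projective_complex_def)
  then show ?thesis by unfold_locales
qed

lemma P_free:
  "interval_length R (P i) {\<zero>\<^bsub>P i\<^esub>} (carrier (P i)) =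
    interval_length R (P i) (rad_mult R (P i)) (carrier (P i)) * (1 + e + a)"
proof -
  interpret M: short_local_module R "P i" by (rule P_module)
  have "projective_module R (P i)" using exact by (simp add: exact_projective_complex_def)
  then show ?thesis using M.projective_length by simp
qed

text \<open>The image \<open>img i\<close> of \<open>d i\<close> is \<open>M\<^sub>i\<close>, a submodule of \<open>P\<^sub>i\<^sub>-\<^sub>1\<close>.\<close>

lemma kernel_eq_img: "a_kernel (P i) (P (i - 1)) (d i) = img (i + 1)"
proof -
  have "d (i + 1) ` carrier (P (i + 1)) = a_kernel (P (i + 1 - 1)) (P (i + 1 - 2)) (d (i + 1 - 1))"
    using exact unfolding exact_projective_complex_def by blast
  moreover have "i + 1 - 2 = i - 1" by simp
  ultimately show ?thesis unfolding img_def by simp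
qed

lemma img_rad: "img i \<subseteq> rad_mult R (P (i - 1))"
  using minimal unfolding minimal_complex_def img_def by blast

lemma img_submodule: "submodule (img i) R (P (i - 1))"
proof -
  interpret h: short_local_hom R "P i" "P (i - 1)" "d i" by (rule d_hom)
  show ?thesis unfolding img_def by (rule h.submodule_image[OF h.M.submodule_carrier])
qed

lemma rad_rad_img: "rad_mult R (sub_module (P (i - 1)) (rad_mult R (sub_module (P (i - 1)) (img i))))
  = {\<zero>\<^bsub>P (i - 1)\<^esub>}"
proof -
  interpret M: short_local_module R "P (i - 1)" by (rule P_module)
  note rP = M.submodule_rad[OF M.submodule_carrier]
  have "M.rad (img i) \<subseteq> M.rad (M.rad (carrier (P (i - 1))))"
    using M.rad_mono[OF img_submodule rP] img_rad by simp
  then have "M.rad (img i) \<subseteq> M.killed" using M.rad_rad_killed[OF M.submodule_carrier] by (rule subset_trans)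
  then show ?thesis using M.rad_eq_zero_iff[OF M.submodule_rad[OF img_submodule]] by simp
qed

text \<open>Minimality gives \<open>J\<^sup>2M = 0\<close> for all the images \<open>M\<close>, so \<open>d\<close> kills \<open>J\<^sup>2P\<close>.\<close>

lemma rad_rad_subset_img: "rad_mult R (sub_module (P (i - 1)) (rad_mult R (P (i - 1)))) \<subseteq> img i"
proof -
  interpret h: short_local_hom R "P (i - 1)" "P (i - 1 - 1)" "d (i - 1)" by (rule d_hom)
  note rP = h.M.submodule_rad[OF h.M.submodule_carrier]
  let ?RR = "h.M.rad (h.M.rad (carrier (P (i - 1))))"
  have "d (i - 1) ` ?RR = {\<zero>\<^bsub>P (i - 1 - 1)\<^esub>}"
    using h.image_rad[OF rP] h.image_rad[OF h.M.submodule_carrier] rad_rad_img[of "i - 1"]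
    by (simp add: img_def)
  moreover have "?RR \<subseteq> carrier (P (i - 1))" by (rule h.M.submodule_subset[OF h.M.submodule_rad[OF rP]])
  ultimately have "x \<in> a_kernel (P (i - 1)) (P (i - 1 - 1)) (d (i - 1))" if "x \<in> ?RR" for x
    using imageI[OF that, of "d (i - 1)"] that unfolding h.kernel_eq by blast
  then have "?RR \<subseteq> a_kernel (P (i - 1)) (P (i - 1 - 1)) (d (i - 1))" by (rule subsetI)
  then show ?thesis using kernel_eq_img[of "i - 1"] by simp
qed

lemma top_P: "interval_length R (P i) (rad_mult R (P i)) (carrier (P i)) = t i"
proof -
  interpret h: short_local_hom R "P i" "P (i - 1)" "d i" by (rule d_hom)
  have "h.ker \<subseteq> h.M.rad (carrier (P i))" using img_rad[of "i + 1"] by (simp add: kernel_eq_img)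
  from h.interval_length_image(2)[OF h.N.fin h.M.submodule_rad[OF h.M.submodule_carrier]
      h.M.submodule_carrier h.M.rad_subset[OF h.M.submodule_carrier] this]
  show ?thesis using h.image_rad[OF h.M.submodule_carrier] by (simp add: t_def img_def)
qed

lemma img_length: "interval_length R (P (i - 1)) {\<zero>\<^bsub>P (i - 1)\<^esub>} (img i) = t i + r i"
proof -
  interpret M: short_local_module R "P (i - 1)" by (rule P_module)
  show ?thesis unfolding t_def r_def
    using M.len_add[OF M.submodule_0 M.submodule_rad[OF img_submodule] img_submodule
        M.zero_subset[OF M.submodule_rad[OF img_submodule]] M.rad_subset[OF img_submodule]] by simp
qed

text \<open>This compares the lengths in \<open>0 \<rightarrow> M\<^sub>i\<^sub>+\<^sub>1 \<rightarrow> P\<^sub>i \<rightarrow> M\<^sub>i \<rightarrow> 0\<close>, where \<open>P\<^sub>i\<close> has the length of a free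
  module.\<close>

lemma dimension_step: "t (i + 1) + r (i + 1) + r i = (e + a) * t i"
proof -
  interpret h: short_local_hom R "P i" "P (i - 1)" "d i" by (rule d_hom)
  note K = h.submodule_kernel and P = h.M.submodule_carrier
  have "d i ` h.ker = {\<zero>\<^bsub>P (i - 1)\<^esub>}"
    using h.M.submodule_zero[OF K] h.hom_zero by (force simp: h.kernel_eq)
  then have "interval_length R (P (i - 1)) {\<zero>\<^bsub>P (i - 1)\<^esub>} (img i) = h.M.len h.ker (carrier (P i))"
    using h.interval_length_image(2)[OF h.N.fin K P h.M.submodule_subset[OF K] order_refl]
    by (simp add: img_def)
  moreover have "h.M.len {\<zero>\<^bsub>P i\<^esub>} (carrier (P i)) = h.M.len {\<zero>\<^bsub>P i\<^esub>} h.ker + h.M.len h.ker (carrier (P i))"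
    by (rule h.M.len_add[OF h.M.submodule_0 K P h.M.zero_subset[OF K] h.M.submodule_subset[OF K]])
  moreover have "h.M.len {\<zero>\<^bsub>P i\<^esub>} h.ker = t (i + 1) + r (i + 1)"
    using img_length[of "i + 1"] by (simp add: kernel_eq_img)
  ultimately show ?thesis
    using P_free[of i] img_length[of i] by (simp add: top_P algebra_simps)
qed

lemma rad_img_subset: "rad_mult R (sub_module (P (i - 1)) (img i)) \<subseteq>
    rad_mult R (sub_module (P (i - 1)) (rad_mult R (P (i - 1))))"
proof -
  interpret M: short_local_module R "P (i - 1)" by (rule P_module)
  show ?thesis using M.rad_mono[OF img_submodule M.submodule_rad[OF M.submodule_carrier]] img_rad by simp
qed

lemma rad_rad_length:
  "interval_length R (P (i - 1)) {\<zero>\<^bsub>P (i - 1)\<^esub>} (rad_mult R (sub_module (P (i - 1)) (rad_mult R (P (i - 1)))))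
    = a * t (i - 1)"
proof -
  interpret M: short_local_module R "P (i - 1)" by (rule P_module)
  show ?thesis using M.free_layers(2) P_free[of "i - 1"] top_P[of "i - 1"] by simp
qed

lemma rad_bound: "r i \<le> a * t (i - 1)"
proof -
  interpret M: short_local_module R "P (i - 1)" by (rule P_module)
  show ?thesis unfolding r_def rad_rad_length[symmetric]
    by (rule M.interval_length_mono[OF M.fin M.submodule_0 M.zero_subset[OF M.submodule_rad[OF img_submodule]]
        rad_img_subset])
qed

text \<open>The witness \<open>m\<close> is the length of \<open>M\<^sub>i/J\<^sup>2P\<^sub>i\<^sub>-\<^sub>1\<close>. Since \<open>J\<^sup>2P\<^sub>i\<^sub>-\<^sub>1\<close> is killed by \<open>J\<close>, only \<open>m\<close>
  generators contribute to \<open>JM\<^sub>i\<close>.\<close>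

lemma layer_bound: "\<exists>m. t i + r i = m + a * t (i - 1) \<and> r i \<le> m * e \<and> m \<le> t i"
proof -
  interpret M: short_local_module R "P (i - 1)" by (rule P_module)
  let ?RR = "M.rad (M.rad (carrier (P (i - 1))))"
  note rP = M.submodule_rad[OF M.submodule_carrier]
  note RR = M.submodule_rad[OF rP]
  have RRi: "?RR \<subseteq> img i" using rad_rad_subset_img by simp
  let ?m = "M.len ?RR (img i)"
  have "t i + r i = ?m + a * t (i - 1)"
    using M.len_add[OF M.submodule_0 RR img_submodule M.zero_subset[OF RR] RRi] img_length rad_rad_length
    by simp
  moreover have "r i \<le> ?m * e" unfolding r_def
    by (rule M.rad_length_bound[OF img_submodule _ RRi]) (use img_rad in simp)
  moreover have "?m \<le> t i"
    using M.len_add[OF M.submodule_rad[OF img_submodule] RR img_submodule _ RRi] rad_img_subset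
    unfolding t_def by simp
  ultimately show ?thesis by blast
qed

lemma bipartite_img_iff:
  "bipartite R (image_module P d i) \<longleftrightarrow>
    short_local_module.killed R (P (i - 1)) \<inter> img i = rad_mult R (sub_module (P (i - 1)) (img i))"
proof -
  interpret M: short_local_module R "P (i - 1)" by (rule P_module)
  show ?thesis using M.bipartite_iff[OF img_submodule] by (simp add: image_module_def img_def)
qed

lemma bipartite_imp:
  assumes "bipartite R (image_module P d i)" shows "r i = a * t (i - 1)"
proof -
  interpret M: short_local_module R "P (i - 1)" by (rule P_module)
  have "M.rad (M.rad (carrier (P (i - 1)))) \<subseteq> M.killed \<inter> img i"
    using M.rad_rad_killed[OF M.submodule_carrier] rad_rad_subset_img by simp
  then have "M.rad (img i) = M.rad (M.rad (carrier (P (i - 1))))"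
    using assms rad_img_subset unfolding bipartite_img_iff by (intro subset_antisym) simp_all
  then show ?thesis using rad_rad_length by (simp add: r_def)
qed

text \<open>\<open>summand i \<tau> \<rho>\<close> says that \<open>M\<^sub>i\<close> has a direct summand with dimension vector \<open>(\<tau>, \<rho>)\<close>.\<close>

definition summand :: "int \<Rightarrow> nat \<Rightarrow> nat \<Rightarrow> bool" where
  "summand i \<tau> \<rho> \<longleftrightarrow> (\<exists>X Y. submodule X R (P (i - 1)) \<and> submodule Y R (P (i - 1)) \<and>
     X <+>\<^bsub>P (i - 1)\<^esub> Y = img i \<and> X \<inter> Y = {\<zero>\<^bsub>P (i - 1)\<^esub>} \<and>
     interval_length R (P (i - 1)) (rad_mult R (sub_module (P (i - 1)) X)) X = \<tau> \<and>
     interval_length R (P (i - 1)) {\<zero>\<^bsub>P (i - 1)\<^esub>} (rad_mult R (sub_module (P (i - 1)) X)) = \<rho>)"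

lemma summand_le: "summand i \<tau> \<rho> \<Longrightarrow> \<tau> \<le> t i"
proof -
  assume "summand i \<tau> \<rho>"
  interpret M: short_local_module R "P (i - 1)" by (rule P_module)
  obtain X Y where *: "submodule X R (P (i - 1))" "submodule Y R (P (i - 1))"
     "X <+>\<^bsub>P (i - 1)\<^esub> Y = img i" "X \<inter> Y = {\<zero>\<^bsub>P (i - 1)\<^esub>}" "M.top X = \<tau>"
    using \<open>summand i \<tau> \<rho>\<close> unfolding summand_def by blast
  show "\<tau> \<le> t i" using M.top_direct_sum[OF *(1,2,4)] *(3,5) by (simp add: t_def)
qed

lemma summand_step:
  assumes "summand i \<tau> \<rho>"
  shows "\<exists>\<tau>' \<rho>'. summand (i + 1) \<tau>' \<rho>' \<and> \<tau>' + \<rho>' + \<rho> = (e + a) * \<tau> \<and> \<rho>' \<le> a * \<tau>"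
proof -
  interpret h: short_local_hom R "P i" "P (i - 1)" "d i" by (rule d_hom)
  obtain X Y where *: "submodule X R (P (i - 1))" "submodule Y R (P (i - 1))"
     "X <+>\<^bsub>P (i - 1)\<^esub> Y = img i" "X \<inter> Y = {\<zero>\<^bsub>P (i - 1)\<^esub>}"
     and \<tau>: "h.N.top X = \<tau>" and \<rho>: "h.N.len {\<zero>\<^bsub>P (i - 1)\<^esub>} (h.N.rad X) = \<rho>"
    using assms unfolding summand_def by blast
  have free: "h.M.len {\<zero>\<^bsub>P i\<^esub>} (carrier (P i)) = h.M.top (carrier (P i)) * (1 + e + a)"
    using P_free[of i] by simp
  have ker: "h.ker \<subseteq> h.M.rad (carrier (P i))" using img_rad[of "i + 1"] by (simp add: kernel_eq_img)
  obtain X' Y' where "submodule X' R (P i)" "submodule Y' R (P i)" "X' <+>\<^bsub>P i\<^esub> Y' = h.ker"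
    "X' \<inter> Y' = {\<zero>\<^bsub>P i\<^esub>}"
    and n: "h.M.top X' + h.M.len {\<zero>\<^bsub>P i\<^esub>} (h.M.rad X') + \<rho> = (e + a) * \<tau>"
      "h.M.len {\<zero>\<^bsub>P i\<^esub>} (h.M.rad X') \<le> a * \<tau>"
    using h.kernel_decomposition[OF free ker *(1,2) *(3)[unfolded img_def] *(4)] \<tau> \<rho> by metis
  then have "summand (i + 1) (h.M.top X') (h.M.len {\<zero>\<^bsub>P i\<^esub>} (h.M.rad X'))"
    unfolding summand_def kernel_eq_img by (simp, blast)
  then show ?thesis using n by blast
qed

lemma not_bipartite_summand:
  assumes "\<not> bipartite R (image_module P d i)" shows "summand i 1 0"
proof -
  interpret M: short_local_module R "P (i - 1)" by (rule P_module)
  have "M.rad (img i) \<subseteq> M.killed \<inter> img i"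
    using rad_rad_img[of i] M.rad_eq_zero_iff[OF M.submodule_rad[OF img_submodule]]
      M.rad_subset[OF img_submodule] by simp
  then obtain z where "z \<in> img i" "z \<in> M.killed" "z \<notin> M.rad (img i)"
    using assms unfolding bipartite_img_iff by blast
  from M.simple_summand[OF img_submodule this] show ?thesis unfolding summand_def by simp
qed

text \<open>As \<open>M\<^sub>i\<close> lies in \<open>JP\<^sub>i\<^sub>-\<^sub>1\<close>, it is killed by \<open>x\<close>. Hence \<open>xP\<^sub>i\<close> lies in \<open>M\<^sub>i\<^sub>+\<^sub>1\<close>, and this alone has
  \<open>t\<^sub>i\<close> generators modulo \<open>J\<^sup>2P\<^sub>i\<close>.\<close>

lemma nondecreasing:
  assumes x: "x \<in> J" "x \<notin> J2" and xJ: "\<And>j. j \<in> J \<Longrightarrow> x \<otimes> j = \<zero>"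
  shows "t i \<le> t (i + 1)"
proof -
  interpret h: short_local_hom R "P i" "P (i - 1)" "d i" by (rule d_hom)
  note RR = h.M.submodule_rad[OF h.M.submodule_rad[OF h.M.submodule_carrier]]
  have I: "submodule (img (i + 1)) R (P i)" "img (i + 1) \<subseteq> h.M.rad (carrier (P i))"
    and RRi: "h.M.rad (h.M.rad (carrier (P i))) \<subseteq> img (i + 1)"
    using img_submodule[of "i + 1"] img_rad[of "i + 1"] rad_rad_subset_img[of "i + 1"] by simp_all
  have free: "h.M.len {\<zero>\<^bsub>P i\<^esub>} (carrier (P i)) = h.M.top (carrier (P i)) * (1 + e + a)"
    using P_free[of i] by simp
  have xc: "x \<in> carrier R" using x(1) by (rule J_closed)
  let ?X = "{y \<in> carrier (P (i - 1)). \<forall>b\<in>carrier R. x \<odot>\<^bsub>P (i - 1)\<^esub> (b \<odot>\<^bsub>P (i - 1)\<^esub> y) = \<zero>\<^bsub>P (i - 1)\<^esub>}"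
  have X: "submodule ?X R (P (i - 1))"
  proof (rule h.N.submoduleI)
    show "c \<odot>\<^bsub>P (i - 1)\<^esub> y \<in> ?X" if c: "c \<in> carrier R" and y: "y \<in> ?X" for c y
    proof -
      have "x \<odot>\<^bsub>P (i - 1)\<^esub> (b \<odot>\<^bsub>P (i - 1)\<^esub> (c \<odot>\<^bsub>P (i - 1)\<^esub> y)) = \<zero>\<^bsub>P (i - 1)\<^esub>" if b: "b \<in> carrier R" for b
        using h.N.smult_assoc1[of b c y, symmetric] b c y by simp
      then show ?thesis using c y by simp
    qed
  qed (use xc in \<open>simp_all add: h.N.smult_r_distr subset_iff\<close>)
  have "h.N.rad (carrier (P (i - 1))) \<subseteq> ?X"
  proof (rule h.N.rad_least[OF h.N.submodule_carrier X])
    fix j y assume j: "j \<in> J" and y: "y \<in> carrier (P (i - 1))"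
    have "x \<odot>\<^bsub>P (i - 1)\<^esub> (b \<odot>\<^bsub>P (i - 1)\<^esub> (j \<odot>\<^bsub>P (i - 1)\<^esub> y)) = \<zero>\<^bsub>P (i - 1)\<^esub>" if b: "b \<in> carrier R" for b
    proof -
      have bj: "b \<otimes> j \<in> J" using reg.submodule_smult[OF rad_left b j] by simp
      have "x \<odot>\<^bsub>P (i - 1)\<^esub> (b \<odot>\<^bsub>P (i - 1)\<^esub> (j \<odot>\<^bsub>P (i - 1)\<^esub> y)) = (x \<otimes> (b \<otimes> j)) \<odot>\<^bsub>P (i - 1)\<^esub> y"
        using b j y xc J_closed[OF j] by (simp add: h.N.smult_assoc1)
      then show ?thesis using xJ[OF bj] y by simp
    qed
    then show "j \<odot>\<^bsub>P (i - 1)\<^esub> y \<in> ?X" using j y by (simp add: J_closed)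
  qed
  then have imgX: "img i \<subseteq> ?X" using img_rad[of i] by simp
  have "x \<odot>\<^bsub>P i\<^esub> p \<in> img (i + 1)" if p: "p \<in> carrier (P i)" for p
  proof -
    have "d i p \<in> ?X" using imgX p by (auto simp: img_def)
    then have "x \<odot>\<^bsub>P (i - 1)\<^esub> (\<one> \<odot>\<^bsub>P (i - 1)\<^esub> d i p) = \<zero>\<^bsub>P (i - 1)\<^esub>" by blast
    then have "x \<odot>\<^bsub>P (i - 1)\<^esub> d i p = \<zero>\<^bsub>P (i - 1)\<^esub>" using p by simp
    then show ?thesis using p xc unfolding kernel_eq_img[symmetric] h.kernel_eq by simp
  qed
  from h.M.length_of_multiples[OF free x I RRi this]
  have "t i \<le> h.M.len (h.M.rad (h.M.rad (carrier (P i)))) (img (i + 1))" using top_P[of i] by simp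
  also have "\<dots> \<le> t (i + 1)"
    using h.M.len_add[OF h.M.submodule_rad[OF I(1)] RR I(1) _ RRi] rad_img_subset[of "i + 1"]
    unfolding t_def by simp
  finally show ?thesis .
qed

lemma t_positive:
  assumes "nonzero_complex P" shows "\<exists>i. 0 < t i"
proof -
  obtain i where i: "carrier (P i) \<noteq> {\<zero>\<^bsub>P i\<^esub>}" using assms unfolding nonzero_complex_def by blast
  interpret M: short_local_module R "P i" by (rule P_module)
  have "t i \<noteq> 0" using M.top_zero_imp_zero[OF M.submodule_carrier] i top_P[of i] by auto
  then show ?thesis by auto
qed

lemma lengths:
  shows "top_length R (P i) = t i" and "top_length R (image_module P d i) = t i"
    and "rad_length R (image_module P d i) = r i" and "dim_vector R (image_module P d i) = (t i, r i)"
proof -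
  interpret N: short_local_module R "P i" by (rule P_module)
  interpret M: short_local_module R "P (i - 1)" by (rule P_module)
  show "top_length R (P i) = t i" unfolding N.top_length_eq using top_P[of i] by simp
  have i: "image_module P d i = sub_module (P (i - 1)) (img i)" by (simp add: image_module_def img_def)
  show "top_length R (image_module P d i) = t i"
    unfolding i t_def by (rule M.top_length_sub_module[OF img_submodule])
  show "rad_length R (image_module P d i) = r i"
    unfolding i r_def by (rule M.rad_length_sub_module[OF img_submodule])
  show "dim_vector R (image_module P d i) = (t i, r i)"
    unfolding i t_def r_def by (rule M.dim_vector_sub_module[OF img_submodule rad_rad_img])
qed

end

section \<open>Linear functionals\<close>

text \<open>Vector spaces over a field \<open>K\<close> are treated as left modules over \<open>K\<close>, so that dimensions are
  lengths and subspaces are submodules.\<close>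

locale linear_space = K?: field K + plain_left_module K V
  for K :: "('k, 'r) ring_scheme" and V :: "('k, 'v) module"
begin

lemma inverse:
  assumes "c \<in> carrier K" "c \<noteq> \<zero>\<^bsub>K\<^esub>"
  shows "inv\<^bsub>K\<^esub> c \<in> carrier K" "inv\<^bsub>K\<^esub> c \<otimes>\<^bsub>K\<^esub> c = \<one>\<^bsub>K\<^esub>" "c \<otimes>\<^bsub>K\<^esub> inv\<^bsub>K\<^esub> c = \<one>\<^bsub>K\<^esub>"
  using assms field_Units by auto

lemma zero_submodule_K: "submodule {\<zero>\<^bsub>K\<^esub>} K (regular_module K)"
  using plain_left_module.submodule_0[OF K.regular_module_plain] by simp

lemma length_K:
  shows "finite_interval K (regular_module K) {\<zero>\<^bsub>K\<^esub>} (carrier K)"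
    and "interval_length K (regular_module K) {\<zero>\<^bsub>K\<^esub>} (carrier K) \<le> 1"
  using K.length_le_1[OF zero_submodule_K] inverse by blast+

text \<open>A subspace that contains \<open>N\<close> and is maximal without \<open>w\<close> is a hyperplane, the kernel of the
  functional.\<close>

lemma functional_separating:
  assumes N: "submodule N K V" and w: "w \<in> carrier V" "w \<notin> N"
  shows "\<exists>F \<in> left_module_hom K V (regular_module K). F w = \<one>\<^bsub>K\<^esub> \<and> (\<forall>n\<in>N. F n = \<zero>\<^bsub>K\<^esub>)"
proof -
  obtain H where H: "submodule H K V" "N \<subseteq> H" "w \<notin> H"
    and max: "\<And>Y. \<lbrakk>submodule Y K V; H \<subset> Y\<rbrakk> \<Longrightarrow> w \<in> Y"
    using maximal_submodule_avoiding[OF N w(2)] by blast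
  have Hc: "x \<in> carrier V" if "x \<in> H" for x using submodule_subset[OF H(1)] that by auto
  have ex: "\<exists>c\<in>carrier K. \<exists>h\<in>H. y = h \<oplus>\<^bsub>V\<^esub> c \<odot>\<^bsub>V\<^esub> w" if y: "y \<in> carrier V" for y
  proof (cases "y \<in> H")
    case True
    then show ?thesis using w(1) y by (intro bexI[of _ "\<zero>\<^bsub>K\<^esub>"] bexI[of _ y]) simp_all
  next
    case False
    let ?T = "(\<lambda>b. b \<odot>\<^bsub>V\<^esub> y) ` carrier K"
    have T: "submodule ?T K V" by (rule submodule_multiples[OF submodule_regular_carrier y])
    have "y \<in> ?T" by (rule image_eqI[of _ _ "\<one>\<^bsub>K\<^esub>"]) (use y in simp_all)
    then have "H \<subset> H <+>\<^bsub>V\<^esub> ?T"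
      using False subsetD[OF set_add_upper2[OF H(1) T], of y] set_add_upper1[OF H(1) T] by auto
    then have "w \<in> H <+>\<^bsub>V\<^esub> ?T" by (rule max[OF submodule_set_add[OF H(1) T]])
    then obtain h u where "h \<in> H" "u \<in> ?T" "w = h \<oplus>\<^bsub>V\<^esub> u" unfolding mem_set_add by (elim bexE)
    then obtain b where b: "b \<in> carrier K" and h: "h \<in> H" and wb: "w = h \<oplus>\<^bsub>V\<^esub> b \<odot>\<^bsub>V\<^esub> y"
      by auto
    have "b \<noteq> \<zero>\<^bsub>K\<^esub>" using wb h H(3) y Hc[OF h] by auto
    note i = inverse[OF b this]
    let ?h = "inv\<^bsub>K\<^esub> b \<odot>\<^bsub>V\<^esub> h"
    have hH: "?h \<in> H" by (rule submodule_smult[OF H(1) i(1) h])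
    have "inv\<^bsub>K\<^esub> b \<odot>\<^bsub>V\<^esub> w = ?h \<oplus>\<^bsub>V\<^esub> y"
      unfolding wb using i b y Hc[OF h] by (simp add: smult_r_distr smult_assoc1[symmetric])
    then have "y = \<ominus>\<^bsub>V\<^esub> ?h \<oplus>\<^bsub>V\<^esub> inv\<^bsub>K\<^esub> b \<odot>\<^bsub>V\<^esub> w" using y Hc[OF hH] by (simp add: M.r_neg1)
    then show ?thesis using submodule_a_inv[OF H(1) hH] i(1) by blast
  qed
  have un: "c = c'" if c: "c \<in> carrier K" "c' \<in> carrier K" and h: "h \<in> H" "h' \<in> H"
    and eq: "h \<oplus>\<^bsub>V\<^esub> c \<odot>\<^bsub>V\<^esub> w = h' \<oplus>\<^bsub>V\<^esub> c' \<odot>\<^bsub>V\<^esub> w" for c c' h h'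
  proof (rule ccontr)
    assume "c \<noteq> c'"
    have ne: "c \<ominus>\<^bsub>K\<^esub> c' \<noteq> \<zero>\<^bsub>K\<^esub>"
    proof
      assume "c \<ominus>\<^bsub>K\<^esub> c' = \<zero>\<^bsub>K\<^esub>"
      then have "\<ominus>\<^bsub>K\<^esub> (\<ominus>\<^bsub>K\<^esub> c') = c" using c by (intro K.minus_equality) (simp_all add: a_minus_def)
      then show False using \<open>c \<noteq> c'\<close> c by simp
    qed
    have k: "c \<ominus>\<^bsub>K\<^esub> c' \<in> carrier K" using c by simp
    note i = inverse[OF k ne]
    have "(c \<ominus>\<^bsub>K\<^esub> c') \<odot>\<^bsub>V\<^esub> w = c \<odot>\<^bsub>V\<^esub> w \<oplus>\<^bsub>V\<^esub> \<ominus>\<^bsub>V\<^esub> (c' \<odot>\<^bsub>V\<^esub> w)"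
      using c w(1) by (simp add: a_minus_def smult_l_distr smult_l_minus)
    also have "c \<odot>\<^bsub>V\<^esub> w = \<ominus>\<^bsub>V\<^esub> h \<oplus>\<^bsub>V\<^esub> (h' \<oplus>\<^bsub>V\<^esub> c' \<odot>\<^bsub>V\<^esub> w)"
      unfolding eq[symmetric] using Hc[OF h(1)] c w(1) by (simp add: M.r_neg1)
    also have "\<dots> \<oplus>\<^bsub>V\<^esub> \<ominus>\<^bsub>V\<^esub> (c' \<odot>\<^bsub>V\<^esub> w) = \<ominus>\<^bsub>V\<^esub> h \<oplus>\<^bsub>V\<^esub> h'"
      using Hc[OF h(1)] Hc[OF h(2)] c w(1) by (simp add: M.a_assoc M.r_neg)
    also have "\<dots> \<in> H" using submodule_add[OF H(1) submodule_a_inv[OF H(1) h(1)] h(2)] .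
    finally have "inv\<^bsub>K\<^esub> (c \<ominus>\<^bsub>K\<^esub> c') \<odot>\<^bsub>V\<^esub> ((c \<ominus>\<^bsub>K\<^esub> c') \<odot>\<^bsub>V\<^esub> w) \<in> H" by (rule submodule_smult[OF H(1) i(1)])
    then show False using i k w(1) H(3) by (simp add: smult_assoc1[symmetric])
  qed
  define F where "F y = (THE c. c \<in> carrier K \<and> (\<exists>h\<in>H. y = h \<oplus>\<^bsub>V\<^esub> c \<odot>\<^bsub>V\<^esub> w))" for y
  have FI: "F (h \<oplus>\<^bsub>V\<^esub> c \<odot>\<^bsub>V\<^esub> w) = c" if "h \<in> H" "c \<in> carrier K" for h c
    unfolding F_def using that un by (intro the_equality) blast+
  have F_closed: "F y \<in> carrier K" if y: "y \<in> carrier V" for y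
  proof -
    obtain c h where "c \<in> carrier K" "h \<in> H" "y = h \<oplus>\<^bsub>V\<^esub> c \<odot>\<^bsub>V\<^esub> w" using ex[OF y] by blast
    then show ?thesis using FI by simp
  qed
  have F_add: "F (y \<oplus>\<^bsub>V\<^esub> y') = F y \<oplus>\<^bsub>K\<^esub> F y'" if y: "y \<in> carrier V" "y' \<in> carrier V" for y y'
  proof -
    obtain c h c' h' where *: "c \<in> carrier K" "h \<in> H" "y = h \<oplus>\<^bsub>V\<^esub> c \<odot>\<^bsub>V\<^esub> w"
      "c' \<in> carrier K" "h' \<in> H" "y' = h' \<oplus>\<^bsub>V\<^esub> c' \<odot>\<^bsub>V\<^esub> w" using ex[OF y(1)] ex[OF y(2)] by metis
    have "y \<oplus>\<^bsub>V\<^esub> y' = (h \<oplus>\<^bsub>V\<^esub> h') \<oplus>\<^bsub>V\<^esub> (c \<oplus>\<^bsub>K\<^esub> c') \<odot>\<^bsub>V\<^esub> w"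
      using * Hc w(1) by (simp add: smult_l_distr M.a_ac)
    then show ?thesis
      using FI[OF submodule_add[OF H(1) *(2,5)], of "c \<oplus>\<^bsub>K\<^esub> c'"] * FI by simp
  qed
  have F_smult: "F (b \<odot>\<^bsub>V\<^esub> y) = b \<otimes>\<^bsub>K\<^esub> F y" if b: "b \<in> carrier K" and y: "y \<in> carrier V" for b y
  proof -
    obtain c h where *: "c \<in> carrier K" "h \<in> H" "y = h \<oplus>\<^bsub>V\<^esub> c \<odot>\<^bsub>V\<^esub> w" using ex[OF y] by metis
    have "b \<odot>\<^bsub>V\<^esub> y = b \<odot>\<^bsub>V\<^esub> h \<oplus>\<^bsub>V\<^esub> (b \<otimes>\<^bsub>K\<^esub> c) \<odot>\<^bsub>V\<^esub> w"
      using * Hc w(1) b by (simp add: smult_r_distr smult_assoc1)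
    then show ?thesis
      using FI[OF submodule_smult[OF H(1) b *(2)], of "b \<otimes>\<^bsub>K\<^esub> c"] * b FI by simp
  qed
  have "F \<in> left_module_hom K V (regular_module K)"
    by (simp add: left_module_hom_def hom_def F_closed F_add F_smult)
  moreover have "F w = \<one>\<^bsub>K\<^esub>" using FI[OF submodule_zero[OF H(1)], of "\<one>\<^bsub>K\<^esub>"] w(1) by simp
  moreover have "F n = \<zero>\<^bsub>K\<^esub>" if "n \<in> N" for n
    using FI[of n "\<zero>\<^bsub>K\<^esub>"] that H(2) Hc w(1) by (auto simp: subset_iff)
  ultimately show ?thesis by blast
qed

text \<open>After scaling, \<open>f\<close> has the value \<open>1\<close> at some \<open>w\<close>; the functional that separates \<open>w\<close> from the
  kernel of \<open>f\<close> agrees with \<open>f\<close> on \<open>U\<close>.\<close>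

lemma functional_extension:
  assumes U: "submodule U K V" and f: "f \<in> left_module_hom K (sub_module V U) (regular_module K)"
  shows "\<exists>F \<in> left_module_hom K V (regular_module K). \<forall>u\<in>U. F u = f u"
proof -
  interpret KK: plain_left_module K "regular_module K" by (rule K.regular_module_plain)
  interpret U: plain_left_module K "sub_module V U" by (rule sub_module_plain[OF U])
  interpret f: plain_module_hom K "sub_module V U" "regular_module K" f using f by unfold_locales
  have Uc: "x \<in> carrier V" if "x \<in> U" for x using submodule_subset[OF U] that by auto
  show ?thesis
  proof (cases "\<forall>u\<in>U. f u = \<zero>\<^bsub>K\<^esub>")
    case True
    have "(\<lambda>_. \<zero>\<^bsub>K\<^esub>) \<in> left_module_hom K V (regular_module K)"
      by (simp add: left_module_hom_def hom_def)
    then show ?thesis using True by (intro bexI[of _ "\<lambda>_. \<zero>\<^bsub>K\<^esub>"]) auto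
  next
    case False
    then obtain u where u: "u \<in> U" "f u \<noteq> \<zero>\<^bsub>K\<^esub>" by auto
    have fc: "f x \<in> carrier K" if "x \<in> U" for x using f.hom_closed[of x] that by simp
    note i = inverse[OF fc[OF u(1)] u(2)]
    let ?w = "inv\<^bsub>K\<^esub> (f u) \<odot>\<^bsub>V\<^esub> u"
    have w: "?w \<in> U" "?w \<in> carrier V" using submodule_smult[OF U i(1) u(1)] Uc by simp_all
    have fw: "f ?w = \<one>\<^bsub>K\<^esub>" using f.hom_smult[OF i(1), of u] u(1) i(2) by simp
    let ?N = "{x \<in> U. f x \<in> {\<zero>\<^bsub>K\<^esub>}}"
    have N: "submodule ?N K V"
      using f.submodule_preimage[OF U.submodule_carrier zero_submodule_K] submodule_sub_module_iff[OF U]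
      by simp
    have "\<one>\<^bsub>K\<^esub> \<noteq> \<zero>\<^bsub>K\<^esub>" using zero_not_one by simp
    then have "?w \<notin> ?N" using fw by simp
    then obtain F where F: "F \<in> left_module_hom K V (regular_module K)" "F ?w = \<one>\<^bsub>K\<^esub>"
      "\<And>n. n \<in> ?N \<Longrightarrow> F n = \<zero>\<^bsub>K\<^esub>" using functional_separating[OF N w(2)] by blast
    interpret F: plain_module_hom K V "regular_module K" F using F(1) by unfold_locales
    have "F x = f x" if x: "x \<in> U" for x
    proof -
      let ?y = "\<ominus>\<^bsub>V\<^esub> (f x \<odot>\<^bsub>V\<^esub> ?w)"
      have y: "?y \<in> U" "?y \<in> carrier V"
        using submodule_a_inv[OF U submodule_smult[OF U fc[OF x] w(1)]] Uc by simp_all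
      have "?y = (\<ominus>\<^bsub>K\<^esub> f x) \<odot>\<^bsub>V\<^esub> ?w" using smult_l_minus[OF fc[OF x] w(2)] by simp
      then have "f ?y = \<ominus>\<^bsub>K\<^esub> f x" "F ?y = \<ominus>\<^bsub>K\<^esub> f x"
        using f.hom_smult[of "\<ominus>\<^bsub>K\<^esub> f x" ?w] F.hom_smult[of "\<ominus>\<^bsub>K\<^esub> f x" ?w] w fw F(2) fc[OF x] by simp_all
      moreover have "f (x \<oplus>\<^bsub>V\<^esub> ?y) = f x \<oplus>\<^bsub>K\<^esub> f ?y" "F (x \<oplus>\<^bsub>V\<^esub> ?y) = F x \<oplus>\<^bsub>K\<^esub> F ?y"
        using f.hom_add[of x ?y] F.hom_add[of x ?y] x y Uc[OF x] by simp_all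
      moreover from calculation have "f (x \<oplus>\<^bsub>V\<^esub> ?y) = \<zero>\<^bsub>K\<^esub>" using fc[OF x] by (simp add: K.r_neg)
      then have "F (x \<oplus>\<^bsub>V\<^esub> ?y) = \<zero>\<^bsub>K\<^esub>" using F(3) submodule_add[OF U x y(1)] by simp
      moreover have "F x \<in> carrier K" using F.hom_closed[OF Uc[OF x]] by simp
      ultimately show ?thesis
        using fc[OF x] by (metis K.a_inv_closed K.minus_equality K.minus_minus)
    qed
    then show ?thesis using F(1) by blast
  qed
qed

end


section \<open>Finite-dimensional algebras\<close>

text \<open>Restriction of scalars along \<open>c \<mapsto> c 1\<close>.\<close>

definition scalar_module ::
  "('k, 'a, 's) module_scheme \<Rightarrow> ('a, 'm) module \<Rightarrow> ('k, 'm) module" where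
  "scalar_module A M = \<lparr>carrier = carrier M, mult = undefined, one = undefined, zero = zero M,
     add = add M, smult = (\<lambda>c x. (c \<odot>\<^bsub>A\<^esub> \<one>\<^bsub>A\<^esub>) \<odot>\<^bsub>M\<^esub> x)\<rparr>"

lemma scalar_module_simps [simp]:
  "carrier (scalar_module A M) = carrier M" "\<zero>\<^bsub>scalar_module A M\<^esub> = \<zero>\<^bsub>M\<^esub>"
  "x \<oplus>\<^bsub>scalar_module A M\<^esub> y = x \<oplus>\<^bsub>M\<^esub> y" "c \<odot>\<^bsub>scalar_module A M\<^esub> x = (c \<odot>\<^bsub>A\<^esub> \<one>\<^bsub>A\<^esub>) \<odot>\<^bsub>M\<^esub> x"
  by (simp_all add: scalar_module_def)

context fd_algebra
begin

abbreviation A\<^sub>K where "A\<^sub>K \<equiv> scalar_module A (regular_module A)"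

lemma one_mult:
  assumes "c \<in> carrier K" "x \<in> carrier A" shows "(c \<odot>\<^bsub>A\<^esub> \<one>\<^bsub>A\<^esub>) \<otimes>\<^bsub>A\<^esub> x = c \<odot>\<^bsub>A\<^esub> x"
  using smult_mult_left[of c "\<one>\<^bsub>A\<^esub>" x] assms by simp

lemma scalar_linear_space:
  assumes "plain_left_module A M" shows "linear_space K (scalar_module A M)"
proof -
  interpret M: plain_left_module A M by fact
  have "abelian_group (scalar_module A M)"
    by (rule abelian_groupI) (auto simp: M.M.a_ac intro: M.M.l_neg bexI[of _ "\<ominus>\<^bsub>M\<^esub> _"])
  moreover have "left_module_axioms K (scalar_module A M)"
    by (rule left_module_axioms.intro)
      (simp_all add: M.smult_r_distr M.smult_l_distr smult_l_distr one_mult smult_assoc1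
        M.smult_assoc1[symmetric])
  ultimately show ?thesis
    unfolding linear_space_def plain_left_module_def
    by (intro conjI left_module.intro K.field_axioms R.ring_axioms)
qed

lemma submodule_scalar:
  assumes "plain_left_module A M" and X: "submodule X A M"
  shows "submodule X K (scalar_module A M)"
proof -
  interpret M: plain_left_module A M by fact
  interpret S: linear_space K "scalar_module A M" by (rule scalar_linear_space[OF assms(1)])
  show ?thesis
    using M.submoduleD(1-4)[OF X] by (intro S.submoduleI) simp_all
qed

sublocale AK: linear_space K "A\<^sub>K" by (rule scalar_linear_space[OF A.regular_module_plain])

lemma finite_dimensional: "finite_length K A\<^sub>K"
proof -
  obtain B where B: "finite B" "B \<subseteq> carrier A"
    and gen: "\<And>x. x \<in> carrier A \<Longrightarrow> \<exists>c \<in> B \<rightarrow> carrier K. x = (\<Oplus>\<^bsub>A\<^esub>b\<in>B. c b \<odot>\<^bsub>A\<^esub> b)"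
    using finite_dim by blast
  obtain bs where bs: "set bs = B" using finite_list[OF B(1)] by blast
  have bc: "set bs \<subseteq> carrier A\<^sub>K" using B(2) bs by simp
  let ?S = "multiples_span K A\<^sub>K (carrier K) bs"
  have S: "submodule ?S K A\<^sub>K" by (rule AK.submodule_multiples_span[OF AK.submodule_regular_carrier bc])
  have "x \<in> ?S" if x: "x \<in> carrier A" for x
  proof -
    obtain c where c: "c \<in> B \<rightarrow> carrier K" "x = (\<Oplus>\<^bsub>A\<^esub>b\<in>B. c b \<odot>\<^bsub>A\<^esub> b)" using gen[OF x] by blast
    have "finite F \<Longrightarrow> F \<subseteq> B \<Longrightarrow> (\<Oplus>\<^bsub>A\<^esub>b\<in>F. c b \<odot>\<^bsub>A\<^esub> b) \<in> ?S" for F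
    proof (induction F rule: finite_induct)
      case empty
      then show ?case using AK.submodule_zero[OF S] by simp
    next
      case (insert b F)
      have b: "b \<in> B" "b \<in> carrier A" "c b \<in> carrier K" using insert.prems B(2) c(1) by auto
      have F: "(\<lambda>b. c b \<odot>\<^bsub>A\<^esub> b) \<in> F \<rightarrow> carrier A" using insert.prems B(2) c(1) by blast
      have "c b \<odot>\<^bsub>A\<^sub>K\<^esub> b \<in> ?S"
        by (rule AK.submodule_smult[OF S b(3) subsetD[OF AK.set_subset_multiples_span[OF bc]]]) (simp add: bs b)
      then have "c b \<odot>\<^bsub>A\<^esub> b \<in> ?S" using one_mult[OF b(3,2)] by simp
      moreover have "(\<Oplus>\<^bsub>A\<^esub>b\<in>F. c b \<odot>\<^bsub>A\<^esub> b) \<in> ?S" using insert by simp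
      ultimately have "c b \<odot>\<^bsub>A\<^esub> b \<oplus>\<^bsub>A\<^sub>K\<^esub> (\<Oplus>\<^bsub>A\<^esub>b\<in>F. c b \<odot>\<^bsub>A\<^esub> b) \<in> ?S" by (rule AK.submodule_add[OF S])
      then show ?case using M.finsum_insert[OF insert.hyps F] b by simp
    qed
    then show ?thesis using B(1) c(2) by simp
  qed
  then have "carrier A\<^sub>K \<subseteq> ?S" by auto
  then have eq: "carrier A\<^sub>K = ?S" using AK.submodule_subset[OF S] by (rule subset_antisym)
  have "finite_interval K A\<^sub>K {\<zero>\<^bsub>A\<^sub>K\<^esub>} ({\<zero>\<^bsub>A\<^sub>K\<^esub>} <+>\<^bsub>A\<^sub>K\<^esub> ?S)"
    by (rule conjunct1[OF AK.interval_length_multiples_span[OF AK.submodule_regular_carrier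
            AK.zero_submodule_K _ AK.length_K(1) AK.submodule_0 bc]])
      (use bc in \<open>auto simp: A.l_null\<close>)
  then show ?thesis
    unfolding AK.set_add_zero[OF AK.submodule_subset[OF S]] AK.finite_length_eq eq .
qed

lemma finite_length_regular: "finite_length A (regular_module A)"
proof -
  interpret reg: plain_left_module A "regular_module A" by (rule A.regular_module_plain)
  have "finite_interval A (regular_module A) {\<zero>\<^bsub>A\<^esub>} (carrier A)"
    by (rule interval_length_transfer(1)[OF finite_length_finite_interval[OF finite_dimensional], of _ _ _ _ "\<lambda>X. X"
          "{\<zero>\<^bsub>A\<^esub>}" "carrier A"])
      (use reg.submodule_0 submodule_scalar[OF A.regular_module_plain] in auto)
  then show ?thesis using reg.finite_length_eq by simp
qed

end

section \<open>Non-degenerate forms and self-injectivity\<close>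

text \<open>A functional \<open>l\<close> gives the bilinear form \<open>l (x \<otimes> y)\<close>. If no non-zero \<open>x\<close> is orthogonal to all
  \<open>y\<close>, then \<open>A\<close> is a Frobenius algebra.\<close>

locale frobenius_form = fd_algebra K A
  for K :: "('k, 'r) ring_scheme" and A :: "('k, 'a, 's) module_scheme" +
  fixes l :: "'a \<Rightarrow> 'k"
  assumes l_hom: "l \<in> left_module_hom K (scalar_module A (regular_module A)) (regular_module K)"
    and nondegenerate: "\<lbrakk>x \<in> carrier A; \<And>y. y \<in> carrier A \<Longrightarrow> l (x \<otimes>\<^bsub>A\<^esub> y) = \<zero>\<^bsub>K\<^esub>\<rbrakk> \<Longrightarrow> x = \<zero>\<^bsub>A\<^esub>"
begin

lemma l_closed [simp]: "x \<in> carrier A \<Longrightarrow> l x \<in> carrier K"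
  and l_add [simp]: "\<lbrakk>x \<in> carrier A; y \<in> carrier A\<rbrakk> \<Longrightarrow> l (x \<oplus>\<^bsub>A\<^esub> y) = l x \<oplus>\<^bsub>K\<^esub> l y"
  using l_hom by (auto simp: left_module_hom_def hom_def)

lemma l_smult [simp]: "\<lbrakk>c \<in> carrier K; x \<in> carrier A\<rbrakk> \<Longrightarrow> l (c \<odot>\<^bsub>A\<^esub> x) = c \<otimes>\<^bsub>K\<^esub> l x"
  using l_hom one_mult by (auto simp: left_module_hom_def)

lemma l_zero [simp]: "l \<zero>\<^bsub>A\<^esub> = \<zero>\<^bsub>K\<^esub>"
  using l_smult[of "\<zero>\<^bsub>K\<^esub>" "\<zero>\<^bsub>A\<^esub>"] by (simp del: l_smult)

abbreviation K\<^sub>K where "K\<^sub>K \<equiv> regular_module K"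

sublocale KK: plain_left_module K "K\<^sub>K" by (rule R.regular_module_plain)

lemma finK [simp]: "finite_interval K A\<^sub>K X Y"
  by (rule finite_length_finite_interval[OF finite_dimensional])

lemma form_hom:
  assumes h: "h \<in> carrier A"
  shows "plain_module_hom K A\<^sub>K K\<^sub>K (\<lambda>x. l (x \<otimes>\<^bsub>A\<^esub> h))"
  by unfold_locales
    (use h in \<open>simp add: left_module_hom_def hom_def one_mult A.l_distr smult_mult_left\<close>)

definition orth :: "'a list \<Rightarrow> 'a set" where
  "orth hs = {x \<in> carrier A. \<forall>h\<in>set hs. l (x \<otimes>\<^bsub>A\<^esub> h) = \<zero>\<^bsub>K\<^esub>}"

lemma orth_submodule: "set hs \<subseteq> carrier A \<Longrightarrow> submodule (orth hs) K A\<^sub>K"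
  by (rule AK.submoduleI)
    (auto simp: orth_def subset_iff A.l_distr one_mult smult_mult_left)

text \<open>One linear condition lowers the dimension by at most one.\<close>

lemma orth_codimension:
  "set hs \<subseteq> carrier A \<Longrightarrow> interval_length K A\<^sub>K (orth hs) (carrier A) \<le> length hs"
proof (induction hs)
  case Nil
  have "orth [] = carrier A" by (simp add: orth_def)
  then show ?case using AK.interval_length_self(1)[OF AK.submodule_carrier] by simp
next
  case (Cons h hs)
  then have h: "h \<in> carrier A" and hs: "set hs \<subseteq> carrier A" by auto
  interpret f: plain_module_hom K "A\<^sub>K" "K\<^sub>K" "\<lambda>x. l (x \<otimes>\<^bsub>A\<^esub> h)" by (rule form_hom[OF h])
  let ?f = "\<lambda>x. l (x \<otimes>\<^bsub>A\<^esub> h)"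
  have k: "a_kernel A\<^sub>K K\<^sub>K ?f = orth [h]" by (simp add: f.kernel_eq orth_def)
  have h1: "set [h] \<subseteq> carrier A" using h by simp
  note O1 = orth_submodule[OF h1] and O = orth_submodule[OF hs] and O' = orth_submodule[OF Cons.prems]
  have C: "submodule (carrier A) K A\<^sub>K" using AK.submodule_carrier by simp
  have i: "orth (h # hs) = orth [h] \<inter> orth hs" by (auto simp: orth_def)
  have s: "orth hs' \<subseteq> carrier A" for hs' by (auto simp: orth_def)
  have S: "submodule (orth [h] <+>\<^bsub>A\<^sub>K\<^esub> orth hs) K A\<^sub>K" by (rule AK.submodule_set_add[OF O1 O])
  have "interval_length K A\<^sub>K (orth (h # hs)) (orth hs) =
      interval_length K A\<^sub>K (orth [h]) (orth [h] <+>\<^bsub>A\<^sub>K\<^esub> orth hs)"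
    unfolding i by (rule AK.interval_length_second_iso(2)[OF finK O1 O, symmetric])
  also have "\<dots> \<le> interval_length K A\<^sub>K (orth [h]) (carrier A)"
    by (rule AK.interval_length_mono[OF finK O1 AK.set_add_upper1[OF O1 O]])
      (use AK.submodule_subset[OF S] in simp)
  also have "\<dots> = interval_length K K\<^sub>K (?f ` orth [h]) (?f ` carrier A)"
    by (rule f.interval_length_image(2)[OF f.interval_length_image_le(1)[OF finK O1 C s] O1 C s, symmetric])
      (simp add: k)
  also have "?f ` orth [h] = {\<zero>\<^bsub>K\<^esub>}"
  proof (rule subset_antisym)
    show "?f ` orth [h] \<subseteq> {\<zero>\<^bsub>K\<^esub>}" by (rule image_subsetI) (simp add: orth_def)
    have "\<zero>\<^bsub>K\<^esub> \<in> ?f ` orth [h]"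
      using AK.submodule_zero[OF O1] h by (intro image_eqI[of _ _ "\<zero>\<^bsub>A\<^esub>"]) simp_all
    then show "{\<zero>\<^bsub>K\<^esub>} \<subseteq> ?f ` orth [h]" by simp
  qed
  also have "interval_length K K\<^sub>K {\<zero>\<^bsub>K\<^esub>} (?f ` carrier A) \<le> interval_length K K\<^sub>K {\<zero>\<^bsub>K\<^esub>} (carrier K)"
  proof (rule KK.interval_length_mono[OF AK.length_K(1) AK.zero_submodule_K])
    show "{\<zero>\<^bsub>K\<^esub>} \<subseteq> ?f ` carrier A" using h by (auto intro!: image_eqI[of _ _ "\<zero>\<^bsub>A\<^esub>"])
    show "?f ` carrier A \<subseteq> carrier K" using h by auto
  qed
  also have "\<dots> \<le> 1" by (rule AK.length_K(2))
  finally have "interval_length K A\<^sub>K (orth (h # hs)) (orth hs) \<le> 1" .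
  moreover have "interval_length K A\<^sub>K (orth (h # hs)) (carrier A) =
      interval_length K A\<^sub>K (orth (h # hs)) (orth hs) + interval_length K A\<^sub>K (orth hs) (carrier A)"
    by (rule AK.interval_length_add(2)[OF finK finK O' O C _ s]) (simp add: i)
  ultimately show ?case using Cons.IH[OF hs] by simp
qed

text \<open>Choose a complement of the right radical \<open>L\<close> of the form, spanned by at most
  \<open>dim A - dim L\<close> elements. By non-degeneracy nothing but zero is orthogonal to these elements, so
  there are at least \<open>dim A\<close> of them.\<close>

lemma nondegenerate_right:
  assumes h: "h \<in> carrier A" and "\<And>x. x \<in> carrier A \<Longrightarrow> l (x \<otimes>\<^bsub>A\<^esub> h) = \<zero>\<^bsub>K\<^esub>"
  shows "h = \<zero>\<^bsub>A\<^esub>"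
    and "\<exists>hs. set hs \<subseteq> carrier A \<and> orth hs = {\<zero>\<^bsub>A\<^esub>}"
proof -
  define L where "L = {h \<in> carrier A. \<forall>x\<in>carrier A. l (x \<otimes>\<^bsub>A\<^esub> h) = \<zero>\<^bsub>K\<^esub>}"
  have L: "submodule L K A\<^sub>K"
    by (rule AK.submoduleI) (auto simp: L_def A.r_distr one_mult smult_mult_right)
  have LA: "L \<subseteq> carrier A" by (auto simp: L_def)
  have C: "submodule (carrier A) K A\<^sub>K" using AK.submodule_carrier by simp
  obtain hs where hs: "set hs \<subseteq> carrier A" "length hs \<le> interval_length K A\<^sub>K L (carrier A)"
    and gen: "carrier A = L <+>\<^bsub>A\<^sub>K\<^esub> multiples_span K A\<^sub>K (carrier K) hs"
    using AK.exists_generators[OF L C LA finK] by auto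
  have "x = \<zero>\<^bsub>A\<^esub>" if x: "x \<in> orth hs" for x
  proof (rule nondegenerate)
    show xc: "x \<in> carrier A" using x by (simp add: orth_def)
    let ?Y = "{y \<in> carrier A. l (x \<otimes>\<^bsub>A\<^esub> y) = \<zero>\<^bsub>K\<^esub>}"
    have Y: "submodule ?Y K A\<^sub>K"
      by (rule AK.submoduleI) (use xc in \<open>auto simp: A.r_distr one_mult smult_mult_right\<close>)
    have "L \<subseteq> ?Y" using xc by (auto simp: L_def)
    moreover have "multiples_span K A\<^sub>K (carrier K) hs \<subseteq> ?Y"
      by (rule AK.multiples_span_subset[OF Y]) (use x hs(1) in \<open>auto simp: orth_def\<close>)
    ultimately have "carrier A \<subseteq> ?Y" using AK.set_add_least[OF Y] gen by simp
    then show "l (x \<otimes>\<^bsub>A\<^esub> y) = \<zero>\<^bsub>K\<^esub>" if "y \<in> carrier A" for y using that by auto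
  qed
  then have "orth hs \<subseteq> {\<zero>\<^bsub>A\<^esub>}" by auto
  then have 0: "orth hs = {\<zero>\<^bsub>A\<^esub>}" using AK.submodule_zero[OF orth_submodule[OF hs(1)]] by auto
  then show "\<exists>hs. set hs \<subseteq> carrier A \<and> orth hs = {\<zero>\<^bsub>A\<^esub>}" using hs(1) by blast
  have zL: "{\<zero>\<^bsub>A\<^esub>} \<subseteq> L" using AK.submodule_zero[OF L] by simp
  have Z: "submodule {\<zero>\<^bsub>A\<^esub>} K A\<^sub>K" using AK.submodule_0 by simp
  have "interval_length K A\<^sub>K {\<zero>\<^bsub>A\<^esub>} (carrier A) =
      interval_length K A\<^sub>K {\<zero>\<^bsub>A\<^esub>} L + interval_length K A\<^sub>K L (carrier A)"
    by (rule AK.interval_length_add(2)[OF finK finK Z L C zL LA])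
  then have "interval_length K A\<^sub>K {\<zero>\<^bsub>A\<^esub>} L = 0"
    using orth_codimension[OF hs(1)] hs(2) 0 by simp
  then have "\<not> {\<zero>\<^bsub>A\<^esub>} \<subset> L"
    using AK.interval_length_strict_mono[OF finK Z L order_refl] by auto
  then have "L = {\<zero>\<^bsub>A\<^esub>}" using zL by auto
  then show "h = \<zero>\<^bsub>A\<^esub>" using assms by (auto simp: L_def)
qed

text \<open>This is the fact that a functional vanishing on the common kernel of finitely many functionals is
  a linear combination of them. One functional at a time is removed: on its kernel the induction
  hypothesis applies, and the difference to the functional found there is a multiple of it.\<close>

lemma representation_on:
  assumes f: "\<And>x. x \<in> carrier A \<Longrightarrow> f x \<in> carrier K"
    "\<And>x y. \<lbrakk>x \<in> carrier A; y \<in> carrier A\<rbrakk> \<Longrightarrow> f (x \<oplus>\<^bsub>A\<^esub> y) = f x \<oplus>\<^bsub>K\<^esub> f y"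
    "\<And>c x. \<lbrakk>c \<in> carrier K; x \<in> carrier A\<rbrakk> \<Longrightarrow> f (c \<odot>\<^bsub>A\<^esub> x) = c \<otimes>\<^bsub>K\<^esub> f x"
  shows "\<lbrakk>set hs \<subseteq> carrier A; submodule X K A\<^sub>K; \<And>x. \<lbrakk>x \<in> X; x \<in> orth hs\<rbrakk> \<Longrightarrow> f x = \<zero>\<^bsub>K\<^esub>\<rbrakk>
    \<Longrightarrow> \<exists>h\<in>carrier A. \<forall>x\<in>X. f x = l (x \<otimes>\<^bsub>A\<^esub> h)"
proof (induction hs arbitrary: X)
  case Nil
  have "f x = l (x \<otimes>\<^bsub>A\<^esub> \<zero>\<^bsub>A\<^esub>)" if "x \<in> X" for x
  proof -
    have "x \<in> carrier A" using AK.submodule_subset[OF Nil(2)] that by auto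
    then show ?thesis using Nil(3)[OF that] by (simp add: orth_def)
  qed
  then show ?case by (intro bexI[of _ "\<zero>\<^bsub>A\<^esub>"]) auto
next
  case (Cons h0 hs)
  then have h0: "h0 \<in> carrier A" and hs: "set hs \<subseteq> carrier A" by auto
  note X = Cons.prems(2)
  have Xc: "x \<in> carrier A" if "x \<in> X" for x using AK.submodule_subset[OF X] that by auto
  let ?X' = "X \<inter> orth [h0]"
  have X': "submodule ?X' K A\<^sub>K"
    by (rule AK.submodule_inter[OF X orth_submodule]) (use h0 in simp)
  have "f x = \<zero>\<^bsub>K\<^esub>" if "x \<in> ?X'" "x \<in> orth hs" for x
    using Cons.prems(3)[of x] that by (simp add: orth_def)
  then obtain h1 where h1: "h1 \<in> carrier A" and eq: "\<And>x. x \<in> ?X' \<Longrightarrow> f x = l (x \<otimes>\<^bsub>A\<^esub> h1)"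
    using Cons.IH[OF hs X'] by blast
  show ?case
  proof (cases "X \<subseteq> orth [h0]")
    case True
    then have "?X' = X" by auto
    then show ?thesis using h1 eq by auto
  next
    case False
    then obtain x0 where x0: "x0 \<in> X" "l (x0 \<otimes>\<^bsub>A\<^esub> h0) \<noteq> \<zero>\<^bsub>K\<^esub>" using Xc by (auto simp: orth_def)
    define D where "D x = f x \<ominus>\<^bsub>K\<^esub> l (x \<otimes>\<^bsub>A\<^esub> h1)" for x
    have Dc: "D x \<in> carrier K" if "x \<in> carrier A" for x using that f(1) h1 by (simp add: D_def)
    have D_smult: "D (c \<odot>\<^bsub>A\<^esub> x) = c \<otimes>\<^bsub>K\<^esub> D x" if "c \<in> carrier K" "x \<in> carrier A" for c x
      using that f h1 by (simp add: D_def smult_mult_left a_minus_def R.r_distr R.r_minus)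
    have D_add: "D (x \<oplus>\<^bsub>A\<^esub> y) = D x \<oplus>\<^bsub>K\<^esub> D y" if "x \<in> carrier A" "y \<in> carrier A" for x y
      using that f h1 by (simp add: D_def A.l_distr a_minus_def R.minus_add R.a_ac)
    have fD: "f x = l (x \<otimes>\<^bsub>A\<^esub> h1) \<oplus>\<^bsub>K\<^esub> D x" if "x \<in> carrier A" for x
    proof -
      have "f x = D x \<oplus>\<^bsub>K\<^esub> l (x \<otimes>\<^bsub>A\<^esub> h1)"
        using that f(1) h1 by (simp add: D_def a_minus_def R.a_assoc R.l_neg)
      then show ?thesis using Dc[OF that] that h1 by (simp add: R.a_comm)
    qed
    let ?s = "l (x0 \<otimes>\<^bsub>A\<^esub> h0)"
    have x0c: "x0 \<in> carrier A" using Xc x0(1) .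
    have s: "?s \<in> carrier K" using x0c h0 by simp
    note i = AK.inverse[OF s x0(2)]
    let ?c = "inv\<^bsub>K\<^esub> ?s \<otimes>\<^bsub>K\<^esub> D x0"
    have c: "?c \<in> carrier K" using i Dc[OF x0c] by simp
    have "f x = l (x \<otimes>\<^bsub>A\<^esub> (h1 \<oplus>\<^bsub>A\<^esub> ?c \<odot>\<^bsub>A\<^esub> h0))" if x: "x \<in> X" for x
    proof -
      have xc: "x \<in> carrier A" by (rule Xc[OF x])
      let ?p = "l (x \<otimes>\<^bsub>A\<^esub> h0)"
      let ?q = "?p \<otimes>\<^bsub>K\<^esub> inv\<^bsub>K\<^esub> ?s"
      have p: "?p \<in> carrier K" using xc h0 by simp
      have q: "?q \<in> carrier K" using p i by simp
      have qs: "?q \<otimes>\<^bsub>K\<^esub> ?s = ?p" using p i s by (simp add: R.m_assoc)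
      let ?y = "(\<ominus>\<^bsub>K\<^esub> ?q) \<odot>\<^bsub>A\<^esub> x0"
      have y: "?y \<in> X" using AK.submodule_smult[OF X _ x0(1), of "\<ominus>\<^bsub>K\<^esub> ?q"] q x0c one_mult by simp
      have yc: "?y \<in> carrier A" by (rule Xc[OF y])
      have "l ((x \<oplus>\<^bsub>A\<^esub> ?y) \<otimes>\<^bsub>A\<^esub> h0) = ?p \<oplus>\<^bsub>K\<^esub> (\<ominus>\<^bsub>K\<^esub> ?q) \<otimes>\<^bsub>K\<^esub> ?s"
        using xc yc x0c h0 q by (simp add: A.l_distr smult_mult_left)
      also have "\<dots> = \<zero>\<^bsub>K\<^esub>" using q s qs p by (simp add: R.l_minus R.r_neg)
      finally have "x \<oplus>\<^bsub>A\<^esub> ?y \<in> ?X'"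
        using AK.submodule_add[OF X x y] xc yc by (simp add: orth_def)
      then have "D (x \<oplus>\<^bsub>A\<^esub> ?y) = \<zero>\<^bsub>K\<^esub>"
        using eq[of "x \<oplus>\<^bsub>A\<^esub> ?y"] xc yc h1 by (simp add: D_def a_minus_def R.r_neg)
      then have "D x \<oplus>\<^bsub>K\<^esub> \<ominus>\<^bsub>K\<^esub> (?q \<otimes>\<^bsub>K\<^esub> D x0) = \<zero>\<^bsub>K\<^esub>"
        using D_add[OF xc yc] D_smult[of "\<ominus>\<^bsub>K\<^esub> ?q" x0] q x0c Dc[OF x0c] by (simp add: R.l_minus)
      then have "\<ominus>\<^bsub>K\<^esub> (\<ominus>\<^bsub>K\<^esub> (?q \<otimes>\<^bsub>K\<^esub> D x0)) = D x"
        using q Dc[OF x0c] Dc[OF xc] by (intro R.minus_equality) simp_all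
      then have "D x = ?q \<otimes>\<^bsub>K\<^esub> D x0" using q Dc[OF x0c] by simp
      also have "\<dots> = ?c \<otimes>\<^bsub>K\<^esub> ?p" using p i Dc[OF x0c] by (simp add: R.m_ac)
      finally have "f x = l (x \<otimes>\<^bsub>A\<^esub> h1) \<oplus>\<^bsub>K\<^esub> ?c \<otimes>\<^bsub>K\<^esub> ?p" using fD[OF xc] by simp
      then show ?thesis using xc h0 h1 c by (simp add: A.r_distr smult_mult_right)
    qed
    moreover have "h1 \<oplus>\<^bsub>A\<^esub> ?c \<odot>\<^bsub>A\<^esub> h0 \<in> carrier A" using h0 h1 c by simp
    ultimately show ?thesis by blast
  qed
qed

lemma representation:
  assumes f: "\<And>x. x \<in> carrier A \<Longrightarrow> f x \<in> carrier K"
    "\<And>x y. \<lbrakk>x \<in> carrier A; y \<in> carrier A\<rbrakk> \<Longrightarrow> f (x \<oplus>\<^bsub>A\<^esub> y) = f x \<oplus>\<^bsub>K\<^esub> f y"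
    "\<And>c x. \<lbrakk>c \<in> carrier K; x \<in> carrier A\<rbrakk> \<Longrightarrow> f (c \<odot>\<^bsub>A\<^esub> x) = c \<otimes>\<^bsub>K\<^esub> f x"
  shows "\<exists>h\<in>carrier A. \<forall>x\<in>carrier A. f x = l (x \<otimes>\<^bsub>A\<^esub> h)"
proof -
  obtain hs where hs: "set hs \<subseteq> carrier A" "orth hs = {\<zero>\<^bsub>A\<^esub>}"
    using nondegenerate_right(2)[of "\<zero>\<^bsub>A\<^esub>"] by auto
  have "f \<zero>\<^bsub>A\<^esub> = \<zero>\<^bsub>K\<^esub>" using f(3)[of "\<zero>\<^bsub>K\<^esub>" "\<zero>\<^bsub>A\<^esub>"] f(1) by simp
  moreover have "submodule (carrier A) K A\<^sub>K" using AK.submodule_carrier by simp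
  ultimately show ?thesis using representation_on[of f hs "carrier A"] f hs by auto
qed

lemma form_cancel:
  assumes "h \<in> carrier A" "h' \<in> carrier A"
    and eq: "\<And>x. x \<in> carrier A \<Longrightarrow> l (x \<otimes>\<^bsub>A\<^esub> h) = l (x \<otimes>\<^bsub>A\<^esub> h')"
  shows "h = h'"
proof -
  let ?m = "(\<ominus>\<^bsub>K\<^esub> \<one>\<^bsub>K\<^esub>) \<odot>\<^bsub>A\<^esub> h'"
  have m: "?m = \<ominus>\<^bsub>A\<^esub> h'" using assms smult_l_minus[of "\<one>\<^bsub>K\<^esub>" h'] by simp
  have "l (x \<otimes>\<^bsub>A\<^esub> (h \<oplus>\<^bsub>A\<^esub> ?m)) = \<zero>\<^bsub>K\<^esub>" if x: "x \<in> carrier A" for x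
    using eq[OF x] x assms by (simp add: A.r_distr smult_mult_right R.l_minus R.r_neg)
  then have "h \<oplus>\<^bsub>A\<^esub> \<ominus>\<^bsub>A\<^esub> h' = \<zero>\<^bsub>A\<^esub>"
    using nondegenerate_right(1)[of "h \<oplus>\<^bsub>A\<^esub> ?m"] assms m by simp
  then have "\<ominus>\<^bsub>A\<^esub> (\<ominus>\<^bsub>A\<^esub> h') = h" using assms by (intro M.minus_equality) simp_all
  then show ?thesis using assms by simp
qed

text \<open>A homomorphism \<open>f\<close> from a submodule of \<open>Y\<close> to \<open>A\<close> is extended by extending the functional
  \<open>l \<circ> f\<close> to \<open>\<Psi>\<close> on \<open>Y\<close>: the value at \<open>y\<close> is the element that represents the functional
  \<open>b \<mapsto> \<Psi> (b y)\<close>.\<close>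

lemma self_injective: "self_injective A"
  unfolding self_injective_def injective_module_def
proof (intro allI impI, elim conjE)
  fix X Y :: "('a, nat \<Rightarrow> 'a) module" and g f
  assume "fl_module A X" "fl_module A Y" and g_hom: "g \<in> left_module_hom A X Y"
    and inj: "inj_on g (carrier X)" and f_hom: "f \<in> left_module_hom A X (regular_module A)"
  then interpret X: plain_left_module A X by (simp add: fl_module_def plain_left_module_def)
  interpret Y: plain_left_module A Y
    using \<open>fl_module A Y\<close> by (simp add: fl_module_def plain_left_module_def)
  interpret reg: plain_left_module A "regular_module A" by (rule A.regular_module_plain)
  interpret g: plain_module_hom A X Y g using g_hom by unfold_locales
  interpret f: plain_module_hom A X "regular_module A" f using f_hom by unfold_locales
  let ?V = "scalar_module A Y"
  interpret V: linear_space K ?V by (rule scalar_linear_space[OF Y.plain_left_module_axioms])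
  let ?U = "g ` carrier X"
  have UA: "submodule ?U A Y" by (rule g.submodule_image[OF X.submodule_carrier])
  have U: "submodule ?U K ?V" by (rule submodule_scalar[OF Y.plain_left_module_axioms UA])
  define \<phi> where "\<phi> u = l (f (inv_into (carrier X) g u))" for u
  have \<phi>: "\<phi> (g x) = l (f x)" if "x \<in> carrier X" for x using inj that by (simp add: \<phi>_def)
  have fc: "f x \<in> carrier A" if "x \<in> carrier X" for x using f.hom_closed[OF that] by simp
  have "\<phi> \<in> left_module_hom K (sub_module ?V ?U) (regular_module K)"
    unfolding left_module_hom_def hom_def
  proof (intro CollectI conjI ballI funcsetI)
    fix u assume "u \<in> carrier (add_monoid (sub_module ?V ?U))"
    then obtain x where x: "x \<in> carrier X" "u = g x" by auto
    then show "\<phi> u \<in> carrier (add_monoid (regular_module K))" using \<phi> fc by simp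
  next
    fix u v assume "u \<in> carrier (add_monoid (sub_module ?V ?U))" "v \<in> carrier (add_monoid (sub_module ?V ?U))"
    then obtain x y where x: "x \<in> carrier X" "u = g x" and y: "y \<in> carrier X" "v = g y" by auto
    then have "u \<oplus>\<^bsub>Y\<^esub> v = g (x \<oplus>\<^bsub>X\<^esub> y)" by simp
    then have "\<phi> (u \<oplus>\<^bsub>Y\<^esub> v) = l (f (x \<oplus>\<^bsub>X\<^esub> y))" using \<phi>[of "x \<oplus>\<^bsub>X\<^esub> y"] x y by simp
    then show "\<phi> (u \<otimes>\<^bsub>add_monoid (sub_module ?V ?U)\<^esub> v) = \<phi> u \<otimes>\<^bsub>add_monoid (regular_module K)\<^esub> \<phi> v"
      using x y \<phi> fc f.hom_add[OF x(1) y(1)] by simp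
  next
    fix c u assume c: "c \<in> carrier K" and "u \<in> carrier (sub_module ?V ?U)"
    then obtain x where x: "x \<in> carrier X" "u = g x" by auto
    have c1: "c \<odot>\<^bsub>A\<^esub> \<one>\<^bsub>A\<^esub> \<in> carrier A" using c by simp
    have "\<phi> ((c \<odot>\<^bsub>A\<^esub> \<one>\<^bsub>A\<^esub>) \<odot>\<^bsub>Y\<^esub> u) = l (f ((c \<odot>\<^bsub>A\<^esub> \<one>\<^bsub>A\<^esub>) \<odot>\<^bsub>X\<^esub> x))"
      using \<phi>[OF X.smult_closed[OF c1 x(1)]] g.hom_smult[OF c1 x(1)] x(2) by simp
    also have "\<dots> = c \<otimes>\<^bsub>K\<^esub> \<phi> u"
      using f.hom_smult[OF c1 x(1)] \<phi>[OF x(1)] x fc[OF x(1)] c one_mult by simp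
    finally show "\<phi> (c \<odot>\<^bsub>sub_module ?V ?U\<^esub> u) = c \<odot>\<^bsub>regular_module K\<^esub> \<phi> u" by simp
  qed
  then obtain \<Psi> where "\<Psi> \<in> left_module_hom K ?V (regular_module K)" and \<Psi>\<phi>: "\<And>u. u \<in> ?U \<Longrightarrow> \<Psi> u = \<phi> u"
    using V.functional_extension[OF U] by blast
  then interpret \<Psi>: plain_module_hom K ?V "regular_module K" \<Psi> by unfold_locales
  have \<Psi>_closed: "\<Psi> y \<in> carrier K" if "y \<in> carrier Y" for y using \<Psi>.hom_closed[of y] that by simp
  have \<Psi>_add: "\<Psi> (y \<oplus>\<^bsub>Y\<^esub> z) = \<Psi> y \<oplus>\<^bsub>K\<^esub> \<Psi> z" if "y \<in> carrier Y" "z \<in> carrier Y" for y z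
    using \<Psi>.hom_add[of y z] that by simp
  have \<Psi>_smult: "\<Psi> ((c \<odot>\<^bsub>A\<^esub> b) \<odot>\<^bsub>Y\<^esub> y) = c \<otimes>\<^bsub>K\<^esub> \<Psi> (b \<odot>\<^bsub>Y\<^esub> y)"
    if "c \<in> carrier K" "b \<in> carrier A" "y \<in> carrier Y" for c b y
    using \<Psi>.hom_smult[of c "b \<odot>\<^bsub>Y\<^esub> y"] that by (simp add: Y.smult_assoc1[symmetric] one_mult)
  define H where "H y = (SOME h. h \<in> carrier A \<and> (\<forall>b\<in>carrier A. \<Psi> (b \<odot>\<^bsub>Y\<^esub> y) = l (b \<otimes>\<^bsub>A\<^esub> h)))" for y
  have H: "H y \<in> carrier A \<and> (\<forall>b\<in>carrier A. \<Psi> (b \<odot>\<^bsub>Y\<^esub> y) = l (b \<otimes>\<^bsub>A\<^esub> H y))" if y: "y \<in> carrier Y" for y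
    unfolding H_def
  proof (rule someI_ex)
    have "\<exists>h\<in>carrier A. \<forall>b\<in>carrier A. \<Psi> (b \<odot>\<^bsub>Y\<^esub> y) = l (b \<otimes>\<^bsub>A\<^esub> h)"
      by (rule representation) (use y in \<open>simp_all add: \<Psi>_closed Y.smult_l_distr \<Psi>_add \<Psi>_smult\<close>)
    then show "\<exists>h. h \<in> carrier A \<and> (\<forall>b\<in>carrier A. \<Psi> (b \<odot>\<^bsub>Y\<^esub> y) = l (b \<otimes>\<^bsub>A\<^esub> h))" by blast
  qed
  have Hc: "H y \<in> carrier A" and Hl: "\<And>b. b \<in> carrier A \<Longrightarrow> l (b \<otimes>\<^bsub>A\<^esub> H y) = \<Psi> (b \<odot>\<^bsub>Y\<^esub> y)"
    if "y \<in> carrier Y" for y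
    using H[OF that] by simp_all
  have "H (y \<oplus>\<^bsub>Y\<^esub> z) = H y \<oplus>\<^bsub>A\<^esub> H z" if "y \<in> carrier Y" "z \<in> carrier Y" for y z
    by (rule form_cancel) (use that in \<open>simp_all add: Hc Hl A.r_distr Y.smult_r_distr \<Psi>_add\<close>)
  moreover have "H (b \<odot>\<^bsub>Y\<^esub> y) = b \<otimes>\<^bsub>A\<^esub> H y" if b: "b \<in> carrier A" and y: "y \<in> carrier Y" for b y
  proof (rule form_cancel)
    fix x assume x: "x \<in> carrier A"
    have "l (x \<otimes>\<^bsub>A\<^esub> (b \<otimes>\<^bsub>A\<^esub> H y)) = l ((x \<otimes>\<^bsub>A\<^esub> b) \<otimes>\<^bsub>A\<^esub> H y)" using x b Hc[OF y] by (simp add: A.m_assoc)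
    also have "\<dots> = \<Psi> (x \<odot>\<^bsub>Y\<^esub> (b \<odot>\<^bsub>Y\<^esub> y))" using x b y by (simp add: Hl Y.smult_assoc1)
    finally show "l (x \<otimes>\<^bsub>A\<^esub> H (b \<odot>\<^bsub>Y\<^esub> y)) = l (x \<otimes>\<^bsub>A\<^esub> (b \<otimes>\<^bsub>A\<^esub> H y))" using x b y by (simp add: Hl)
  qed (use b y in \<open>simp_all add: Hc\<close>)
  ultimately have "H \<in> left_module_hom A Y (regular_module A)"
    by (simp add: left_module_hom_def hom_def Hc)
  moreover have "H (g x) = f x" if x: "x \<in> carrier X" for x
  proof (rule form_cancel)
    fix b assume b: "b \<in> carrier A"
    have "l (b \<otimes>\<^bsub>A\<^esub> H (g x)) = \<Psi> (g (b \<odot>\<^bsub>X\<^esub> x))" using b x by (simp add: Hl)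
    also have "\<dots> = \<phi> (g (b \<odot>\<^bsub>X\<^esub> x))" using b x by (intro \<Psi>\<phi> imageI) simp
    also have "\<dots> = l (b \<otimes>\<^bsub>A\<^esub> f x)" using \<phi>[of "b \<odot>\<^bsub>X\<^esub> x"] f.hom_smult[OF b x] b x by simp
    finally show "l (b \<otimes>\<^bsub>A\<^esub> H (g x)) = l (b \<otimes>\<^bsub>A\<^esub> f x)" .
  qed (use x in \<open>simp_all add: Hc fc\<close>)
  ultimately show "\<exists>h\<in>left_module_hom A Y (regular_module A). \<forall>x\<in>carrier X. h (g x) = f x" by blast
qed

end

section \<open>The numerical argument\<close>

lemma eventually_constant_to_the_left:
  fixes f :: "int \<Rightarrow> nat"
  assumes "\<And>i. i < N \<Longrightarrow> f i \<le> f (i + 1)"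
  shows "\<exists>n\<le>N. \<forall>i\<le>n. f i = f n"
proof -
  obtain n where n: "n \<le> N" and min: "\<And>i. i \<le> N \<Longrightarrow> f n \<le> f i"
    using ex_has_least_nat[of "\<lambda>i. i \<le> N" N f] by blast
  have "f i \<le> f n" if "i \<le> n" for i
    using that
  proof (induction i rule: int_le_induct)
    case (step i)
    then show ?case using assms[of "i - 1"] n by simp
  qed simp
  then have "f i = f n" if "i \<le> n" for i using min[of i] that n by (simp add: le_antisym)
  then show ?thesis using n by blast
qed

lemma not_strictly_increasing:
  fixes f :: "int \<Rightarrow> nat"
  shows "\<not> (\<forall>i. f i < f (i + 1))"
proof
  assume f: "\<forall>i. f i < f (i + 1)"
  then obtain n where n: "\<forall>i\<le>n. f i = f n"
    using eventually_constant_to_the_left[of 0 f] less_imp_le by blast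
  have "f (n - 1) = f n" by (rule n[rule_format]) simp
  moreover have "f (n - 1) < f n" using f[rule_format, of "n - 1"] by simp
  ultimately show False by simp
qed

text \<open>The quotient \<open>y/x\<close> is a root of the monic polynomial \<open>X\<^sup>2 - e X + a\<close>, so it is an integer.\<close>

lemma le_of_rational_root:
  fixes x y e a :: int
  assumes x: "0 < x" and y: "0 < y" and eq: "y * y = (e * y - a * x) * x"
  shows "x \<le> y"
proof -
  define g where "g = gcd x y"
  have g: "0 < g" using x by (simp add: g_def)
  obtain p q where pq: "x = g * p" "y = g * q" "coprime p q"
  proof -
    have "g dvd x" "g dvd y" by (simp_all add: g_def)
    moreover have "coprime (x div g) (y div g)" unfolding g_def using x by (intro div_gcd_coprime) auto
    ultimately show thesis using that[of "x div g" "y div g"] by simp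
  qed
  have "(g * g) * (q * q) = (g * g) * ((e * q - a * p) * p)"
    using eq unfolding pq by (simp add: algebra_simps)
  then have "q * q = (e * q - a * p) * p" using g by simp
  then have "p dvd q * q" by simp
  then have "p dvd q" using pq(3) coprime_dvd_mult_left_iff by blast
  then have "is_unit p" using pq(3) by (simp add: coprime_absorb_left)
  moreover have "0 < p" "0 < q" using x y g pq by (simp_all add: zero_less_mult_iff)
  ultimately have "p = 1" by (simp add: zdvd1_eq)
  then show ?thesis using pq g \<open>0 < q\<close> by simp
qed

text \<open>\<open>t i\<close> and \<open>r i\<close> stand for \<open>t(M\<^sub>i)\<close> and \<open>|JM\<^sub>i|\<close>, \<open>bip i\<close> for the bipartiteness of \<open>M\<^sub>i\<close>, and
  \<open>D i \<tau> \<rho>\<close> for the existence of a direct summand of \<open>M\<^sub>i\<close> of dimension vector \<open>(\<tau>, \<rho>)\<close>.\<close>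

locale betti_sequence =
  fixes e a :: nat and t r :: "int \<Rightarrow> nat" and bip :: "int \<Rightarrow> bool" and D :: "int \<Rightarrow> nat \<Rightarrow> nat \<Rightarrow> bool"
  assumes step: "t (i + 1) + r (i + 1) + r i = (e + a) * t i"
    and rad_le: "r i \<le> a * t (i - 1)"
    and layer: "\<exists>m. t i + r i = m + a * t (i - 1) \<and> r i \<le> m * e \<and> m \<le> t i"
    and nonzero: "\<exists>i. 0 < t i"
    and bip_rad: "bip i \<Longrightarrow> r i = a * t (i - 1)"
    and not_bip: "\<not> bip i \<Longrightarrow> D i 1 0"
    and D_le: "D i \<tau> \<rho> \<Longrightarrow> \<tau> \<le> t i"
    and D_step: "D i \<tau> \<rho> \<Longrightarrow> \<exists>\<tau>' \<rho>'. D (i + 1) \<tau>' \<rho>' \<and> \<tau>' + \<rho>' + \<rho> = (e + a) * \<tau> \<and> \<rho>' \<le> a * \<tau>"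
    and not_1_0: "\<not> (e = 1 \<and> a = 0)"
    and a_1: "a = 1 \<Longrightarrow> 2 \<le> e \<and> (\<forall>i. t i \<le> t (i + 1))"
begin

definition T :: "int \<Rightarrow> int" where "T i = int (t i)"

text \<open>The defect \<open>s i\<close> is the length of \<open>J\<^sup>2P\<^sub>i\<^sub>-\<^sub>1/JM\<^sub>i\<close>.\<close>

definition s :: "int \<Rightarrow> int" where "s i = int a * T (i - 1) - int (r i)"

lemma s_nonneg: "0 \<le> s i"
  using rad_le[of i] by (simp add: s_def T_def flip: of_nat_mult)

lemma bip_s: "bip i \<Longrightarrow> s i = 0"
  using bip_rad[of i] by (simp add: s_def T_def)

lemma recurrence: "T (i + 1) = int e * T i - int a * T (i - 1) + s i + s (i + 1)"
proof -
  have "T (i + 1) + int (r (i + 1)) + int (r i) = (int e + int a) * T i"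
    using arg_cong[OF step[of i], of int] by (simp add: T_def)
  then show ?thesis by (simp add: s_def algebra_simps)
qed

lemma layer_T: "int a * T (i - 1) \<le> int e * T i - (int e - 1) * s i"
proof -
  obtain m where m: "t i + r i = m + a * t (i - 1)" "r i \<le> m * e" using layer[of i] by blast
  have "int m = T i - s i" using arg_cong[OF m(1), of int] by (simp add: s_def T_def)
  moreover have "int (r i) \<le> int m * int e" using m(2) by (metis of_nat_le_iff of_nat_mult)
  ultimately have "int (r i) \<le> (T i - s i) * int e" by simp
  then show ?thesis by (simp add: s_def algebra_simps)
qed

lemma e_a_positive: "0 < e + a"
proof (rule ccontr)
  assume "\<not> 0 < e + a"
  then have "t i = 0" for i using step[of "i - 1"] by simp
  then show False using nonzero by simp
qed

lemma t_positive: "0 < t i"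
proof (rule ccontr)
  assume "\<not> 0 < t i"
  then have 0: "t i = 0" by simp
  have up: "t (j + 1) = 0" if "t j = 0" for j using step[of j] that by simp
  have down: "t (j - 1) = 0" if "t j = 0" for j
  proof -
    have "r j = 0" using step[of j] that by simp
    then have *: "r (j - 1) = (e + a) * t (j - 1)" using step[of "j - 1"] that by simp
    show ?thesis
    proof (cases "a = 0")
      case True
      then show ?thesis using * rad_le[of "j - 1"] e_a_positive by simp
    next
      case False
      obtain m where m: "r (j - 1) \<le> m * e" "m \<le> t (j - 1)" using layer[of "j - 1"] by blast
      then have "r (j - 1) \<le> t (j - 1) * e" using mult_le_mono1[OF m(2), of e] by linarith
      then show ?thesis using * False by (simp add: algebra_simps)
    qed
  qed
  have "t j = 0" for j
  proof (cases "i \<le> j")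
    case True
    then show ?thesis using 0 up by (induction j rule: int_ge_induct) simp_all
  next
    case False
    then have "j \<le> i" by simp
    then show ?thesis using 0 down by (induction j rule: int_le_induct) simp_all
  qed
  then show False using nonzero by simp
qed

lemma T_positive: "0 < T i" using t_positive by (simp add: T_def)

text \<open>If \<open>a > e\<close>, then \<open>layer_T\<close>, or \<open>T (i + 1) = a T i\<close> for \<open>e = 0\<close>, makes \<open>T\<close> strictly increasing,
  which is impossible for positive integers indexed by all of \<open>\<int>\<close>. If \<open>a = e\<close>, then \<open>T\<close> increases weakly, so it is constant far
  to the left; there the defects vanish and the recurrence reads \<open>T = e T - e T\<close>.\<close>

lemma a_less_e: "a < e"
proof (rule ccontr)
  assume "\<not> a < e"
  then consider "e = 0" "2 \<le> a" | "e = 0" "a \<le> 1" | "1 \<le> e" "e < a" | "1 \<le> e" "a = e" by linarith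
  then show False
  proof cases
    case 1
    have "r i = 0" for i using layer[of i] 1 by auto
    then have "t (i + 1) = a * t i" for i using step[of i] 1 by simp
    then have "t i < t (i + 1)" for i using 1 t_positive[of i] by simp
    then show False using not_strictly_increasing[of t] by blast
  next
    case 2
    then show False using a_1 e_a_positive by (cases "a = 1") auto
  next
    case 3
    have "T i < T (i + 1)" for i
    proof -
      have "int e * T i < int a * T i" using 3 T_positive[of i] by simp
      also have "\<dots> \<le> int e * T (i + 1) - (int e - 1) * s (i + 1)" using layer_T[of "i + 1"] by simp
      also have "\<dots> \<le> int e * T (i + 1)" using 3 s_nonneg[of "i + 1"] by simp
      finally show ?thesis using 3 by simp
    qed
    then show False using not_strictly_increasing[of t] by (simp add: T_def)
  next
    case 4
    have e2: "2 \<le> e" using 4 a_1 by (cases "a = 1") auto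
    have le: "int e * T i \<le> int e * T (i + 1) - (int e - 1) * s (i + 1)" for i
      using layer_T[of "i + 1"] 4 by simp
    have "t i \<le> t (i + 1)" for i
    proof -
      have "int e * T i \<le> int e * T (i + 1)"
        using le[of i] mult_nonneg_nonneg[of "int e - 1" "s (i + 1)"] s_nonneg[of "i + 1"] 4 by linarith
      then show ?thesis using 4 by (simp add: T_def)
    qed
    then obtain n where n: "\<And>i. i \<le> n \<Longrightarrow> t i = t n"
      using eventually_constant_to_the_left[of 0 t] by blast
    have Tn: "T i = T n" if "i \<le> n" for i unfolding T_def n[OF that] by (rule refl)
    have s0: "s i = 0" if "i \<le> n" for i
    proof -
      have "(int e - 1) * s i \<le> 0" using le[of "i - 1"] Tn[of "i - 1"] Tn[of i] that by simp
      then show ?thesis using s_nonneg[of i] e2 by (simp add: mult_le_0_iff)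
    qed
    have "T n = 0" using recurrence[of "n - 1"] s0[of n] s0[of "n - 1"] Tn[of "n - 1"] Tn[of "n - 2"] 4 by simp
    then show False using T_positive[of n] by simp
  qed
qed

lemma a_positive: "1 \<le> a"
proof (rule ccontr)
  assume "\<not> 1 \<le> a"
  then have a: "a = 0" by simp
  then have "2 \<le> e" using not_1_0 a_less_e by linarith
  moreover have "r i = 0" for i using rad_le[of i] a by simp
  then have "t (i + 1) = e * t i" for i using step[of i] a by simp
  ultimately have "t i < t (i + 1)" for i using t_positive[of i] by simp
  then show False using not_strictly_increasing[of t] by blast
qed

text \<open>A simple direct summand of \<open>M\<^sub>i\<close> has strictly increasing Betti numbers, and its syzygies are
  direct summands of the modules \<open>M\<^sub>i\<^sub>+\<^sub>n\<close>.\<close>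

lemma not_bip_growth:
  assumes "\<not> bip i" shows "n < t (i + int n)"
proof -
  \<comment> \<open>The last conjunct is the bound on \<open>\<rho>\<close> by \<open>a\<close> times the preceding Betti number, which is at most
    \<open>\<tau> - 1\<close>.\<close>
  have "\<exists>\<tau> \<rho>. D (i + int n) \<tau> \<rho> \<and> n < \<tau> \<and> \<rho> + a \<le> a * \<tau>"
  proof (induction n)
    case 0
    then show ?case using not_bip[OF assms] by (intro exI[of _ 1] exI[of _ 0]) simp
  next
    case (Suc n)
    then obtain \<tau> \<rho> where D: "D (i + int n) \<tau> \<rho>" and \<tau>: "n < \<tau>" and \<rho>: "\<rho> + a \<le> a * \<tau>" by blast
    obtain \<tau>' \<rho>' where D': "D (i + int n + 1) \<tau>' \<rho>'" and eq: "\<tau>' + \<rho>' + \<rho> = (e + a) * \<tau>" and \<rho>': "\<rho>' \<le> a * \<tau>"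
      using D_step[OF D] by blast
    have "(a + 1) * \<tau> \<le> e * \<tau>" using a_less_e by (intro mult_le_mono1) simp
    then have "\<tau> + a \<le> \<tau>'" using eq \<rho> \<rho>' unfolding add_mult_distrib by linarith
    then have le: "\<tau> + 1 \<le> \<tau>'" using a_positive by linarith
    then have "a * (\<tau> + 1) \<le> a * \<tau>'" by (rule mult_le_mono2)
    then have "\<rho>' + a \<le> a * \<tau>'" using \<rho>' by simp
    moreover have "i + int n + 1 = i + int (Suc n)" by simp
    moreover have "Suc n < \<tau>'" using le \<tau> by linarith
    ultimately show ?case using D' by metis
  qed
  then show ?thesis using D_le less_le_trans by blast
qed

lemma eventually_bip:
  assumes i: "i \<le> - int (t 0)" shows "bip i"
proof (rule ccontr)
  assume "\<not> bip i"
  then have "nat (- i) < t (i + int (nat (- i)))" by (rule not_bip_growth)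
  moreover have "i + int (nat (- i)) = 0" using i by simp
  ultimately show False using i by simp
qed

text \<open>Far to the left the defects vanish and \<open>T\<close> satisfies a linear recurrence. The determinants \<open>d i\<close>
  of consecutive terms are multiplied by \<open>a\<close> in each step to the right, so \<open>d i\<close> is divisible by
  all powers of \<open>a\<close>. If \<open>a > 1\<close>, it is therefore zero, \<open>T\<close> is geometric, and its ratio is a
  root of \<open>X\<^sup>2 - e X + a\<close>, hence an integer. For \<open>a = 1\<close> this argument fails, and the existence of
  an element \<open>x\<close> with \<open>xJ = 0\<close> takes its place.\<close>

lemma nondecreasing_to_the_left:
  "\<exists>N. \<forall>i<N. t i \<le> t (i + 1)"
proof (cases "a = 1")
  case True
  then show ?thesis using a_1 by blast
next
  case False
  define N where "N = - int (t 0)"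
  have rec: "T (i + 1) = int e * T i - int a * T (i - 1)" if "i < N" for i
    using recurrence[of i] bip_s[OF eventually_bip, of i] bip_s[OF eventually_bip, of "i + 1"] that
    by (simp add: N_def)
  define d where "d i = T (i + 1) * T (i - 1) - T i * T i" for i
  have d_step: "d i = int a * d (i - 1)" if "i < N" for i
  proof -
    have 1: "T (i + 1) = int e * T i - int a * T (i - 1)" using rec[OF that] .
    have 2: "T i = int e * T (i - 1) - int a * T (i - 1 - 1)" using rec[of "i - 1"] that by simp
    have "d i = T i * (int e * T (i - 1) - T i) - int a * (T (i - 1) * T (i - 1))"
      unfolding d_def 1 by (simp add: algebra_simps)
    also have "int e * T (i - 1) - T i = int a * T (i - 1 - 1)" using 2 by simp
    finally show ?thesis by (simp add: d_def algebra_simps)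
  qed
  have d_pow: "d i = int a ^ n * d (i - int n)" if "i < N" for i n
  proof (induction n)
    case (Suc n)
    have "d (i - int n) = int a * d (i - int n - 1)" using that by (intro d_step) simp
    moreover have "i - int n - 1 = i - int (Suc n)" by simp
    ultimately show ?case using Suc by (simp add: mult_ac)
  qed simp
  have d_0: "d i = 0" if "i < N" for i
  proof (rule ccontr)
    assume nz: "d i \<noteq> 0"
    define n where "n = nat \<bar>d i\<bar>"
    have eq: "d i = int a ^ n * d (i - int n)" by (rule d_pow[OF that])
    then have "d (i - int n) \<noteq> 0" using nz by auto
    then have "int a ^ n * 1 \<le> int a ^ n * \<bar>d (i - int n)\<bar>" by (intro mult_left_mono) simp_all
    also have "\<dots> = \<bar>d i\<bar>" by (subst eq) (simp add: abs_mult)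
    finally have "int a ^ n \<le> int n" by (simp add: n_def)
    moreover have "(2::int) ^ n \<le> int a ^ n" using a_positive False by (intro power_mono) simp_all
    moreover have "int n < 2 ^ n" by simp
    ultimately show False by linarith
  qed
  have "t i \<le> t (i + 1)" if "i < N - 1" for i
  proof -
    have "T (i + 1) * T (i + 1) = T (i + 1 + 1) * T i" using d_0[of "i + 1"] that by (simp add: d_def)
    also have "T (i + 1 + 1) = int e * T (i + 1) - int a * T i" using rec[of "i + 1"] that by simp
    finally have "T i \<le> T (i + 1)" by (intro le_of_rational_root[OF T_positive T_positive])
    then show ?thesis by (simp add: T_def)
  qed
  then show ?thesis by blast
qed

lemma constant_to_the_left:
  obtains n where "\<And>i. i \<le> n \<Longrightarrow> t i = t n"
proof -
  obtain N where "\<And>i. i < N \<Longrightarrow> t i \<le> t (i + 1)" using nondecreasing_to_the_left by blast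
  then show thesis using eventually_constant_to_the_left[of N t] that by blast
qed

text \<open>A constant positive solution of the recurrence without defects forces \<open>1 = e - a\<close>.\<close>

lemma e_eq: "e = a + 1"
proof -
  obtain n where n: "\<And>i. i \<le> n \<Longrightarrow> t i = t n" using constant_to_the_left by blast
  define m where "m = min n (- int (t 0))"
  have Tn: "T i = T n" if "i \<le> n" for i unfolding T_def n[OF that] by (rule refl)
  have "T m = T n" "T (m - 1) = T n" "T (m - 2) = T n" by (rule Tn, simp add: m_def)+
  moreover have "s m = 0" "s (m - 1) = 0" by (intro bip_s eventually_bip, simp add: m_def)+
  ultimately have "T n * (int e - int a - 1) = 0"
    using recurrence[of "m - 1"] by (simp add: algebra_simps)
  then show ?thesis using T_positive[of n] by simp
qed

lemma difference: "T (i + 1) - T i = int a * (T i - T (i - 1)) + s i + s (i + 1)"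
  using recurrence[of i] e_eq by (simp add: algebra_simps)

text \<open>By \<open>difference\<close>, one strict increase forces strict increases from there on. If \<open>t\<close> is constant, then
  no \<open>M\<^sub>i\<close> has a simple summand, as that would make \<open>t\<close> unbounded. Otherwise let \<open>v\<close> be the last index
  up to which \<open>t\<close> is constant: the first increase equals the defect at \<open>v + 1\<close>, so \<open>M\<^sub>v\<^sub>+\<^sub>1\<close> is not
  bipartite.\<close>

theorem two_types:
  "\<exists>c. (\<exists>v. \<forall>i\<le>v. t i = c \<and> r i = a * c) \<and>
    ((\<forall>i. bip i \<and> t i = c \<and> r i = a * c) \<or>
     (\<exists>v. (\<forall>i\<le>v. t i = c \<and> r i = a * c) \<and> (\<forall>i\<ge>v. t i < t (i + 1)) \<and>
        \<not> bip (v + 1) \<and> (\<forall>i>v. r i < a * t i)))"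
proof -
  obtain n where n: "\<And>i. i \<le> n \<Longrightarrow> t i = t n" using constant_to_the_left by blast
  show ?thesis
  proof (cases "\<forall>i. t i = t n")
    case True
    have bip: "bip i" for i
    proof (rule ccontr)
      assume "\<not> bip i"
      then have "t n < t (i + int (t n))" by (rule not_bip_growth)
      also have "\<dots> = t n" by (rule True[rule_format])
      finally show False by simp
    qed
    have "bip i \<and> t i = t n \<and> r i = a * t n" for i
      using bip[of i] bip_rad[OF bip, of i] True[rule_format, of i] True[rule_format, of "i - 1"] by simp
    then show ?thesis by blast
  next
    case False
    then obtain i where "t i \<noteq> t n" by blast
    then have ex: "\<exists>k. t (n + int k) \<noteq> t n"
      using n[of i] by (cases "i \<le> n") (auto intro: exI[of _ "nat (i - n)"])
    define k where "k = (LEAST k. t (n + int k) \<noteq> t n)"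
    have k: "t (n + int k) \<noteq> t n" unfolding k_def by (rule LeastI_ex[OF ex])
    have k_min: "t (n + int j) = t n" if "j < k" for j using not_less_Least[of j] that unfolding k_def by blast
    define v where "v = n + int k - 1"
    have tv: "t i = t n" if "i \<le> v" for i
    proof (cases "i \<le> n")
      case False
      then show ?thesis using k_min[of "nat (i - n)"] that by (simp add: v_def)
    qed (rule n)
    have Tv: "T i = T n" if "i \<le> v" for i unfolding T_def tv[OF that] by (rule refl)
    have sv: "s i = 0" if "i \<le> v" for i
      using difference[of "i - 1"] Tv[of i] Tv[of "i - 1"] Tv[of "i - 2"] that
        s_nonneg[of i] s_nonneg[of "i - 1"] by simp
    have rv: "r i = a * t n" if "i \<le> v" for i
    proof -
      have "int (r i) = int (a * t n)" using sv[OF that] Tv[of "i - 1"] that by (simp add: s_def T_def)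
      then show ?thesis by (simp only: of_nat_eq_iff)
    qed
    have "T (v + 1) - T v = s (v + 1)" using difference[of v] sv[of v] Tv[of v] Tv[of "v - 1"] by simp
    moreover have "T (v + 1) \<noteq> T v" using k tv[of v] by (simp add: T_def v_def)
    ultimately have sv1: "0 < s (v + 1)" "T v < T (v + 1)" using s_nonneg[of "v + 1"] by linarith+
    have inc: "T i < T (i + 1)" if "v \<le> i" for i
      using that
    proof (induction i rule: int_ge_induct)
      case (step i)
      have "0 < int a * (T (i + 1) - T i)" using step a_positive by simp
      then show ?case using difference[of "i + 1"] s_nonneg[of "i + 1"] s_nonneg[of "i + 1 + 1"] by simp
    qed (rule sv1(2))
    have "\<not> bip (v + 1)" using bip_s[of "v + 1"] sv1(1) by auto
    moreover have "r i < a * t i" if "v < i" for i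
    proof -
      have "t (i - 1) < t i" using inc[of "i - 1"] that by (simp add: T_def)
      then show ?thesis using rad_le[of i] a_positive
        by (metis le_less_trans less_le_trans mult_less_mono2 zero_less_one)
    qed
    moreover have "t i < t (i + 1)" if "v \<le> i" for i using inc[OF that] by (simp add: T_def)
    ultimately show ?thesis using tv rv by blast
  qed
qed

end


section \<open>Short local algebras\<close>

context short_local_algebra
begin

lemma radical_maximal: "maximal_left_ideal A (radical A)"
proof -
  obtain I where I: "maximal_left_ideal A I" and un: "\<And>I'. maximal_left_ideal A I' \<Longrightarrow> I' = I"
    using unique_maximal by blast
  have "{I. maximal_left_ideal A I} = {I}"
  proof (rule subset_antisym)
    show "{I. maximal_left_ideal A I} \<subseteq> {I}" by (rule subsetI) (simp add: un)
    show "{I} \<subseteq> {I. maximal_left_ideal A I}" using I by simp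
  qed
  then have "radical A = carrier A \<inter> I" by (simp add: radical_def)
  moreover have "submodule I A (regular_module A)" using I by (simp add: maximal_left_ideal_def)
  then have "I \<subseteq> carrier A"
    using plain_left_module.submodule_subset[OF A.regular_module_plain, of I] by simp
  ultimately have "radical A = I" by auto
  then show ?thesis using I by simp
qed

lemma scalar_plus_radical:
  assumes x: "x \<in> carrier A"
  shows "\<exists>c\<in>carrier K. \<exists>j\<in>radical A. x = j \<oplus>\<^bsub>A\<^esub> c \<odot>\<^bsub>A\<^esub> \<one>\<^bsub>A\<^esub>"
proof -
  have J: "submodule (radical A) A (regular_module A)"
    using radical_maximal by (simp add: maximal_left_ideal_def)
  have z: "\<zero>\<^bsub>A\<^esub> \<in> radical A"
    using plain_left_module.submodule_zero[OF A.regular_module_plain J] by simp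
  have img: "(\<lambda>c. radical A +>\<^bsub>A\<^esub> (c \<odot>\<^bsub>A\<^esub> \<one>\<^bsub>A\<^esub>)) ` carrier K = carrier (A Quot radical A)"
    using residue_field by (simp add: ring_iso_def bij_betw_def)
  have "carrier (A Quot radical A) = (\<Union>u\<in>carrier A. {radical A +>\<^bsub>A\<^esub> u})"
    by (simp add: FactRing_def A_RCOSETS_def')
  then have "radical A +>\<^bsub>A\<^esub> x \<in> carrier (A Quot radical A)" using x by blast
  then have "radical A +>\<^bsub>A\<^esub> x \<in> (\<lambda>c. radical A +>\<^bsub>A\<^esub> (c \<odot>\<^bsub>A\<^esub> \<one>\<^bsub>A\<^esub>)) ` carrier K" unfolding img .
  then obtain c where c: "radical A +>\<^bsub>A\<^esub> x = radical A +>\<^bsub>A\<^esub> (c \<odot>\<^bsub>A\<^esub> \<one>\<^bsub>A\<^esub>)" "c \<in> carrier K"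
    by (rule imageE)
  have "x \<in> (\<Union>j\<in>radical A. {j \<oplus>\<^bsub>A\<^esub> x})" by (rule UN_I[OF z]) (use x in simp)
  then have "x \<in> (\<Union>j\<in>radical A. {j \<oplus>\<^bsub>A\<^esub> c \<odot>\<^bsub>A\<^esub> \<one>\<^bsub>A\<^esub>})" using c(1) unfolding a_r_coset_def' by simp
  then show ?thesis using c(2) by (elim UN_E singletonE) (intro bexI)
qed

text \<open>As \<open>A = J + K 1\<close>, the left ideal \<open>J\<close> is two-sided, and an element outside \<open>J\<close> is up to a scalar of
  the form \<open>1 + k\<close> with \<open>k\<close> nilpotent.\<close>

lemma short_local_ring_A: "short_local_ring A"
proof -
  interpret reg: plain_left_module A "regular_module A" by (rule A.regular_module_plain)
  let ?J = "radical A"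
  have J: "submodule ?J A (regular_module A)" and ne: "?J \<noteq> carrier A"
    using radical_maximal by (simp_all add: maximal_left_ideal_def)
  have Jc: "j \<in> carrier A" if "j \<in> ?J" for j using reg.submodule_subset[OF J] that by auto
  have left: "x \<otimes>\<^bsub>A\<^esub> j \<in> ?J" if "x \<in> carrier A" "j \<in> ?J" for x j
    using reg.submodule_smult[OF J that] by simp
  have add: "i \<oplus>\<^bsub>A\<^esub> j \<in> ?J" if "i \<in> ?J" "j \<in> ?J" for i j using reg.submodule_add[OF J that] by simp
  have scal: "c \<odot>\<^bsub>A\<^esub> j \<in> ?J" if "c \<in> carrier K" "j \<in> ?J" for c j
    using left[of "c \<odot>\<^bsub>A\<^esub> \<one>\<^bsub>A\<^esub>" j] that one_mult Jc by simp
  have one: "\<one>\<^bsub>A\<^esub> \<notin> ?J"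
  proof
    assume 1: "\<one>\<^bsub>A\<^esub> \<in> ?J"
    have "x \<in> ?J" if "x \<in> carrier A" for x using left[OF that 1] that by simp
    then show False using ne Jc by blast
  qed
  have right: "j \<otimes>\<^bsub>A\<^esub> x \<in> ?J" if j: "j \<in> ?J" and x: "x \<in> carrier A" for j x
  proof -
    obtain c i where ci: "c \<in> carrier K" "i \<in> ?J" "x = i \<oplus>\<^bsub>A\<^esub> c \<odot>\<^bsub>A\<^esub> \<one>\<^bsub>A\<^esub>"
      using scalar_plus_radical[OF x] by blast
    have eq: "j \<otimes>\<^bsub>A\<^esub> x = j \<otimes>\<^bsub>A\<^esub> i \<oplus>\<^bsub>A\<^esub> c \<odot>\<^bsub>A\<^esub> j"
      unfolding ci(3) using ci(1) Jc[OF ci(2)] Jc[OF j] by (simp add: A.r_distr smult_mult_right)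
    show ?thesis unfolding eq by (rule add[OF left[OF Jc[OF j] ci(2)] scal[OF ci(1) j]])
  qed
  have nil: "i \<otimes>\<^bsub>A\<^esub> (j \<otimes>\<^bsub>A\<^esub> k) = \<zero>\<^bsub>A\<^esub>" if "i \<in> ?J" "j \<in> ?J" "k \<in> ?J" for i j k
  proof -
    have "(i \<otimes>\<^bsub>A\<^esub> j) \<otimes>\<^bsub>A\<^esub> k \<in> radical A \<cdot>\<^bsub>A\<^esub> radical A \<cdot>\<^bsub>A\<^esub> radical A"
      by (rule ideal_prod.prod[OF ideal_prod.prod[OF that(1,2)] that(3)])
    then show ?thesis unfolding rad_cube using that Jc by (simp add: A.m_assoc)
  qed
  have inv: "\<exists>y\<in>carrier A. y \<otimes>\<^bsub>A\<^esub> x = \<one>\<^bsub>A\<^esub>" if x: "x \<in> carrier A" "x \<notin> ?J" for x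
  proof -
    obtain c i where ci: "c \<in> carrier K" "i \<in> ?J" "x = i \<oplus>\<^bsub>A\<^esub> c \<odot>\<^bsub>A\<^esub> \<one>\<^bsub>A\<^esub>"
      using scalar_plus_radical[OF x(1)] by blast
    have "c \<noteq> \<zero>\<^bsub>K\<^esub>" using ci x Jc by auto
    note c = AK.inverse[OF ci(1) this]
    let ?u = "inv\<^bsub>K\<^esub> c"
    define k where "k = ?u \<odot>\<^bsub>A\<^esub> i"
    have k: "k \<in> ?J" "k \<in> carrier A" unfolding k_def using scal[OF c(1) ci(2)] Jc by simp_all
    have ux: "(?u \<odot>\<^bsub>A\<^esub> \<one>\<^bsub>A\<^esub>) \<otimes>\<^bsub>A\<^esub> x = k \<oplus>\<^bsub>A\<^esub> \<one>\<^bsub>A\<^esub>"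
      using ci c Jc[OF ci(2)] by (simp add: one_mult k_def smult_r_distr smult_assoc1[symmetric])
    \<comment> \<open>The geometric series for the inverse of \<open>1 + k\<close> ends after \<open>k\<^sup>2\<close>.\<close>
    let ?g = "\<one>\<^bsub>A\<^esub> \<oplus>\<^bsub>A\<^esub> \<ominus>\<^bsub>A\<^esub> k \<oplus>\<^bsub>A\<^esub> k \<otimes>\<^bsub>A\<^esub> k"
    have k3: "(k \<otimes>\<^bsub>A\<^esub> k) \<otimes>\<^bsub>A\<^esub> k = \<zero>\<^bsub>A\<^esub>" using nil[OF k(1) k(1) k(1)] k(2) by (simp add: A.m_assoc)
    have "?g \<otimes>\<^bsub>A\<^esub> (k \<oplus>\<^bsub>A\<^esub> \<one>\<^bsub>A\<^esub>) = ?g \<otimes>\<^bsub>A\<^esub> k \<oplus>\<^bsub>A\<^esub> ?g" using k(2) by (simp add: A.r_distr)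
    also have "?g \<otimes>\<^bsub>A\<^esub> k = k \<oplus>\<^bsub>A\<^esub> \<ominus>\<^bsub>A\<^esub> (k \<otimes>\<^bsub>A\<^esub> k)" using k(2) k3 by (simp add: A.l_distr A.l_minus)
    also have "(k \<oplus>\<^bsub>A\<^esub> \<ominus>\<^bsub>A\<^esub> (k \<otimes>\<^bsub>A\<^esub> k)) \<oplus>\<^bsub>A\<^esub> ?g
        = (k \<oplus>\<^bsub>A\<^esub> \<ominus>\<^bsub>A\<^esub> k) \<oplus>\<^bsub>A\<^esub> (k \<otimes>\<^bsub>A\<^esub> k \<oplus>\<^bsub>A\<^esub> \<ominus>\<^bsub>A\<^esub> (k \<otimes>\<^bsub>A\<^esub> k)) \<oplus>\<^bsub>A\<^esub> \<one>\<^bsub>A\<^esub>"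
      using k(2) by (simp only: M.a_ac A.m_closed M.a_inv_closed A.one_closed M.a_closed)
    also have "\<dots> = \<one>\<^bsub>A\<^esub>" using k(2) by (simp add: M.r_neg)
    finally have "(?g \<otimes>\<^bsub>A\<^esub> (?u \<odot>\<^bsub>A\<^esub> \<one>\<^bsub>A\<^esub>)) \<otimes>\<^bsub>A\<^esub> x = \<one>\<^bsub>A\<^esub>"
      using k(2) c(1) x(1) by (simp add: A.m_assoc ux)
    moreover have "?g \<otimes>\<^bsub>A\<^esub> (?u \<odot>\<^bsub>A\<^esub> \<one>\<^bsub>A\<^esub>) \<in> carrier A" using k(2) c(1) by simp
    ultimately show ?thesis by blast
  qed
  show ?thesis
    by (rule short_local_ring.intro[OF A.ring_axioms
          short_local_ring_axioms.intro[OF J right one inv nil finite_length_regular]])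
qed

sublocale L: short_local_ring A by (rule short_local_ring_A)

lemma hilbert_type_eq: "hilbert_type A = (L.e, L.a)"
proof -
  interpret J: plain_left_module A "sub_module (regular_module A) L.J"
    by (rule L.reg.sub_module_plain[OF L.rad_left])
  have J2: "submodule L.J2 A (sub_module (regular_module A) L.J)"
    using L.reg.submodule_sub_module_iff[OF L.rad_left] L.J2_left L.J2_sub by simp
  have fin: "finite_interval A (sub_module (regular_module A) L.J) L.J2 L.J"
    using L.reg.interval_length_sub_module(2)[OF L.rad_left order_refl] by simp
  have "module_length A (quotient_module (sub_module (regular_module A) L.J) L.J2) = L.e"
    using J.module_length_quotient[OF J2] fin L.reg.interval_length_sub_module(1)[OF L.rad_left order_refl]
    by (simp add: L.e_def)
  moreover have "module_length A (sub_module (regular_module A) L.J2) = L.a"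
    using L.reg.module_length_sub_module[OF L.J2_left] by (simp add: L.a_def)
  ultimately show ?thesis by (simp add: hilbert_type_def Let_def)
qed

text \<open>Take a functional \<open>l\<close> that does not vanish on the one-dimensional ideal \<open>S\<close>. As \<open>A\<close> is not
  self-injective, the form \<open>l (x y)\<close> is degenerate, and any \<open>b\<close> that is orthogonal to everything
  will do.\<close>

lemma orthogonal_element:
  assumes not_inj: "\<not> self_injective A"
    and S: "submodule S A (regular_module A)"
    and len: "interval_length A (regular_module A) {\<zero>\<^bsub>A\<^esub>} S = 1"
    and JS: "\<And>j x. \<lbrakk>j \<in> L.J; x \<in> S\<rbrakk> \<Longrightarrow> j \<otimes>\<^bsub>A\<^esub> x = \<zero>\<^bsub>A\<^esub>"
  shows "\<exists>b\<in>L.J. b \<notin> S \<and> (\<forall>y\<in>carrier A. b \<otimes>\<^bsub>A\<^esub> y \<in> S \<longrightarrow> b \<otimes>\<^bsub>A\<^esub> y = \<zero>\<^bsub>A\<^esub>)"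
proof -
  note reg_d = L.reg.submodule_zero[OF S] L.reg.submodule_subset[OF S]
  have "S \<noteq> {\<zero>\<^bsub>A\<^esub>}" using len L.reg.interval_length_self(1)[OF L.zero_left] by auto
  then obtain w where w: "w \<in> S" "w \<noteq> \<zero>\<^bsub>A\<^esub>" using reg_d by auto
  have wc: "w \<in> carrier A" using w(1) reg_d by auto
  let ?W = "(\<lambda>b. b \<otimes>\<^bsub>A\<^esub> w) ` carrier A"
  have W: "submodule ?W A (regular_module A)" using L.reg.submodule_multiples[OF L.R_left, of w] wc by simp
  have WS: "?W \<subseteq> S" by (rule image_subsetI) (use L.reg.submodule_smult[OF S _ w(1)] in simp)
  have wW: "w \<in> ?W" by (rule image_eqI[of _ _ "\<one>\<^bsub>A\<^esub>"]) (use wc in simp_all)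
  have zW: "{\<zero>\<^bsub>A\<^esub>} \<subseteq> ?W" using L.reg.submodule_zero[OF W] by simp
  have "{\<zero>\<^bsub>A\<^esub>} \<subset> ?W" using zW wW w(2) by auto
  then have "0 < interval_length A (regular_module A) {\<zero>\<^bsub>A\<^esub>} ?W"
    using L.reg.interval_length_strict_mono[OF L.finite_reg L.zero_left W order_refl] by simp
  then have "\<not> ?W \<subset> S"
    using L.reg.interval_length_strict_mono[OF L.finite_reg L.zero_left S zW] len by auto
  then have SW: "S = ?W" using WS by auto
  have "submodule {\<zero>\<^bsub>A\<^esub>} K A\<^sub>K" using AK.submodule_0 by simp
  then obtain l where l: "l \<in> left_module_hom K A\<^sub>K (regular_module K)" "l w = \<one>\<^bsub>K\<^esub>"
    using AK.functional_separating[of "{\<zero>\<^bsub>A\<^esub>}" w] w(2) wc by auto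
  have "\<not> frobenius_form K A l" using frobenius_form.self_injective not_inj by blast
  then have "\<not> frobenius_form_axioms K A l"
    using fd_algebra_axioms unfolding frobenius_form_def by blast
  then obtain b where b: "b \<in> carrier A" "b \<noteq> \<zero>\<^bsub>A\<^esub>" and lb: "\<And>y. y \<in> carrier A \<Longrightarrow> l (b \<otimes>\<^bsub>A\<^esub> y) = \<zero>\<^bsub>K\<^esub>"
    using l(1) unfolding frobenius_form_axioms_def by blast
  have l_smult: "l (c \<odot>\<^bsub>A\<^esub> x) = c \<otimes>\<^bsub>K\<^esub> l x" if "c \<in> carrier K" "x \<in> carrier A" for c x
    using l(1) that one_mult by (auto simp: left_module_hom_def)
  have S0: "x = \<zero>\<^bsub>A\<^esub>" if x: "x \<in> S" "l x = \<zero>\<^bsub>K\<^esub>" for x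
  proof -
    obtain y where y: "y \<in> carrier A" "x = y \<otimes>\<^bsub>A\<^esub> w" using x(1) unfolding SW by auto
    obtain c j where c: "c \<in> carrier K" "j \<in> L.J" "y = j \<oplus>\<^bsub>A\<^esub> c \<odot>\<^bsub>A\<^esub> \<one>\<^bsub>A\<^esub>"
      using scalar_plus_radical[OF y(1)] by blast
    have "x = c \<odot>\<^bsub>A\<^esub> w"
      unfolding y(2) c(3) using c wc JS[OF c(2) w(1)] L.J_closed by (simp add: A.l_distr one_mult)
    then show ?thesis using x(2) l_smult[OF c(1) wc] l(2) c(1) wc by simp
  qed
  have "b \<in> L.J"
  proof (rule ccontr)
    assume "b \<notin> L.J"
    then obtain y where y: "y \<in> carrier A" "y \<otimes>\<^bsub>A\<^esub> b = \<one>\<^bsub>A\<^esub>" using L.left_inverse b(1) by blast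
    have "y \<notin> L.J" using L.rad_right[of y b] L.one_notin_rad y b(1) by auto
    then obtain z where z: "z \<in> carrier A" "z \<otimes>\<^bsub>A\<^esub> y = \<one>\<^bsub>A\<^esub>" using L.left_inverse y(1) by blast
    have "z = z \<otimes>\<^bsub>A\<^esub> (y \<otimes>\<^bsub>A\<^esub> b)" using y z by simp
    also have "\<dots> = b" using y(1) z b(1) by (simp add: A.m_assoc[symmetric])
    finally have "b \<otimes>\<^bsub>A\<^esub> (y \<otimes>\<^bsub>A\<^esub> w) = w" using z y(1) b(1) wc by (simp add: A.m_assoc[symmetric])
    then have "l w = \<zero>\<^bsub>K\<^esub>" using lb[of "y \<otimes>\<^bsub>A\<^esub> w"] y(1) wc by simp
    then show False using l(2) K.one_not_zero by simp
  qed
  moreover have "b \<notin> S" using S0[of b] lb[of "\<one>\<^bsub>A\<^esub>"] b by auto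
  moreover have "b \<otimes>\<^bsub>A\<^esub> y = \<zero>\<^bsub>A\<^esub>" if "y \<in> carrier A" "b \<otimes>\<^bsub>A\<^esub> y \<in> S" for y
    by (rule S0[OF that(2) lb[OF that(1)]])
  ultimately show ?thesis by blast
qed

text \<open>Here \<open>J\<close> itself is the one-dimensional ideal, which leaves no room for the orthogonal element.\<close>

lemma not_self_injective_1_0:
  assumes "\<not> self_injective A" shows "\<not> (L.e = 1 \<and> L.a = 0)"
proof
  assume ea: "L.e = 1 \<and> L.a = 0"
  have z: "{\<zero>\<^bsub>A\<^esub>} \<subseteq> L.J2" using L.reg.submodule_zero[OF L.J2_left] by simp
  have "\<not> {\<zero>\<^bsub>A\<^esub>} \<subset> L.J2"
    using L.reg.interval_length_strict_mono[OF L.finite_reg L.zero_left L.J2_left order_refl] ea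
    by (auto simp: L.a_def)
  then have J2: "L.J2 = {\<zero>\<^bsub>A\<^esub>}" using z by auto
  have "j \<otimes>\<^bsub>A\<^esub> x = \<zero>\<^bsub>A\<^esub>" if "j \<in> L.J" "x \<in> L.J" for j x using ideal_prod.prod[OF that, of A] J2 by simp
  then have "\<exists>b\<in>L.J. b \<notin> L.J \<and> (\<forall>y\<in>carrier A. b \<otimes>\<^bsub>A\<^esub> y \<in> L.J \<longrightarrow> b \<otimes>\<^bsub>A\<^esub> y = \<zero>\<^bsub>A\<^esub>)"
    using ea J2 by (intro orthogonal_element[OF assms L.rad_left]) (simp_all add: L.e_def)
  then show False by blast
qed

text \<open>Here \<open>J\<^sup>2\<close> is the one-dimensional ideal, and it contains \<open>bJ\<close> for the orthogonal element \<open>b\<close>.\<close>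

lemma not_self_injective_a_1:
  assumes "\<not> self_injective A" and a: "L.a = 1"
  shows "\<exists>x\<in>L.J. x \<notin> L.J2 \<and> (\<forall>j\<in>L.J. x \<otimes>\<^bsub>A\<^esub> j = \<zero>\<^bsub>A\<^esub>)"
proof -
  have "j \<otimes>\<^bsub>A\<^esub> x = \<zero>\<^bsub>A\<^esub>" if j: "j \<in> L.J" and x: "x \<in> L.J2" for j x
    using x
  proof (induction rule: ideal_prod.induct)
    case (prod i k)
    then show ?case using L.rad_nilpotent[OF j] by simp
  next
    case (sum x y)
    then have "x \<in> carrier A" "y \<in> carrier A" using L.J2_sub L.J_closed by blast+
    then show ?case using sum L.J_closed[OF j] by (simp add: A.r_distr)
  qed
  then obtain b where b: "b \<in> L.J" "b \<notin> L.J2"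
    and eq: "\<And>y. \<lbrakk>y \<in> carrier A; b \<otimes>\<^bsub>A\<^esub> y \<in> L.J2\<rbrakk> \<Longrightarrow> b \<otimes>\<^bsub>A\<^esub> y = \<zero>\<^bsub>A\<^esub>"
    using orthogonal_element[OF assms(1) L.J2_left] a unfolding L.a_def by blast
  have "b \<otimes>\<^bsub>A\<^esub> j = \<zero>\<^bsub>A\<^esub>" if "j \<in> L.J" for j
    by (rule eq[OF L.J_closed[OF that] ideal_prod.prod[OF b(1) that]])
  then show ?thesis using b by blast
qed

text \<open>If \<open>e = 1\<close> then \<open>J = Ax + J\<^sup>2\<close>, so \<open>xJ = 0\<close> would give \<open>J\<^sup>2 = 0\<close>.\<close>

lemma e_ge_2:
  assumes x: "x \<in> L.J" "x \<notin> L.J2" and xJ: "\<And>j. j \<in> L.J \<Longrightarrow> x \<otimes>\<^bsub>A\<^esub> j = \<zero>\<^bsub>A\<^esub>" and a: "L.a \<noteq> 0"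
  shows "2 \<le> L.e"
proof (rule ccontr)
  assume "\<not> 2 \<le> L.e"
  then have e: "L.e \<le> 1" by simp
  have xc: "x \<in> carrier A" using x(1) by (rule L.J_closed)
  let ?X = "(\<lambda>b. b \<otimes>\<^bsub>A\<^esub> x) ` carrier A"
  have X: "submodule ?X A (regular_module A)" using L.reg.submodule_multiples[OF L.R_left, of x] xc by simp
  let ?L = "L.J2 <+>\<^bsub>regular_module A\<^esub> ?X"
  have L: "submodule ?L A (regular_module A)" by (rule L.reg.submodule_set_add[OF L.J2_left X])
  have J2L: "L.J2 \<subseteq> ?L" by (rule L.reg.set_add_upper1[OF L.J2_left X])
  have XJ: "?X \<subseteq> L.J" by (rule image_subsetI) (use L.reg.submodule_smult[OF L.rad_left _ x(1)] in simp)
  have LJ: "?L \<subseteq> L.J" by (rule L.reg.set_add_least[OF L.rad_left L.J2_sub XJ])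
  have "x \<in> ?X" by (rule image_eqI[of _ _ "\<one>\<^bsub>A\<^esub>"]) (use xc in simp_all)
  then have "x \<in> ?L" by (rule subsetD[OF L.reg.set_add_upper2[OF L.J2_left X]])
  then have "L.J2 \<subset> ?L" using x(2) J2L by auto
  then have "0 < interval_length A (regular_module A) L.J2 ?L"
    using L.reg.interval_length_strict_mono[OF L.finite_reg L.J2_left L order_refl] by (metis gr_zeroI not_less_zero)
  then have "\<not> ?L \<subset> L.J"
    using L.reg.interval_length_strict_mono[OF L.finite_reg L.J2_left L.rad_left J2L] e by (force simp: L.e_def)
  then have JL: "L.J = ?L" using LJ by auto
  have "i \<otimes>\<^bsub>A\<^esub> j \<in> {\<zero>\<^bsub>A\<^esub>}" if i: "i \<in> L.J" and j: "j \<in> L.J" for i j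
  proof -
    have "i \<in> ?L" using i JL by simp
    then obtain y z where yz: "y \<in> L.J2" "z \<in> ?X" "i = y \<oplus>\<^bsub>A\<^esub> z"
      unfolding L.reg.mem_set_add by auto
    then obtain b where b: "b \<in> carrier A" "z = b \<otimes>\<^bsub>A\<^esub> x" by auto
    have jc: "j \<in> carrier A" using j by (rule L.J_closed)
    have yc: "y \<in> carrier A" using yz(1) L.J2_sub L.J_closed by blast
    have "z \<otimes>\<^bsub>A\<^esub> j = \<zero>\<^bsub>A\<^esub>" unfolding b(2) using b(1) xc jc xJ[OF j] by (simp add: A.m_assoc)
    moreover have "y \<otimes>\<^bsub>A\<^esub> j \<in> L.J2 \<cdot>\<^bsub>A\<^esub> L.J" by (rule ideal_prod.prod[OF yz(1) j])
    then have "y \<otimes>\<^bsub>A\<^esub> j = \<zero>\<^bsub>A\<^esub>" unfolding rad_cube by simp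
    moreover have "z \<in> carrier A" using b xc by simp
    ultimately show ?thesis unfolding yz(3) using yc jc by (simp add: A.l_distr)
  qed
  then have "L.J2 \<subseteq> {\<zero>\<^bsub>A\<^esub>}" by (rule L.J2_least[OF L.zero_left])
  then have "L.J2 = {\<zero>\<^bsub>A\<^esub>}" using L.reg.submodule_zero[OF L.J2_left] by auto
  then show False using a L.reg.interval_length_self(1)[OF L.zero_left] by (simp add: L.a_def)
qed

end

theorem theorem1p3:
  fixes K :: "('k, 'r) ring_scheme" and A :: "('k, 'a, 's) module_scheme"
    and P :: "int \<Rightarrow> ('a, 'm) module" and d :: "int \<Rightarrow> 'm \<Rightarrow> 'm"
    and e a :: nat
  assumes "short_local_algebra K A"
    and "hilbert_type A = (e, a)"
    and "\<not> self_injective A"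
    and "exact_projective_complex A P d"
    and "minimal_complex A P d"
    and "nonzero_complex P"
  defines "M \<equiv> image_module P d"
  shows "1 \<le> a \<and> a = e - 1 \<and>
    (\<exists>n::int. \<forall>i\<le>n. bipartite A (M i)) \<and>
    (\<forall>i. top_length A (P i) = top_length A (M i)) \<and>
    (\<exists>t::nat.
      (\<exists>v::int. \<forall>i\<le>v. top_length A (P i) = t \<and> dim_vector A (M i) = (t, a * t)) \<and>
      ((\<forall>i. bipartite A (M i) \<and> dim_vector A (M i) = (t, a * t) \<and> top_length A (P i) = t)
       \<or>
       (\<exists>v::int.
          (\<forall>i\<le>v. top_length A (P i) = t \<and> dim_vector A (M i) = (t, a * t)) \<and>
          (\<forall>i\<ge>v. top_length A (P (i + 1)) > top_length A (P i)) \<and>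
          \<not> bipartite A (M (v + 1)) \<and>
          (\<forall>i>v. rad_length A (M i) < a * top_length A (P i)))))"
proof -
  interpret short_local_algebra K A by fact
  interpret C: minimal_exact_complex A P d
    by (rule minimal_exact_complex.intro[OF L.short_local_ring_axioms
          minimal_exact_complex_axioms.intro[OF assms(4,5)]])
  have ea: "e = L.e" "a = L.a" using assms(2) hilbert_type_eq by simp_all
  have a_1: "2 \<le> L.e \<and> (\<forall>i. C.t i \<le> C.t (i + 1))" if "L.a = 1"
  proof -
    obtain x where "x \<in> L.J" "x \<notin> L.J2" "\<And>j. j \<in> L.J \<Longrightarrow> x \<otimes>\<^bsub>A\<^esub> j = \<zero>\<^bsub>A\<^esub>"
      using not_self_injective_a_1[OF assms(3) \<open>L.a = 1\<close>] by blast
    then show ?thesis using C.nondecreasing[of x] e_ge_2[of x] \<open>L.a = 1\<close> by simp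
  qed
  interpret B: betti_sequence L.e L.a C.t C.r "\<lambda>i. bipartite A (image_module P d i)" C.summand
    by (rule betti_sequence.intro, rule C.dimension_step, rule C.rad_bound, rule C.layer_bound,
        rule C.t_positive[OF assms(6)], erule C.bipartite_imp, erule C.not_bipartite_summand,
        erule C.summand_le, erule C.summand_step, rule not_self_injective_1_0[OF assms(3)], erule a_1)
  obtain c where left: "\<exists>v. \<forall>i\<le>v. C.t i = c \<and> C.r i = L.a * c"
    and types: "(\<forall>i. bipartite A (M i) \<and> C.t i = c \<and> C.r i = L.a * c) \<or>
      (\<exists>v. (\<forall>i\<le>v. C.t i = c \<and> C.r i = L.a * c) \<and> (\<forall>i\<ge>v. C.t i < C.t (i + 1)) \<and>
        \<not> bipartite A (M (v + 1)) \<and> (\<forall>i>v. C.r i < L.a * C.t i))"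
    using B.two_types unfolding M_def by blast
  have dim: "dim_vector A (M i) = (c, L.a * c) \<longleftrightarrow> C.t i = c \<and> C.r i = L.a * c" for i
    by (simp add: M_def C.lengths ea)
  have rad: "rad_length A (M i) = C.r i" for i unfolding M_def by (rule C.lengths)
  show ?thesis
  proof (intro conjI exI[of _ c])
    show "1 \<le> a" "a = e - 1" using B.a_positive B.e_eq ea by simp_all
    show "\<exists>n. \<forall>i\<le>n. bipartite A (M i)" unfolding M_def using B.eventually_bip by blast
    show "\<forall>i. top_length A (P i) = top_length A (M i)" unfolding M_def by (simp add: C.lengths)
    show "\<exists>v. \<forall>i\<le>v. top_length A (P i) = c \<and> dim_vector A (M i) = (c, a * c)"
      unfolding ea(2) dim C.lengths(1) using left by simp
    show "(\<forall>i. bipartite A (M i) \<and> dim_vector A (M i) = (c, a * c) \<and> top_length A (P i) = c) \<or>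
      (\<exists>v. (\<forall>i\<le>v. top_length A (P i) = c \<and> dim_vector A (M i) = (c, a * c)) \<and>
        (\<forall>i\<ge>v. top_length A (P i) < top_length A (P (i + 1))) \<and>
        \<not> bipartite A (M (v + 1)) \<and> (\<forall>i>v. rad_length A (M i) < a * top_length A (P i)))"
      using types
    proof (rule disj_forward)
    qed (simp_all add: dim rad C.lengths(1) ea(2))
  qed
qed

end
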